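(* Let $H=(V,F)$ be a connected hypergraph with $n$ vertices, $m$ hyperedges and diameter $d$, and let $V_s, V_t$ be two vertex covers of $H$ of size $k$. Then one can compute, in $\mathcal{O}(n^{3.5}+n^2 m)$ time, a reconfiguration sequence from $V_s$ to $V_t$ under $(k,1)$-Token Jumping consisting of $\mathcal{O}(n\cdot d)$ moves, all of whose configurations are vertex covers of $H$ of size $k$.
   Context: A vertex cover of a hypergraph is a set of vertices intersecting every hyperedge. In a hypergraph $H$, a path is a sequence of vertices $v_1,\dots,v_\ell$ where $v_i$ and $v_{i+1}$ share a hyperedge; its length is $\ell-1$; $\mathrm{dist}_H$ is the minimum length of a path. A configuration is a set of $k$ vertices (tokens on distinct vertices). A move under $(k,1)$-Token Jumping from configuration $D$ to $D'$ is a bijection $f: D\to D'$ with $\mathrm{dist}_H(v,f(v))\leq 1$ for all $v\in D$ (all tokens may move simultaneously, each to a vertex at distance at most 1). A reconfiguration sequence is a sequence of configurations, each a vertex cover of size $k$, with a move between every two consecutive ones. *)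

theory Defs
  imports Complex_Main "HOL-Library.Extended_Nat"
begin

definition hypergraph :: "'a set \<Rightarrow> 'a set set \<Rightarrow> bool" where
  "hypergraph V F \<longleftrightarrow> finite V \<and> V \<noteq> {} \<and> F \<subseteq> Pow V"

definition vertex_cover :: "'a set \<Rightarrow> 'a set set \<Rightarrow> 'a set \<Rightarrow> bool" where
  "vertex_cover V F C \<longleftrightarrow> C \<subseteq> V \<and> (\<forall>e\<in>F. e \<inter> C \<noteq> {})"

definition hpath :: "'a set \<Rightarrow> 'a set set \<Rightarrow> 'a \<Rightarrow> 'a list \<Rightarrow> 'a \<Rightarrow> bool" where
  "hpath V F u p v \<longleftrightarrow> p \<noteq> [] \<and> hd p = u \<and> last p = v \<and> set p \<subseteq> V \<and>
     (\<forall>i. Suc i < length p \<longrightarrow> (\<exists>e\<in>F. p ! i \<in> e \<and> p ! Suc i \<in> e))"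

text \<open>The distance is \<open>\<infinity>\<close> when no path exists.\<close>

definition hdist :: "'a set \<Rightarrow> 'a set set \<Rightarrow> 'a \<Rightarrow> 'a \<Rightarrow> enat" where
  "hdist V F u v = (INF p\<in>{p. hpath V F u p v}. enat (length p - 1))"

definition hconnected :: "'a set \<Rightarrow> 'a set set \<Rightarrow> bool" where
  "hconnected V F \<longleftrightarrow> (\<forall>u\<in>V. \<forall>v\<in>V. \<exists>p. hpath V F u p v)"

definition hdiam :: "'a set \<Rightarrow> 'a set set \<Rightarrow> enat" where
  "hdiam V F = (SUP (u, v)\<in>V \<times> V. hdist V F u v)"

definition tj_move :: "'a set \<Rightarrow> 'a set set \<Rightarrow> 'a set \<Rightarrow> 'a set \<Rightarrow> bool" where
  "tj_move V F D D' \<longleftrightarrow> (\<exists>f. bij_betw f D D' \<and> (\<forall>v\<in>D. hdist V F v (f v) \<le> 1))"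

definition reconf_seq :: "'a set \<Rightarrow> 'a set set \<Rightarrow> nat \<Rightarrow> 'a set list \<Rightarrow> bool" where
  "reconf_seq V F k Ds \<longleftrightarrow> Ds \<noteq> [] \<and>
     (\<forall>D\<in>set Ds. vertex_cover V F D \<and> card D = k) \<and>
     (\<forall>i. Suc i < length Ds \<longrightarrow> tj_move V F (Ds ! i) (Ds ! Suc i))"

text \<open>
  Running time is measured on a word RAM programmed in a structured language. A state consists of
  registers and arrays of natural numbers; a program mentions only finitely many of them. Every
  syntactic node that is evaluated costs one time unit. The parameter \<open>B\<close> of the semantics is the
  word bound: every value and address produced during a run must be smaller than \<open>B\<close>, otherwise
  the run is stuck.
\<close>

datatype aexp =
    Const nat
  | Reg nat
  | Arr nat aexp
  | Add aexp aexp
  | Sub aexp aexp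
  | Mul aexp aexp

datatype bexp =
    Less aexp aexp
  | Equal aexp aexp
  | Neg bexp
  | Conj bexp bexp

datatype com =
    Skip
  | Assign nat aexp
  | Store nat aexp aexp
  | Seq com com
  | Cond bexp com com
  | While bexp com

record state =
  reg :: "nat \<Rightarrow> nat"
  arr :: "nat \<Rightarrow> nat \<Rightarrow> nat"

fun aval :: "aexp \<Rightarrow> state \<Rightarrow> nat" where
  "aval (Const c) s = c"
| "aval (Reg x) s = reg s x"
| "aval (Arr A i) s = arr s A (aval i s)"
| "aval (Add a b) s = aval a s + aval b s"
| "aval (Sub a b) s = aval a s - aval b s"
| "aval (Mul a b) s = aval a s * aval b s"

fun acost :: "aexp \<Rightarrow> nat" where
  "acost (Const c) = 1"
| "acost (Reg x) = 1"
| "acost (Arr A i) = 1 + acost i"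
| "acost (Add a b) = 1 + acost a + acost b"
| "acost (Sub a b) = 1 + acost a + acost b"
| "acost (Mul a b) = 1 + acost a + acost b"

fun afits :: "nat \<Rightarrow> aexp \<Rightarrow> state \<Rightarrow> bool" where
  "afits B (Const c) s \<longleftrightarrow> c < B"
| "afits B (Reg x) s \<longleftrightarrow> reg s x < B"
| "afits B (Arr A i) s \<longleftrightarrow> afits B i s \<and> arr s A (aval i s) < B"
| "afits B (Add a b) s \<longleftrightarrow> afits B a s \<and> afits B b s \<and> aval a s + aval b s < B"
| "afits B (Sub a b) s \<longleftrightarrow> afits B a s \<and> afits B b s"
| "afits B (Mul a b) s \<longleftrightarrow> afits B a s \<and> afits B b s \<and> aval a s * aval b s < B"

fun bval :: "bexp \<Rightarrow> state \<Rightarrow> bool" where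
  "bval (Less a b) s \<longleftrightarrow> aval a s < aval b s"
| "bval (Equal a b) s \<longleftrightarrow> aval a s = aval b s"
| "bval (Neg b) s \<longleftrightarrow> \<not> bval b s"
| "bval (Conj b c) s \<longleftrightarrow> bval b s \<and> bval c s"

fun bcost :: "bexp \<Rightarrow> nat" where
  "bcost (Less a b) = 1 + acost a + acost b"
| "bcost (Equal a b) = 1 + acost a + acost b"
| "bcost (Neg b) = 1 + bcost b"
| "bcost (Conj b c) = 1 + bcost b + bcost c"

fun bfits :: "nat \<Rightarrow> bexp \<Rightarrow> state \<Rightarrow> bool" where
  "bfits B (Less a b) s \<longleftrightarrow> afits B a s \<and> afits B b s"
| "bfits B (Equal a b) s \<longleftrightarrow> afits B a s \<and> afits B b s"
| "bfits B (Neg b) s \<longleftrightarrow> bfits B b s"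
| "bfits B (Conj b c) s \<longleftrightarrow> bfits B b s \<and> bfits B c s"

definition set_reg :: "nat \<Rightarrow> nat \<Rightarrow> state \<Rightarrow> state" where
  "set_reg x v s = s\<lparr>reg := (reg s)(x := v)\<rparr>"

definition set_arr :: "nat \<Rightarrow> nat \<Rightarrow> nat \<Rightarrow> state \<Rightarrow> state" where
  "set_arr A i v s = s\<lparr>arr := (arr s)(A := (arr s A)(i := v))\<rparr>"

text \<open>\<open>exec B c s t s'\<close>: started in \<open>s\<close>, program \<open>c\<close> halts in \<open>s'\<close> after exactly \<open>t\<close> time units,
  with all values below \<open>B\<close>.\<close>

inductive exec :: "nat \<Rightarrow> com \<Rightarrow> state \<Rightarrow> nat \<Rightarrow> state \<Rightarrow> bool" for B where
  Skip: "exec B Skip s 1 s"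
| Assign: "afits B a s \<Longrightarrow> exec B (Assign x a) s (1 + acost a) (set_reg x (aval a s) s)"
| Store: "afits B i s \<Longrightarrow> afits B a s \<Longrightarrow>
    exec B (Store A i a) s (1 + acost i + acost a) (set_arr A (aval i s) (aval a s) s)"
| Seq: "exec B c1 s t1 s' \<Longrightarrow> exec B c2 s' t2 s'' \<Longrightarrow> exec B (Seq c1 c2) s (t1 + t2) s''"
| CondTrue: "bfits B b s \<Longrightarrow> bval b s \<Longrightarrow> exec B c1 s t s' \<Longrightarrow>
    exec B (Cond b c1 c2) s (1 + bcost b + t) s'"
| CondFalse: "bfits B b s \<Longrightarrow> \<not> bval b s \<Longrightarrow> exec B c2 s t s' \<Longrightarrow>
    exec B (Cond b c1 c2) s (1 + bcost b + t) s'"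
| WhileFalse: "bfits B b s \<Longrightarrow> \<not> bval b s \<Longrightarrow> exec B (While b c) s (1 + bcost b) s"
| WhileTrue: "bfits B b s \<Longrightarrow> bval b s \<Longrightarrow> exec B c s t1 s' \<Longrightarrow> exec B (While b c) s' t2 s'' \<Longrightarrow>
    exec B (While b c) s (1 + bcost b + t1 + t2) s''"

inductive_cases exec_SkipE: "exec B Skip s t s'"
inductive_cases exec_AssignE: "exec B (Assign x a) s t s'"
inductive_cases exec_StoreE: "exec B (Store A i a) s t s'"
inductive_cases exec_SeqE: "exec B (Seq c1 c2) s t s'"
inductive_cases exec_CondE: "exec B (Cond b c1 c2) s t s'"
inductive_cases exec_WhileE: "exec B (While b c) s t s'"

lemma exec_deterministic:
  "exec B c s t s' \<Longrightarrow> exec B c s u s'' \<Longrightarrow> u = t \<and> s'' = s'"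
proof (induction arbitrary: u s'' rule: exec.induct)
  case (Skip s)
  from Skip.prems show ?case by (rule exec_SkipE) simp
next
  case (Assign a s x)
  from Assign.prems show ?case by (rule exec_AssignE) simp
next
  case (Store i s a A)
  from Store.prems show ?case by (rule exec_StoreE) simp
next
  case (Seq c1 s t1 s1 c2 t2 s2)
  from Seq.prems obtain u1 r u2 where r: "exec B c1 s u1 r" "exec B c2 r u2 s''" "u = u1 + u2"
    by (rule exec_SeqE)
  from Seq.IH(1)[OF r(1)] have "u1 = t1" "r = s1" by auto
  with Seq.IH(2) r show ?case by simp
next
  case (CondTrue b s c1 t s' c2)
  from CondTrue.prems show ?case
    by (rule exec_CondE) (simp_all add: CondTrue.hyps CondTrue.IH)
next
  case (CondFalse b s c2 t s' c1)
  from CondFalse.prems show ?case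
    by (rule exec_CondE) (simp_all add: CondFalse.hyps CondFalse.IH)
next
  case (WhileFalse b s c)
  from WhileFalse.prems show ?case
    by (rule exec_WhileE) (simp_all add: WhileFalse.hyps)
next
  case (WhileTrue b s c t1 s1 t2 s2)
  from WhileTrue.prems WhileTrue.hyps obtain u1 r u2
    where r: "u = 1 + bcost b + u1 + u2" "exec B c s u1 r" "exec B (While b c) r u2 s''"
    by (auto elim: exec_WhileE)
  from WhileTrue.IH(1)[OF r(2)] have "u1 = t1" "r = s1" by auto
  with WhileTrue.IH(2) r show ?case by simp
qed

text \<open>
  The vertices and the hyperedges are presented in arbitrary orders \<open>xs\<close> and \<open>es\<close>. Registers 0, 1, 2
  hold \<open>n\<close>, \<open>m\<close>, \<open>k\<close>; array 0 holds the incidence matrix (one row per hyperedge), arrays 1 and 2 the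
  characteristic vectors of the source and target covers. All other cells are 0.
\<close>

definition input_state :: "'a list \<Rightarrow> 'a set list \<Rightarrow> nat \<Rightarrow> 'a set \<Rightarrow> 'a set \<Rightarrow> state" where
  "input_state xs es k S T = \<lparr>
     reg = (\<lambda>_. 0)(0 := length xs, 1 := length es, 2 := k),
     arr = (\<lambda>_ _. 0)
       (0 := (\<lambda>a. if a < length es * length xs
                   then of_bool (xs ! (a mod length xs) \<in> es ! (a div length xs)) else 0),
        1 := (\<lambda>i. if i < length xs then of_bool (xs ! i \<in> S) else 0),
        2 := (\<lambda>i. if i < length xs then of_bool (xs ! i \<in> T) else 0))\<rparr>"

text \<open>
  The result is read off register 3 (number of moves) and array 3 (the characteristic vectors of the
  successive configurations, one row per configuration).
\<close>

definition outputs :: "'a list \<Rightarrow> 'a set list \<Rightarrow> state \<Rightarrow> bool" where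
  "outputs xs Ds s \<longleftrightarrow> reg s 3 = length Ds - 1 \<and>
     (\<forall>i<length Ds. \<forall>j<length xs. arr s 3 (i * length xs + j) = of_bool (xs ! j \<in> Ds ! i))"

end

theory Submission
  imports Defs
begin

text \<open>
  Let \<open>S\<close> be the current configuration and \<open>T\<close> the target. Keep a matching between \<open>S - T\<close> and
  \<open>T - S\<close> whose pairs share hyperedges, and treat the unmatched \<open>a \<in> S - T\<close> one by one. If an
  alternating path leads from \<open>a\<close> to an unmatched vertex of \<open>T - S\<close>, augment. Otherwise the vertices
  reached from \<open>a\<close> form a Hall violator: after moving all reached tokens except \<open>a\<close> along the
  matching (one move), the configuration covers every hyperedge even without \<open>a\<close>, since a hyperedge
  that was covered only by \<open>a\<close> and moved tokens meets \<open>T\<close> in a vertex that is now occupied. The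
  token on \<open>a\<close> is therefore free and walks along a shortest path to an unmatched vertex of
  \<open>T - S\<close>; where the path is occupied, the tokens on it all step forward simultaneously, so at
  most \<open>d\<close> moves suffice. When \<open>S - T\<close> is completely matched, the matching is a single move to
  \<open>T\<close>. There are at most \<open>n\<close> rounds, each dominated by breadth-first searches on adjacency
  matrices, so the total time is in fact \<open>O(n\<^sup>3 + n\<^sup>2 m)\<close>.\<close>

section \<open>Distances and moves in hypergraphs\<close>

lemma hdist_le_hpath: "hpath V F u p v \<Longrightarrow> hdist V F u v \<le> enat (length p - 1)"
  unfolding hdist_def by (intro INF_lower) simp

lemma hdist_le_1:
  assumes "u \<in> V" "v \<in> V" "u = v \<or> (\<exists>e\<in>F. u \<in> e \<and> v \<in> e)"
  shows "hdist V F u v \<le> 1"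
proof (cases "u = v")
  case True
  then have "hpath V F u [u] v" using assms by (simp add: hpath_def)
  from hdist_le_hpath[OF this] show ?thesis
    by (simp add: zero_enat_def[symmetric] order_trans[OF _ zero_le_one])
next
  case False
  then have "hpath V F u [u, v] v" using assms by (auto simp: hpath_def)
  from hdist_le_hpath[OF this] show ?thesis by (simp add: one_enat_def)
qed

lemma hpath_of_hdist_le:
  assumes "hdist V F u v \<le> enat d"
  obtains p where "hpath V F u p v" "length p \<le> Suc d"
proof -
  have "hdist V F u v < enat (Suc d)" using assms by (rule order_le_less_trans) simp
  then obtain p where "hpath V F u p v" "enat (length p - 1) < enat (Suc d)"
    unfolding hdist_def by (auto simp: INF_less_iff)
  then show thesis using that by auto
qed

lemma hdist_le_0_imp_eq:
  assumes "hdist V F u v \<le> 0"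
  shows "u = v"
proof -
  obtain p where "hpath V F u p v" "length p \<le> Suc 0"
    using hpath_of_hdist_le[of V F u v 0] assms by (auto simp: zero_enat_def)
  then show ?thesis by (cases p) (auto simp: hpath_def)
qed

lemma hdist_le_hdiam: "u \<in> V \<Longrightarrow> v \<in> V \<Longrightarrow> hdist V F u v \<le> hdiam V F"
  unfolding hdiam_def by (rule SUP_upper2[of "(u, v)"]) auto

lemma vertex_cover_mono:
  "vertex_cover V F C \<Longrightarrow> C \<subseteq> D \<Longrightarrow> D \<subseteq> V \<Longrightarrow> vertex_cover V F D"
  unfolding vertex_cover_def by blast

lemma vertex_cover_subset: "vertex_cover V F C \<Longrightarrow> C \<subseteq> V"
  by (simp add: vertex_cover_def)

lemma tj_move_card: "tj_move V F D D' \<Longrightarrow> card D' = card D"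
  by (auto simp: tj_move_def bij_betw_same_card)

definition reconfigures ::
  "'a set \<Rightarrow> 'a set set \<Rightarrow> nat \<Rightarrow> 'a set \<Rightarrow> 'a set list \<Rightarrow> 'a set \<Rightarrow> bool" where
  "reconfigures V F k S Ds S' \<longleftrightarrow> reconf_seq V F k Ds \<and> hd Ds = S \<and> last Ds = S'"

lemma reconfigures_refl:
  "vertex_cover V F S \<Longrightarrow> card S = k \<Longrightarrow> reconfigures V F k S [S] S"
  by (simp add: reconfigures_def reconf_seq_def)

lemma reconfiguresD:
  assumes "reconfigures V F k S Ds S'"
  shows "Ds \<noteq> []" "vertex_cover V F S'" "card S' = k"
  using assms last_in_set[of Ds] by (auto simp: reconfigures_def reconf_seq_def)

lemma reconfigures_snoc:
  assumes Ds: "reconfigures V F k S Ds S'" and "tj_move V F S' S''" "vertex_cover V F S''"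
  shows "reconfigures V F k S (Ds @ [S'']) S''"
proof -
  have "card S'' = k"
    using reconfiguresD(3)[OF Ds] tj_move_card[OF assms(2)] by simp
  moreover have "tj_move V F ((Ds @ [S'']) ! i) ((Ds @ [S'']) ! Suc i)" if "i < length Ds" for i
  proof (cases "Suc i < length Ds")
    case True
    then show ?thesis using Ds by (simp add: reconfigures_def reconf_seq_def nth_append)
  next
    case False
    then have "Suc i = length Ds" "i = length Ds - 1" using that by auto
    then have "Ds ! i = S'"
      using Ds reconfiguresD(1)[OF Ds] by (simp add: reconfigures_def last_conv_nth)
    then show ?thesis using assms(2) \<open>Suc i = length Ds\<close> that by (simp add: nth_append)
  qed
  ultimately show ?thesis
    using Ds assms(3) by (auto simp: reconfigures_def reconf_seq_def)
qed

subsection \<open>Images of hypergraphs\<close>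

lemma hpath_image:
  assumes "hpath V F u p v"
  shows "hpath (f ` V) ((`) f ` F) (f u) (map f p) (f v)"
  using assms unfolding hpath_def by (fastforce simp: hd_map last_map)

lemma hdist_image_le: "hdist (f ` V) ((`) f ` F) (f u) (f v) \<le> hdist V F u v"
  unfolding hdist_def by (rule INF_mono) (use hpath_image in fastforce)

lemma hdiam_image_le: "hdiam (f ` V) ((`) f ` F) \<le> hdiam V F"
proof -
  have "hdist (f ` V) ((`) f ` F) (f u) (f v) \<le> hdiam V F" if "u \<in> V" "v \<in> V" for u v
    using hdist_image_le hdist_le_hdiam[OF that] by (rule order_trans)
  then show ?thesis
    unfolding hdiam_def[of "f ` V"] by (intro SUP_least) auto
qed

lemma vertex_cover_image: "vertex_cover V F C \<Longrightarrow> vertex_cover (f ` V) ((`) f ` F) (f ` C)"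
  unfolding vertex_cover_def by blast

lemma tj_move_image:
  assumes move: "tj_move V F D D'" and inj: "inj_on f V" and sub: "D \<subseteq> V" "D' \<subseteq> V"
  shows "tj_move (f ` V) ((`) f ` F) (f ` D) (f ` D')"
proof -
  obtain h where h: "bij_betw h D D'" and near: "\<forall>v\<in>D. hdist V F v (h v) \<le> 1"
    using move by (auto simp: tj_move_def)
  have D: "bij_betw f D (f ` D)" and D': "bij_betw f D' (f ` D')"
    using inj sub by (auto simp: bij_betw_def intro: inj_on_subset)
  define g where "g = f \<circ> h \<circ> inv_into D f"
  have "bij_betw g (f ` D) (f ` D')"
    unfolding g_def using bij_betw_inv_into[OF D] h D' by (metis bij_betw_trans comp_assoc)
  moreover have "hdist (f ` V) ((`) f ` F) w (g w) \<le> 1" if w: "w \<in> f ` D" for w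
  proof -
    obtain v where v: "v \<in> D" "w = f v" using w by blast
    then have "g w = f (h v)" using bij_betw_inv_into_left[OF D] by (simp add: g_def)
    then show ?thesis
      using v near hdist_image_le[of f V F v "h v"] order_trans by auto
  qed
  ultimately show ?thesis unfolding tj_move_def by blast
qed

lemma reconf_seq_image:
  assumes Ds: "reconf_seq V F k Ds" and inj: "inj_on f V"
  shows "reconf_seq (f ` V) ((`) f ` F) k (map ((`) f) Ds)"
proof -
  have sub: "D \<subseteq> V" if "D \<in> set Ds" for D
    using Ds that by (auto simp: reconf_seq_def vertex_cover_def)
  have "card (f ` D) = k" if "D \<in> set Ds" for D
    using Ds that sub inj by (auto simp: reconf_seq_def card_image inj_on_subset)
  moreover have "tj_move (f ` V) ((`) f ` F) (f ` (Ds ! i)) (f ` (Ds ! Suc i))"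
    if "Suc i < length Ds" for i
    using that Ds sub by (intro tj_move_image[OF _ inj]) (auto simp: reconf_seq_def)
  ultimately show ?thesis
    using Ds by (auto simp: reconf_seq_def intro: vertex_cover_image)
qed

lemma reconfigures_image:
  assumes "reconfigures V F k S Ds S'" "inj_on f V"
  shows "reconfigures (f ` V) ((`) f ` F) k (f ` S) (map ((`) f) Ds) (f ` S')"
  using assms reconf_seq_image[of V F k Ds f] reconfiguresD(1)[OF assms(1)]
  by (auto simp: reconfigures_def hd_map last_map)

section \<open>Matchings between two configurations\<close>

definition unmatched :: "('a \<rightharpoonup> 'a) \<Rightarrow> 'a set \<Rightarrow> 'a set \<Rightarrow> 'a set" where
  "unmatched M S T = {v \<in> S - T. M v = None}"

lemma unmatched_mem: "v \<in> unmatched M S T \<longleftrightarrow> v \<in> S - T \<and> M v = None"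
  by (simp add: unmatched_def)

definition swap :: "('a \<rightharpoonup> 'a) \<Rightarrow> 'a \<Rightarrow> 'a" where
  "swap M v = (case M v of None \<Rightarrow> v | Some u \<Rightarrow> u)"

locale finite_hypergraph =
  fixes V :: "'a set" and F :: "'a set set"
  assumes hypergraph: "hypergraph V F"
begin

lemma finite_vertices: "finite V"
  using hypergraph by (simp add: hypergraph_def)

lemma finite_vertex_cover: "vertex_cover V F C \<Longrightarrow> finite C"
  using finite_vertices by (auto simp: vertex_cover_def intro: finite_subset)

definition adj :: "'a \<Rightarrow> 'a \<Rightarrow> bool" where
  "adj u v \<longleftrightarrow> u \<in> V \<and> v \<in> V \<and> (\<exists>e\<in>F. u \<in> e \<and> v \<in> e)"

lemma adj_sym: "adj u v \<Longrightarrow> adj v u"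
  by (auto simp: adj_def)

lemma adjD: "adj u v \<Longrightarrow> u \<in> V" "adj u v \<Longrightarrow> v \<in> V"
  by (simp_all add: adj_def)

lemma hdist_adj: "adj u v \<Longrightarrow> hdist V F u v \<le> 1"
  unfolding adj_def by (intro hdist_le_1) auto

definition matching :: "('a \<rightharpoonup> 'a) \<Rightarrow> 'a set \<Rightarrow> 'a set \<Rightarrow> bool" where
  "matching M S T \<longleftrightarrow> (\<forall>u v. M u = Some v \<longrightarrow> M v = Some u \<and> adj u v \<and>
     (u \<in> S - T \<and> v \<in> T - S \<or> u \<in> T - S \<and> v \<in> S - T))"

lemma matchingD:
  assumes "matching M S T" "M u = Some v"
  shows "M v = Some u" "adj u v" "u \<in> S - T \<and> v \<in> T - S \<or> u \<in> T - S \<and> v \<in> S - T"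
  using assms unfolding matching_def by blast+

lemma matching_empty: "matching Map.empty S T"
  by (simp add: matching_def)

lemma matching_dom: "matching M S T \<Longrightarrow> dom M \<subseteq> sym_diff S T"
  unfolding matching_def by blast

lemma swap_involution: "matching M S T \<Longrightarrow> swap M (swap M v) = v"
  by (auto simp: swap_def dest: matchingD(1) split: option.split)

lemma swap_mem_iff: "matching M S T \<Longrightarrow> swap M v \<in> sym_diff S (dom M) \<longleftrightarrow> v \<in> S"
  by (auto simp: swap_def dest: matchingD split: option.split)

lemma bij_betw_swap:
  assumes "matching M S T"
  shows "bij_betw (swap M) S (sym_diff S (dom M))"
  using swap_mem_iff[OF assms] swap_involution[OF assms]
  by (intro bij_betw_byWitness[where f' = "swap M"]) (metis image_subsetI)+

lemma card_unmatched:
  assumes M: "matching M S T" and fin: "finite S" "finite T" and card: "card S = card T"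
  shows "card (unmatched M S T) = card (unmatched M T S)"
proof -
  let ?S' = "sym_diff S (dom M)"
  have swapped: "finite ?S'" "card ?S' = card T"
    using bij_betw_finite[OF bij_betw_swap[OF M]] bij_betw_same_card[OF bij_betw_swap[OF M]]
      fin(1) card by metis+
  have "unmatched M S T = ?S' - T" "unmatched M T S = T - ?S'"
    using matching_dom[OF M] by (auto simp: unmatched_def)
  then show ?thesis
    using card_le_sym_Diff[OF swapped(1) fin(2)] card_le_sym_Diff[OF fin(2) swapped(1)] swapped(2)
    by simp
qed

lemma exists_unmatched:
  assumes "matching M S T" "finite S" "finite T" "card S = card T" "a \<in> unmatched M S T"
  obtains b where "b \<in> unmatched M T S"
proof -
  have "0 < card (unmatched M S T)"
    using assms(2,5) by (auto simp: card_gt_0_iff unmatched_def)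
  then show thesis using that card_unmatched[OF assms(1-4)] by fastforce
qed

lemma tj_move_matching:
  assumes M: "matching M S T" and S: "S \<subseteq> V"
  shows "tj_move V F S (sym_diff S (dom M))"
proof -
  note bij_betw_swap[OF M]
  moreover have "hdist V F v (swap M v) \<le> 1" if "v \<in> S" for v
    using that S matchingD(2)[OF M, of v] hdist_adj hdist_le_1[of v V v]
    by (auto simp: swap_def split: option.split)
  ultimately show ?thesis unfolding tj_move_def by blast
qed

lemma tj_move_complete_matching:
  assumes M: "matching M S T" and S: "S \<subseteq> V" and fin: "finite S" "finite T"
    and card: "card S = card T" and complete: "unmatched M S T = {}"
  shows "tj_move V F S T"
proof -
  have "card (unmatched M T S) = 0"
    using card_unmatched[OF M fin card] complete by simp
  moreover have "finite (unmatched M T S)" using fin by (simp add: unmatched_def)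
  ultimately have "unmatched M T S = {}" by simp
  then have "dom M = sym_diff S T"
    using matching_dom[OF M] complete by (auto simp: unmatched_def)
  then have "sym_diff S (dom M) = T" by blast
  then show ?thesis using tj_move_matching[OF M S] by simp
qed

lemma matching_cong:
  assumes M: "matching M S T" and same: "\<And>v. v \<in> dom M \<Longrightarrow> v \<in> S' \<longleftrightarrow> v \<in> S"
  shows "matching M S' T"
  unfolding matching_def
proof (intro allI impI)
  fix u v assume uv: "M u = Some v"
  note u = matchingD[OF M uv]
  then have "u \<in> S' \<longleftrightarrow> u \<in> S" "v \<in> S' \<longleftrightarrow> v \<in> S" using same uv by blast+
  then show "M v = Some u \<and> adj u v \<and> (u \<in> S' - T \<and> v \<in> T - S' \<or> u \<in> T - S' \<and> v \<in> S' - T)"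
    using u by simp
qed

lemma matching_restrict:
  assumes M: "matching M S T" and closed: "\<And>u v. M u = Some v \<Longrightarrow> u \<in> X \<Longrightarrow> v \<in> X"
  shows "matching (M |` X) S T"
  unfolding matching_def
proof (intro allI impI)
  fix u v assume "(M |` X) u = Some v"
  then have uv: "M u = Some v" "u \<in> X" by (auto simp: restrict_map_def split: if_splits)
  then show "(M |` X) v = Some u \<and> adj u v \<and>
    (u \<in> S - T \<and> v \<in> T - S \<or> u \<in> T - S \<and> v \<in> S - T)"
    using matchingD[OF M uv(1)] closed[OF uv] by simp
qed

end

section \<open>Breadth-first search\<close>

text \<open>\<open>f v - 1\<close> is the distance from \<open>a\<close> to \<open>v\<close> along \<open>E\<close>; \<open>f v = 0\<close> means that \<open>v\<close> is unreachable.\<close>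

definition bfs_levels :: "'a set \<Rightarrow> ('a \<Rightarrow> 'a \<Rightarrow> bool) \<Rightarrow> 'a \<Rightarrow> ('a \<Rightarrow> nat) \<Rightarrow> bool" where
  "bfs_levels V E a f \<longleftrightarrow>
     (\<forall>v\<in>V. f v = 1 \<longleftrightarrow> v = a) \<and>
     (\<forall>u\<in>V. \<forall>v\<in>V. E u v \<longrightarrow> f u \<noteq> 0 \<longrightarrow> f v \<noteq> 0 \<and> f v \<le> Suc (f u)) \<and>
     (\<forall>v\<in>V. 1 < f v \<longrightarrow> (\<exists>u\<in>V. E u v \<and> Suc (f u) = f v))"

lemma bfs_levels_root: "bfs_levels V E a f \<Longrightarrow> v \<in> V \<Longrightarrow> f v = 1 \<longleftrightarrow> v = a"
  by (simp add: bfs_levels_def)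

lemma bfs_levels_edge:
  "bfs_levels V E a f \<Longrightarrow> u \<in> V \<Longrightarrow> v \<in> V \<Longrightarrow> E u v \<Longrightarrow> f u \<noteq> 0 \<Longrightarrow> f v \<noteq> 0 \<and> f v \<le> Suc (f u)"
  by (simp add: bfs_levels_def)

lemma bfs_levels_pred:
  assumes "bfs_levels V E a f" "v \<in> V" "f v \<noteq> 0" "v \<noteq> a"
  obtains u where "u \<in> V" "E u v" "Suc (f u) = f v" "f u \<noteq> 0"
proof -
  have "1 < f v" using assms bfs_levels_root[of V E a f v] by linarith
  then obtain u where "u \<in> V" "E u v" "Suc (f u) = f v"
    using assms by (auto simp: bfs_levels_def)
  then show thesis using that \<open>1 < f v\<close> by simp
qed

lemma level_le_card:
  assumes "finite V" and pred: "\<And>v. v \<in> V \<Longrightarrow> 1 < f v \<Longrightarrow> \<exists>u\<in>V. Suc (f u) = f v"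
    and "v \<in> V"
  shows "f v \<le> card V"
proof -
  have level_nonempty: "\<exists>w\<in>V. f w = f v - i" if "i < f v" for i
    using that
  proof (induction i)
    case 0
    then show ?case using \<open>v \<in> V\<close> by auto
  next
    case (Suc i)
    then obtain w where w: "w \<in> V" "f w = f v - i" by auto
    then have "1 < f w" using Suc.prems by simp
    then obtain u where "u \<in> V" "Suc (f u) = f w" using pred[OF w(1)] by blast
    then have "u \<in> V \<and> f u = f v - Suc i" using w(2) by simp
    then show ?case by blast
  qed
  have "{1..f v} \<subseteq> f ` V"
  proof
    fix l assume "l \<in> {1..f v}"
    then show "l \<in> f ` V" using level_nonempty[of "f v - l"] by force
  qed
  then have "card {1..f v} \<le> card (f ` V)" using \<open>finite V\<close> by (intro card_mono) auto
  also have "\<dots> \<le> card V" using \<open>finite V\<close> by (rule card_image_le)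
  finally show ?thesis by simp
qed

lemma bfs_levels_le_card:
  assumes "bfs_levels V E a f" "finite V" "v \<in> V"
  shows "f v \<le> card V"
  using assms by (intro level_le_card) (auto simp: bfs_levels_def)

text \<open>\<open>q\<close> is a queue of length \<open>t\<close> whose entries before position \<open>h\<close> are processed; of the vertex at
  the head \<open>h\<close>, only the edges into \<open>W\<close> have been examined.\<close>

locale bfs_inv =
  fixes V :: "'a set" and E :: "'a \<Rightarrow> 'a \<Rightarrow> bool" and a :: 'a and h :: nat and W :: "'a set"
    and f :: "'a \<Rightarrow> nat" and q :: "nat \<Rightarrow> 'a" and t :: nat
  assumes finite: "finite V"
    and root: "v \<in> V \<Longrightarrow> f v = 1 \<longleftrightarrow> v = a"
    and queue: "bij_betw q {..<t} {v \<in> V. f v \<noteq> 0}"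
    and queue_mono: "i \<le> j \<Longrightarrow> j < t \<Longrightarrow> f (q i) \<le> f (q j)"
    and queue_near: "h < t \<Longrightarrow> j < t \<Longrightarrow> f (q j) \<le> Suc (f (q h))"
    and processed: "i < h \<Longrightarrow> i < t \<Longrightarrow> v \<in> V \<Longrightarrow> E (q i) v \<Longrightarrow> f v \<noteq> 0 \<and> f v \<le> Suc (f (q i))"
    and examined: "h < t \<Longrightarrow> v \<in> W \<Longrightarrow> E (q h) v \<Longrightarrow> f v \<noteq> 0 \<and> f v \<le> Suc (f (q h))"
    and pred: "v \<in> V \<Longrightarrow> 1 < f v \<Longrightarrow> \<exists>u\<in>V. E u v \<and> Suc (f u) = f v"
begin

lemma queue_entry: "i < t \<Longrightarrow> q i \<in> V" "i < t \<Longrightarrow> f (q i) \<noteq> 0"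
  using bij_betwE[OF queue] by auto

lemma mem_queue: "v \<in> V \<Longrightarrow> f v \<noteq> 0 \<Longrightarrow> \<exists>i<t. v = q i"
  using bij_betw_imp_surj_on[OF queue] by (auto simp: set_eq_iff image_iff)

lemma queue_length_le: "t \<le> card V"
proof -
  have "card {..<t} \<le> card V"
    unfolding bij_betw_same_card[OF queue] by (intro card_mono finite) auto
  then show ?thesis by simp
qed

lemma level_le: "v \<in> V \<Longrightarrow> f v \<le> card V"
  using pred by (intro level_le_card[OF finite]) blast

lemma skip:
  assumes "v \<in> V" "h < t" "\<not> (E (q h) v \<and> f v = 0)"
  shows "bfs_inv V E a h (insert v W) f q t"
proof
  show "f w \<noteq> 0 \<and> f w \<le> Suc (f (q h))" if "w \<in> insert v W" "E (q h) w" for w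
  proof (cases "w = v")
    case True
    then show ?thesis
      using mem_queue[OF assms(1)] queue_near[OF assms(2)] assms(3) that(2) by auto
  qed (use examined[OF assms(2)] that in blast)
qed (fact finite root queue queue_mono queue_near processed pred)+

lemma visit:
  assumes v: "v \<in> V" "E (q h) v" "f v = 0" and h: "h < t"
  shows "bfs_inv V E a h (insert v W) (f(v := Suc (f (q h)))) (q(t := v)) (Suc t)"
proof -
  let ?f = "f(v := Suc (f (q h)))" and ?q = "q(t := v)"
  have old: "?f (?q i) = f (q i)" if "i < t" for i
    using queue_entry(2)[OF that] v(3) that by auto
  have grows: "?f w \<noteq> 0 \<and> ?f w \<le> Suc l" if "f w \<noteq> 0 \<and> f w \<le> Suc l" for w l
    using that v(3) by auto
  show ?thesis
  proof
    show "finite V" by (rule finite)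
    show "?f w = 1 \<longleftrightarrow> w = a" if "w \<in> V" for w
      using root[OF that] queue_entry(2)[OF h] v(3) by auto
    have "bij_betw ?q {..<t} {w \<in> V. f w \<noteq> 0}"
      using queue by (rule bij_betw_cong[THEN iffD1, rotated]) simp
    then have "bij_betw ?q ({..<t} \<union> {t}) ({w \<in> V. f w \<noteq> 0} \<union> {?q t})"
      using v(3) by (intro notIn_Un_bij_betw) auto
    moreover have "{..<t} \<union> {t} = {..<Suc t}" by auto
    moreover have "{w \<in> V. f w \<noteq> 0} \<union> {?q t} = {w \<in> V. ?f w \<noteq> 0}" using v(1) by auto
    ultimately show "bij_betw ?q {..<Suc t} {w \<in> V. ?f w \<noteq> 0}" by simp
    show "?f (?q i) \<le> ?f (?q j)" if "i \<le> j" "j < Suc t" for i j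
      using that old[of i] old[of j] queue_mono[of i j] queue_near[OF h, of i]
      by (cases "i < t"; cases "j < t") auto
    show "?f (?q j) \<le> Suc (?f (?q h))" if "j < Suc t" for j
      using that old[of j] old[OF h] queue_near[OF h, of j] by (cases "j < t") auto
    show "?f w \<noteq> 0 \<and> ?f w \<le> Suc (?f (?q i))"
      if "i < h" "i < Suc t" "w \<in> V" "E (?q i) w" for i w
      using processed[of i w] that h old[of i] grows[of w] by simp
    show "?f w \<noteq> 0 \<and> ?f w \<le> Suc (?f (?q h))" if "w \<in> insert v W" "E (?q h) w" for w
      using examined[OF h, of w] that h old[OF h] grows[of w] by auto
    show "\<exists>u\<in>V. E u w \<and> Suc (?f u) = ?f w" if w: "w \<in> V" "1 < ?f w" for w
    proof (cases "w = v")
      case True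
      then have "E (q h) w \<and> Suc (?f (q h)) = ?f w" using v(2,3) queue_entry(2)[OF h] by auto
      then show ?thesis using queue_entry(1)[OF h] by blast
    next
      case False
      then obtain u where "u \<in> V" "E u w" "Suc (f u) = f w" using pred[of w] w by auto
      then show ?thesis using False w(2) v(3) by (intro bexI[of _ u]) auto
    qed
  qed
qed

lemma advance:
  assumes "h < t \<Longrightarrow> W = V"
  shows "bfs_inv V E a (Suc h) {} f q t"
proof
  show "f v \<noteq> 0 \<and> f v \<le> Suc (f (q i))" if "i < Suc h" "i < t" "v \<in> V" "E (q i) v" for i v
    using that processed[of i v] examined[of v] assms by (cases "i = h") auto
  show "f (q j) \<le> Suc (f (q (Suc h)))" if "Suc h < t" "j < t" for j
    using queue_near[of j] queue_mono[of h "Suc h"] that by simp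
qed (fact finite root queue queue_mono pred | simp)+

lemma levels:
  assumes "t \<le> h"
  shows "bfs_levels V E a f"
  unfolding bfs_levels_def
proof (intro conjI ballI impI)
  fix u v assume uv: "u \<in> V" "v \<in> V" "E u v" "f u \<noteq> 0"
  then obtain i where "i < t" "u = q i" using mem_queue by blast
  then show "f v \<noteq> 0" "f v \<le> Suc (f u)" using processed[of i v] uv assms by auto
qed (use root pred in auto)

end

lemma bfs_inv_init:
  assumes "finite V" "a \<in> V" "\<And>v. v \<in> V \<Longrightarrow> f v = (if v = a then 1 else 0)" "q 0 = a"
  shows "bfs_inv V E a 0 {} f q 1"
proof
  have "f v \<noteq> 0 \<longleftrightarrow> v = a" if "v \<in> V" for v using assms(3)[OF that] by simp
  then have "{v \<in> V. f v \<noteq> 0} = {a}" using assms(2) by blast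
  then show "bij_betw q {..<1} {v \<in> V. f v \<noteq> 0}"
    using assms(4) by (simp add: bij_betw_def lessThan_Suc)
  show "\<exists>u\<in>V. E u v \<and> Suc (f u) = f v" if "v \<in> V" "1 < f v" for v
    using assms(3)[OF that(1)] that(2) by (simp split: if_splits)
qed (use assms in auto)

context finite_hypergraph
begin

lemma bfs_levels_hdist:
  assumes f: "bfs_levels V adj a f" and a: "a \<in> V" and d: "hdist V F a v \<le> enat d"
  shows "f v \<noteq> 0 \<and> f v \<le> Suc d"
proof -
  obtain p where p: "hpath V F a p v" "length p \<le> Suc d" using hpath_of_hdist_le[OF d] .
  have "f (p ! i) \<noteq> 0 \<and> f (p ! i) \<le> Suc i" if "i < length p" for i
    using that
  proof (induction i)
    case 0
    then have "p ! 0 = a" using p(1) by (simp add: hpath_def hd_conv_nth)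
    then show ?case using bfs_levels_root[OF f a] by simp
  next
    case (Suc i)
    then have "adj (p ! i) (p ! Suc i)"
      using p(1) nth_mem[of i p] nth_mem[of "Suc i" p] by (auto simp: hpath_def adj_def)
    then show ?case
      using bfs_levels_edge[OF f, of "p ! i" "p ! Suc i"] adjD[of "p ! i"] Suc by force
  qed
  from this[of "length p - 1"] show ?thesis
    using p by (auto simp: hpath_def last_conv_nth)
qed

end

section \<open>Augmenting paths and Hall violators\<close>

definition rematch :: "'a \<Rightarrow> 'a \<Rightarrow> ('a \<rightharpoonup> 'a) \<Rightarrow> ('a \<rightharpoonup> 'a)" where
  "rematch x y M = (case M y of None \<Rightarrow> M | Some z \<Rightarrow> M(z := None))(y \<mapsto> x, x \<mapsto> y)"

context finite_hypergraph
begin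

definition alternating :: "('a \<rightharpoonup> 'a) \<Rightarrow> 'a set \<Rightarrow> 'a set \<Rightarrow> 'a \<Rightarrow> 'a \<Rightarrow> bool" where
  "alternating M S T u v \<longleftrightarrow> u \<in> S - T \<and> v \<in> T - S \<and> adj u v \<or> u \<notin> S \<and> M u = Some v"

lemma alternatingD:
  assumes "alternating M S T u v" "matching M S T"
  shows "adj u v" "u \<in> S - T \<and> v \<in> T - S \<or> M v = Some u \<and> u \<in> T - S \<and> v \<in> S - T"
  using assms matchingD[of M S T u v] unfolding alternating_def by blast+

lemma matching_rematch:
  assumes M: "matching M S T" and x: "x \<in> unmatched M T S" and y: "y \<in> S - T" "adj y x"
  shows "matching (rematch x y M) S T"
  unfolding matching_def
proof (intro allI impI)
  fix u v assume uv: "rematch x y M u = Some v"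
  have xy: "x \<noteq> y" using x y by (auto simp: unmatched_mem)
  consider (at_x) "u = x" "v = y" | (at_y) "u = y" "v = x"
    | (elsewhere) "u \<noteq> x" "u \<noteq> y" "M u = Some v" "M y \<noteq> Some u"
    using uv xy by (auto simp: rematch_def split: option.splits if_splits)
  then show "rematch x y M v = Some u \<and> adj u v \<and>
     (u \<in> S - T \<and> v \<in> T - S \<or> u \<in> T - S \<and> v \<in> S - T)"
  proof cases
    case elsewhere
    note u = matchingD[OF M elsewhere(3)]
    have "v \<noteq> x" "v \<noteq> y" "M y \<noteq> Some v"
      using u(1) elsewhere x matchingD(1)[OF M, of y v] by (auto simp: unmatched_mem)
    then show ?thesis using u by (auto simp: rematch_def split: option.split)
  qed (use x y xy adj_sym in \<open>auto simp: rematch_def unmatched_mem split: option.split\<close>)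
qed

lemma unmatched_rematch:
  assumes M: "matching M S T" and x: "x \<in> unmatched M T S" and y: "y \<in> S - T"
  shows "unmatched (rematch x y M) S T = unmatched M S T - {y}"
  using x y matchingD(3)[OF M, of y]
  by (auto simp: unmatched_def rematch_def split: option.splits if_splits)

definition augmenting ::
  "'a set \<Rightarrow> 'a set \<Rightarrow> ('a \<Rightarrow> nat) \<Rightarrow> ('a \<rightharpoonup> 'a) \<Rightarrow> ('a \<rightharpoonup> 'a) \<Rightarrow> 'a \<Rightarrow> bool" where
  "augmenting S T f M\<^sub>0 M x \<longleftrightarrow> matching M S T \<and> x \<in> unmatched M T S \<and> f x \<noteq> 0 \<and>
     unmatched M S T \<subseteq> unmatched M\<^sub>0 S T \<and> (\<forall>v\<in>S - T. f v < f x \<longrightarrow> M v = M\<^sub>0 v)"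

definition reached :: "('a \<Rightarrow> nat) \<Rightarrow> 'a \<Rightarrow> 'a set" where
  "reached f a = {v \<in> V. f v \<noteq> 0 \<and> v \<noteq> a}"

context
  fixes M :: "'a \<rightharpoonup> 'a" and S T :: "'a set" and a :: 'a and f :: "'a \<Rightarrow> nat"
  assumes M: "matching M S T" and a: "a \<in> unmatched M S T"
    and f: "bfs_levels V (alternating M S T) a f"
begin

lemma level_pred_source:
  assumes "v \<in> V" "v \<in> S - T" "f v \<noteq> 0" "v \<noteq> a"
  obtains u where "M v = Some u" "Suc (f u) = f v" "f u \<noteq> 0"
  using bfs_levels_pred[OF f assms(1,3,4)] alternatingD(2)[OF _ M] assms(2) by blast

lemma augmenting_pred:
  assumes M': "augmenting S T f M M' x" and "T \<subseteq> V"
  obtains y where "y \<in> S - T" "adj y x" "Suc (f y) = f x"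
proof -
  have x: "x \<in> T - S" "x \<in> V" "f x \<noteq> 0" "x \<noteq> a"
    using assms a by (auto simp: augmenting_def unmatched_mem)
  then obtain u where "alternating M S T u x" "Suc (f u) = f x"
    using bfs_levels_pred[OF f] by metis
  then show thesis using that alternatingD[OF _ M, of u x] x(1) by blast
qed

lemma augmenting_step:
  assumes M': "augmenting S T f M M' x" and y: "y \<in> S - T" "adj y x" "Suc (f y) = f x"
  shows "case M' y of
      None \<Rightarrow> matching (rematch x y M') S T \<and> unmatched (rematch x y M') S T \<subseteq> unmatched M S T - {a}
    | Some z \<Rightarrow> augmenting S T f M (rematch x y M') z \<and> f z < f x"
proof -
  have x: "matching M' S T" "x \<in> unmatched M' T S" "unmatched M' S T \<subseteq> unmatched M S T"
    and kept: "\<And>v. v \<in> S - T \<Longrightarrow> f v < f x \<Longrightarrow> M' v = M v"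
    using M' by (auto simp: augmenting_def)
  note new = matching_rematch[OF x(1,2) y(1,2)] unmatched_rematch[OF x(1,2) y(1)]
  have "f y \<noteq> 0"
  proof
    assume "f y = 0"
    then have "x = a" using y(3) bfs_levels_root[OF f adjD(2)[OF y(2)]] by simp
    then show False using x(2) a by (auto simp: unmatched_mem)
  qed
  have My: "M' y = M y" using kept[OF y(1)] y(3) by simp
  show ?thesis
  proof (cases "M y")
    case None
    then have "y = a" using level_pred_source[OF adjD(1)[OF y(2)] y(1) \<open>f y \<noteq> 0\<close>] by force
    then show ?thesis using new x(3) None My by auto
  next
    case (Some z)
    then have "y \<noteq> a" using a by (auto simp: unmatched_mem)
    then have fz: "Suc (f z) = f y" "f z \<noteq> 0"
      using level_pred_source[OF adjD(1)[OF y(2)] y(1) \<open>f y \<noteq> 0\<close>] Some by auto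
    have z: "z \<in> T - S" "z \<noteq> x"
      using matchingD[OF M Some] y(1) y(3) fz(1) by auto
    then have "z \<in> unmatched (rematch x y M') T S"
      using Some My y(1) by (auto simp: unmatched_mem rematch_def)
    moreover have "rematch x y M' v = M v" if "v \<in> S - T" "f v < f z" for v
      using kept[OF that(1)] that y fz(1) z(1) x(2) Some My
      by (auto simp: rematch_def unmatched_mem)
    ultimately show ?thesis
      using new x(3) fz y(3) Some My by (auto simp: augmenting_def)
  qed
qed

context
  assumes stuck: "\<And>b. b \<in> unmatched M T S \<Longrightarrow> f b = 0"
begin

lemma reached_partner:
  assumes v: "v \<in> reached f a"
  obtains u where "M v = Some u" "u \<in> reached f a"
proof -
  have v': "v \<in> V" "f v \<noteq> 0" "v \<noteq> a" using v by (auto simp: reached_def)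
  then obtain u where u: "u \<in> V" "alternating M S T u v" "f u \<noteq> 0"
    using bfs_levels_pred[OF f] by metis
  show thesis
  proof (cases "u \<in> S - T")
    case True
    then have vT: "v \<in> T - S" using alternatingD(2)[OF u(2) M] by blast
    then obtain w where w: "M v = Some w" using stuck[of v] v'(2) by (auto simp: unmatched_mem)
    then have "alternating M S T v w" "w \<in> V"
      using vT matchingD[OF M w] adjD by (auto simp: alternating_def)
    then have "f w \<noteq> 0" using bfs_levels_edge[OF f v'(1)] v'(2) by blast
    moreover have "w \<noteq> a" using matchingD(1)[OF M w] a by (auto simp: unmatched_mem)
    ultimately show thesis using that[OF w] \<open>w \<in> V\<close> by (simp add: reached_def)
  next
    case False
    then have "M v = Some u" "u \<in> T - S" using alternatingD(2)[OF u(2) M] by auto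
    then show thesis using that[of u] u a by (auto simp: reached_def unmatched_mem)
  qed
qed

lemma reached_closed:
  assumes "M u = Some v"
  shows "u \<in> reached f a \<longleftrightarrow> v \<in> reached f a"
proof
  show "v \<in> reached f a" if "u \<in> reached f a"
    using reached_partner[OF that] assms by force
  show "u \<in> reached f a" if "v \<in> reached f a"
    using reached_partner[OF that] matchingD(1)[OF M assms] by force
qed

lemma reached_subset: "reached f a \<subseteq> dom M" "reached f a \<subseteq> sym_diff S T"
  using reached_partner matching_dom[OF M] by blast+

lemma tj_move_release:
  assumes "S \<subseteq> V"
  shows "tj_move V F S (sym_diff S (reached f a))"
proof -
  have "matching (M |` reached f a) S T"
    by (rule matching_restrict[OF M]) (simp add: reached_closed)
  moreover have "dom (M |` reached f a) = reached f a"
    using reached_subset by auto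
  ultimately show ?thesis using tj_move_matching assms by metis
qed

lemma matching_release: "matching (M |` (- reached f a)) (sym_diff S (reached f a)) T"
proof (rule matching_cong)
  show "matching (M |` (- reached f a)) S T"
    by (rule matching_restrict[OF M]) (simp add: reached_closed)
qed auto

lemma unmatched_release:
  "unmatched (M |` (- reached f a)) (sym_diff S (reached f a)) T \<subseteq> unmatched M S T"
  using reached_subset(2) by (auto simp: unmatched_def restrict_map_def split: if_splits)

text \<open>A hyperedge covered only by \<open>a\<close> and the moved tokens contains a vertex of \<open>T\<close>, which is
  adjacent to a reached vertex of \<open>S - T\<close> and hence reached and now occupied.\<close>

lemma vertex_cover_release:
  assumes S: "vertex_cover V F S" and T: "vertex_cover V F T"
  shows "vertex_cover V F (sym_diff S (reached f a) - {a})"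
  unfolding vertex_cover_def
proof (intro conjI ballI)
  show "sym_diff S (reached f a) - {a} \<subseteq> V"
    using vertex_cover_subset[OF S] by (auto simp: reached_def)
  fix e assume e: "e \<in> F"
  then have "e \<inter> S \<noteq> {}" "e \<inter> T \<noteq> {}" using S T by (simp_all add: vertex_cover_def)
  then obtain i j where i: "i \<in> S" "i \<in> e" and j: "j \<in> T" "j \<in> e" by blast
  have ij: "adj i j" "i \<in> V" "j \<in> V"
    using vertex_cover_subset[OF S] vertex_cover_subset[OF T] i j e by (auto simp: adj_def)
  consider (kept) "i \<notin> insert a (reached f a)"
    | (moved_common) "i \<in> insert a (reached f a)" "j \<in> S"
    | (moved_target) "i \<in> insert a (reached f a)" "j \<notin> S" by blast
  then show "e \<inter> (sym_diff S (reached f a) - {a}) \<noteq> {}"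
  proof cases
    case kept
    then show ?thesis using i by blast
  next
    case moved_common
    then show ?thesis using j reached_subset(2) a by (auto simp: unmatched_mem)
  next
    case moved_target
    then have "i \<in> S - T" using i reached_subset(2) a by (auto simp: unmatched_mem)
    then have "alternating M S T i j" using moved_target j ij by (simp add: alternating_def)
    moreover have "f i \<noteq> 0" using moved_target bfs_levels_root[OF f ij(2)]
      by (auto simp: reached_def)
    ultimately have "f j \<noteq> 0" using bfs_levels_edge[OF f ij(2,3)] by blast
    moreover have "j \<noteq> a" using moved_target a by (auto simp: unmatched_mem)
    ultimately have "j \<in> reached f a" using ij(3) by (simp add: reached_def)
    then show ?thesis using moved_target j(2) \<open>j \<noteq> a\<close> by blast
  qed
qed

end

end

end

section \<open>Pushing a token along a path\<close>

lemma bij_betw_fun_upd_insert: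
  assumes "bij_betw h A B" "x \<notin> A" "y \<notin> B"
  shows "bij_betw (h(x := y)) (insert x A) (insert y B)"
proof -
  have "bij_betw (h(x := y)) A B"
    using assms(1) by (rule bij_betw_cong[THEN iffD1, rotated]) (use assms(2) in auto)
  then show ?thesis
    using notIn_Un_bij_betw[of x A "h(x := y)" B] assms(2,3) by simp
qed

context finite_hypergraph
begin

text \<open>A superfluous token on \<open>f\<close> can be passed along an occupied path from \<open>f\<close> to \<open>x\<close>: every token
  on the path steps forward, which vacates \<open>f\<close> and lets the token on \<open>x\<close> leave. The rank \<open>r\<close>
  decreases along the path, so tokens of rank below \<open>r x\<close> are still in place.\<close>

definition pushable :: "'a set \<Rightarrow> ('a \<Rightarrow> nat) \<Rightarrow> 'a \<Rightarrow> 'a \<Rightarrow> bool" where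
  "pushable S r f x \<longleftrightarrow> f \<in> S \<and> x \<in> S \<and> (\<exists>h. bij_betw h (S - {x}) (S - {f}) \<and>
     (\<forall>v\<in>S - {x}. hdist V F v (h v) \<le> 1) \<and> (\<forall>v\<in>S. r v < r x \<longrightarrow> h v = v))"

lemma pushable_refl: "S \<subseteq> V \<Longrightarrow> f \<in> S \<Longrightarrow> pushable S r f f"
  unfolding pushable_def by (intro conjI exI[of _ id]) (auto intro: hdist_le_1)

lemma pushable_step:
  assumes push: "pushable S r f x" and xy: "adj x y" and y: "y \<in> S" "r y < r x"
  shows "pushable S r f y"
proof -
  obtain h where h: "bij_betw h (S - {x}) (S - {f})" and near: "\<forall>v\<in>S - {x}. hdist V F v (h v) \<le> 1"
    and fixed: "\<forall>v\<in>S. r v < r x \<longrightarrow> h v = v" and fx: "f \<in> S" "x \<in> S"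
    using push unfolding pushable_def by blast
  have hy: "h y = y" and yx: "y \<noteq> x" using fixed y by auto
  then have yf: "y \<in> S - {f}" using bij_betwE[OF h] y(1) by force
  have "bij_betw h (S - {x} - {y}) (S - {f} - {y})"
    using h by (rule bij_betw_DiffI) (use hy yx yf y(1) in \<open>auto simp: bij_betw_def\<close>)
  then have "bij_betw (h(x := y)) (insert x (S - {x} - {y})) (insert y (S - {f} - {y}))"
    by (rule bij_betw_fun_upd_insert) auto
  moreover have "insert x (S - {x} - {y}) = S - {y}" "insert y (S - {f} - {y}) = S - {f}"
    using fx yx yf by auto
  ultimately have "bij_betw (h(x := y)) (S - {y}) (S - {f})" by simp
  moreover have "\<forall>v\<in>S - {y}. hdist V F v ((h(x := y)) v) \<le> 1"
    using near hdist_adj[OF xy] by auto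
  moreover have "\<forall>v\<in>S. r v < r y \<longrightarrow> (h(x := y)) v = v" using fixed y(2) by auto
  ultimately show ?thesis unfolding pushable_def using fx y(1) by blast
qed

lemma tj_move_pushable:
  assumes push: "pushable S r f x" and xy: "adj x y" "y \<notin> S"
  shows "tj_move V F S (insert y (S - {f}))"
proof -
  obtain h where h: "bij_betw h (S - {x}) (S - {f})" and near: "\<forall>v\<in>S - {x}. hdist V F v (h v) \<le> 1"
    and fx: "f \<in> S" "x \<in> S"
    using push unfolding pushable_def by blast
  have "bij_betw (h(x := y)) (insert x (S - {x})) (insert y (S - {f}))"
    using h by (rule bij_betw_fun_upd_insert) (use xy in auto)
  moreover have "\<forall>v\<in>S. hdist V F v ((h(x := y)) v) \<le> 1"
    using near hdist_adj[OF xy(1)] by auto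
  ultimately show ?thesis
    using fx by (auto simp: tj_move_def insert_absorb)
qed

end

section \<open>Timed execution of programs\<close>

notation Seq (infixr ";;" 60)

fun written_regs :: "com \<Rightarrow> nat set" where
  "written_regs Skip = {}"
| "written_regs (Assign x a) = {x}"
| "written_regs (Store A i a) = {}"
| "written_regs (c1 ;; c2) = written_regs c1 \<union> written_regs c2"
| "written_regs (Cond b c1 c2) = written_regs c1 \<union> written_regs c2"
| "written_regs (While b c) = written_regs c"

fun written_arrs :: "com \<Rightarrow> nat set" where
  "written_arrs Skip = {}"
| "written_arrs (Assign x a) = {}"
| "written_arrs (Store A i a) = {A}"
| "written_arrs (c1 ;; c2) = written_arrs c1 \<union> written_arrs c2"
| "written_arrs (Cond b c1 c2) = written_arrs c1 \<union> written_arrs c2"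
| "written_arrs (While b c) = written_arrs c"

definition same_except :: "nat set \<Rightarrow> nat set \<Rightarrow> state \<Rightarrow> state \<Rightarrow> bool" where
  "same_except R A s s' \<longleftrightarrow> (\<forall>x. x \<notin> R \<longrightarrow> reg s' x = reg s x) \<and> (\<forall>a. a \<notin> A \<longrightarrow> arr s' a = arr s a)"

definition bounded_state :: "nat \<Rightarrow> state \<Rightarrow> bool" where
  "bounded_state B s \<longleftrightarrow> (\<forall>x. reg s x < B) \<and> (\<forall>a i. arr s a i < B)"

lemma reg_set_reg [simp]: "reg (set_reg x v s) y = (if y = x then v else reg s y)"
  and arr_set_reg [simp]: "arr (set_reg x v s) = arr s"
  and reg_set_arr [simp]: "reg (set_arr a i v s) = reg s"
  and arr_set_arr [simp]: "arr (set_arr a i v s) b = (if b = a then (arr s a)(i := v) else arr s b)"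
  by (auto simp: set_reg_def set_arr_def)

lemma bounded_set_reg: "bounded_state B s \<Longrightarrow> v < B \<Longrightarrow> bounded_state B (set_reg x v s)"
  and bounded_set_arr: "bounded_state B s \<Longrightarrow> v < B \<Longrightarrow> bounded_state B (set_arr a i v s)"
  by (simp_all add: bounded_state_def)

lemma bounded_reg [simp]: "bounded_state B s \<Longrightarrow> reg s x < B"
  and bounded_arr [simp]: "bounded_state B s \<Longrightarrow> arr s a i < B"
  by (auto simp: bounded_state_def)

lemma same_except_refl [simp]: "same_except R A s s"
  by (simp add: same_except_def)

lemma same_except_trans:
  "same_except R A s s' \<Longrightarrow> same_except R' A' s' s'' \<Longrightarrow> same_except (R \<union> R') (A \<union> A') s s''"
  by (simp add: same_except_def)

lemma same_except_mono:
  "same_except R A s s' \<Longrightarrow> R \<subseteq> R' \<Longrightarrow> A \<subseteq> A' \<Longrightarrow> same_except R' A' s s'"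
  by (auto simp: same_except_def)

lemma same_except_reg: "same_except R A s s' \<Longrightarrow> x \<notin> R \<Longrightarrow> reg s' x = reg s x"
  and same_except_arr: "same_except R A s s' \<Longrightarrow> a \<notin> A \<Longrightarrow> arr s' a = arr s a"
  by (simp_all add: same_except_def)

lemma aval_less: "afits B a s \<Longrightarrow> bounded_state B s \<Longrightarrow> aval a s < B"
  by (induction a) (auto simp: less_imp_diff_less)

lemma exec_same_except: "exec B c s t s' \<Longrightarrow> same_except (written_regs c) (written_arrs c) s s'"
proof (induction rule: exec.induct)
  case (Seq c1 s t1 s' c2 t2 s'')
  then show ?case using same_except_trans by fastforce
next
  case (CondTrue b s c1 t s' c2)
  then show ?case by (auto elim: same_except_mono)
next
  case (CondFalse b s c2 t s' c1)
  then show ?case by (auto elim: same_except_mono)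
next
  case (WhileTrue b s c t1 s' t2 s'')
  then show ?case using same_except_trans by fastforce
qed (simp_all add: same_except_def)

lemma exec_bounded: "exec B c s t s' \<Longrightarrow> bounded_state B s \<Longrightarrow> bounded_state B s'"
proof (induction rule: exec.induct)
  case (Assign a s x)
  then show ?case by (simp only: bounded_set_reg aval_less)
next
  case (Store i s a A)
  then show ?case by (simp only: bounded_set_arr aval_less)
qed simp_all

definition runs :: "nat \<Rightarrow> com \<Rightarrow> state \<Rightarrow> nat \<Rightarrow> state \<Rightarrow> bool" where
  "runs B c s T s' \<longleftrightarrow> (\<exists>t\<le>T. exec B c s t s')"

lemma runs_mono: "runs B c s T s' \<Longrightarrow> T \<le> T' \<Longrightarrow> runs B c s T' s'"
  unfolding runs_def by (meson le_trans)

lemma runs_bounded: "runs B c s T s' \<Longrightarrow> bounded_state B s \<Longrightarrow> bounded_state B s'"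
  by (auto simp: runs_def dest: exec_bounded)

lemma runs_same_except: "runs B c s T s' \<Longrightarrow> same_except (written_regs c) (written_arrs c) s s'"
  by (auto simp: runs_def dest: exec_same_except)

lemmas runs_reg = same_except_reg[OF runs_same_except]
  and runs_arr = same_except_arr[OF runs_same_except]

lemma runs_Skip: "runs B Skip s 1 s"
  using exec.Skip by (auto simp: runs_def)

lemma runs_Seq:
  assumes "runs B c1 s T1 s'" "runs B c2 s' T2 s''"
  shows "runs B (c1 ;; c2) s (T1 + T2) s''"
  using assms unfolding runs_def by (meson add_mono exec.Seq)

definition tests :: "nat \<Rightarrow> bexp \<Rightarrow> state \<Rightarrow> bool \<Rightarrow> bool" where
  "tests B b s p \<longleftrightarrow> bfits B b s \<and> (bval b s \<longleftrightarrow> p)"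

lemma tests_Neg: "tests B b s p \<Longrightarrow> tests B (Neg b) s (\<not> p)"
  and tests_Conj: "tests B b s p \<Longrightarrow> tests B c s q \<Longrightarrow> tests B (Conj b c) s (p \<and> q)"
  by (simp_all add: tests_def)

lemma runs_Cond_True:
  assumes "tests B b s True" "runs B c1 s T s'"
  shows "runs B (Cond b c1 c2) s (1 + bcost b + T) s'"
  using assms exec.CondTrue[of B b s c1] unfolding runs_def tests_def by (meson add_left_mono)

lemma runs_Cond_False:
  assumes "tests B b s False" "runs B c2 s T s'"
  shows "runs B (Cond b c1 c2) s (1 + bcost b + T) s'"
  using assms exec.CondFalse[of B b s c2] unfolding runs_def tests_def by (meson add_left_mono)

lemma runs_While_False: "tests B b s False \<Longrightarrow> runs B (While b c) s (1 + bcost b) s"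
  using exec.WhileFalse[of B b s c] unfolding runs_def tests_def by blast

lemma runs_While_True:
  assumes "tests B b s True" "runs B c s T s'" "runs B (While b c) s' U s''"
  shows "runs B (While b c) s (1 + bcost b + T + U) s''"
proof -
  obtain t u where tu: "t \<le> T" "exec B c s t s'" "u \<le> U" "exec B (While b c) s' u s''"
    using assms(2,3) by (auto simp: runs_def)
  then have "exec B (While b c) s (1 + bcost b + t + u) s''"
    using assms(1) by (intro exec.WhileTrue) (auto simp: tests_def)
  then show ?thesis
    using tu(1,3) unfolding runs_def by (intro exI[of _ "1 + bcost b + t + u"]) simp
qed

lemma runs_While:
  assumes "bounded_state B s" and "I s"
    and test: "\<And>s'. bounded_state B s' \<Longrightarrow> same_except (written_regs c) (written_arrs c) s s' \<Longrightarrow> I s'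
        \<Longrightarrow> tests B b s' (P s')"
    and step: "\<And>s'. bounded_state B s' \<Longrightarrow> same_except (written_regs c) (written_arrs c) s s' \<Longrightarrow> I s'
        \<Longrightarrow> P s' \<Longrightarrow> \<exists>s''. runs B c s' T s'' \<and> I s'' \<and> (rank s'' :: nat) < rank s'"
  obtains s' where "runs B (While b c) s (rank s * (T + bcost b + 1) + bcost b + 1) s'"
    "I s'" "\<not> P s'"
proof -
  have "\<exists>r'. runs B (While b c) r (rank r * (T + bcost b + 1) + bcost b + 1) r' \<and> I r' \<and> \<not> P r'"
    if "bounded_state B r" "same_except (written_regs c) (written_arrs c) s r" "I r" for r
    using that
  proof (induction "rank r" arbitrary: r rule: less_induct)
    case less
    show ?case
    proof (cases "P r")
      case False
      then have "runs B (While b c) r (1 + bcost b) r"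
        using runs_While_False test less.prems by metis
      then have "runs B (While b c) r (rank r * (T + bcost b + 1) + bcost b + 1) r"
        by (rule runs_mono) simp
      then show ?thesis using less.prems(3) False by blast
    next
      case True
      then obtain r1 where r1: "runs B c r T r1" "I r1" "rank r1 < rank r"
        using step less.prems by blast
      have "same_except (written_regs c) (written_arrs c) s r1"
        using same_except_trans[OF less.prems(2) runs_same_except[OF r1(1)]] by simp
      then obtain r2 where r2: "I r2" "\<not> P r2"
        "runs B (While b c) r1 (rank r1 * (T + bcost b + 1) + bcost b + 1) r2"
        using less.hyps[OF r1(3) runs_bounded[OF r1(1) less.prems(1)]] r1(2) by blast
      have "tests B b r True" using test[OF less.prems] True by simp
      then have "runs B (While b c) r
          (1 + bcost b + T + (rank r1 * (T + bcost b + 1) + bcost b + 1)) r2"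
        using r1(1) r2(3) by (rule runs_While_True)
      moreover have "Suc (rank r1) * (T + bcost b + 1) \<le> rank r * (T + bcost b + 1)"
        using r1(3) by (intro mult_right_mono) auto
      ultimately have "runs B (While b c) r (rank r * (T + bcost b + 1) + bcost b + 1) r2"
        by (auto elim: runs_mono)
      then show ?thesis using r2(1,2) by blast
    qed
  qed
  then show thesis using assms(1,2) that same_except_refl by blast
qed

fun wp :: "nat \<Rightarrow> com \<Rightarrow> state \<Rightarrow> (state \<Rightarrow> bool) \<Rightarrow> bool" where
  "wp B Skip s Q = Q s"
| "wp B (Assign x a) s Q = (afits B a s \<and> Q (set_reg x (aval a s) s))"
| "wp B (Store A i a) s Q = (afits B i s \<and> afits B a s \<and> Q (set_arr A (aval i s) (aval a s) s))"
| "wp B (c1 ;; c2) s Q = wp B c1 s (\<lambda>s'. wp B c2 s' Q)"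
| "wp B (Cond b c1 c2) s Q = (bfits B b s \<and> (if bval b s then wp B c1 s Q else wp B c2 s Q))"
| "wp B (While b c) s Q = False"

fun straight_cost :: "com \<Rightarrow> nat" where
  "straight_cost Skip = 1"
| "straight_cost (Assign x a) = 1 + acost a"
| "straight_cost (Store A i a) = 1 + acost i + acost a"
| "straight_cost (c1 ;; c2) = straight_cost c1 + straight_cost c2"
| "straight_cost (Cond b c1 c2) = 1 + bcost b + max (straight_cost c1) (straight_cost c2)"
| "straight_cost (While b c) = 0"

lemma wp_runs: "wp B c s Q \<Longrightarrow> \<exists>s'. runs B c s (straight_cost c) s' \<and> Q s'"
proof (induction c arbitrary: s Q)
  case (Assign x a)
  then show ?case using exec.Assign[of B a s x] by (auto simp: runs_def)
next
  case (Store A i a)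
  then show ?case using exec.Store[of B i s a A] by (auto simp: runs_def)
next
  case (Seq c1 c2)
  from Seq.prems have "wp B c1 s (\<lambda>s'. wp B c2 s' Q)" by simp
  from Seq.IH(1)[OF this] obtain s1 where s1: "runs B c1 s (straight_cost c1) s1" "wp B c2 s1 Q"
    by blast
  from Seq.IH(2)[OF s1(2)] show ?case using runs_Seq[OF s1(1)] by auto
next
  case (Cond b c1 c2)
  let ?T = "max (straight_cost c1) (straight_cost c2)"
  have test: "tests B b s (bval b s)" using Cond.prems by (simp add: tests_def)
  have "\<exists>s'. runs B (Cond b c1 c2) s (1 + bcost b + ?T) s' \<and> Q s'"
  proof (cases "bval b s")
    case True
    then obtain s' where "runs B c1 s (straight_cost c1) s'" "Q s'"
      using Cond.prems Cond.IH(1)[of s Q] by auto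
    moreover from this(1) have "runs B c1 s ?T s'" by (rule runs_mono) simp
    ultimately show ?thesis using test True runs_Cond_True by metis
  next
    case False
    then obtain s' where "runs B c2 s (straight_cost c2) s'" "Q s'"
      using Cond.prems Cond.IH(2)[of s Q] by auto
    moreover from this(1) have "runs B c2 s ?T s'" by (rule runs_mono) simp
    ultimately show ?thesis using test False runs_Cond_False by metis
  qed
  then show ?case by simp
qed (use runs_Skip in \<open>auto simp: numeral_eq_Suc\<close>)

lemma runs_straight:
  assumes "straight_cost c \<le> T" "wp B c s Q"
  obtains s' where "runs B c s T s'" "Q s'"
  using wp_runs[OF assms(2)] assms(1) runs_mono by blast

lemma runs_straight_eq: "straight_cost c \<le> T \<Longrightarrow> wp B c s (\<lambda>s'. s' = r) \<Longrightarrow> runs B c s T r"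
  by (erule runs_straight[where Q = "\<lambda>s'. s' = r"]) auto

definition For :: "nat \<Rightarrow> nat \<Rightarrow> com \<Rightarrow> com" where
  "For x N c = Assign x (Const 0) ;;
     While (Less (Reg x) (Reg N)) (c ;; Assign x (Add (Reg x) (Const 1)))"

lemma written_For [simp]:
  "written_regs (For x N c) = insert x (written_regs c)"
  "written_arrs (For x N c) = written_arrs c"
  by (auto simp: For_def)

lemma runs_For:
  assumes bounded: "bounded_state B s" and B: "1 < B" and x: "x \<notin> written_regs c"
    and N: "N \<notin> written_regs c" "N \<noteq> x"
    and indep: "\<And>i j s'. j < B \<Longrightarrow> I i s' \<Longrightarrow> I i (set_reg x j s')" and init: "I 0 s"
    and step: "\<And>i s'. i < reg s N \<Longrightarrow> reg s' x = i \<Longrightarrow> bounded_state B s'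
        \<Longrightarrow> same_except (insert x (written_regs c)) (written_arrs c) s s' \<Longrightarrow> I i s'
        \<Longrightarrow> \<exists>s''. runs B c s' T s'' \<and> I (Suc i) s''"
  obtains s' where "runs B (For x N c) s (reg s N * (T + 8) + 6) s'" "I (reg s N) s'"
proof -
  let ?incr = "Assign x (Add (Reg x) (Const 1))" and ?s0 = "set_reg x 0 s"
  let ?test = "Less (Reg x) (Reg N)"
  define loop_inv where "loop_inv s' \<longleftrightarrow> reg s' x \<le> reg s N \<and> I (reg s' x) s'" for s'
  have enter: "runs B (Assign x (Const 0)) s 2 ?s0"
    using B by (intro runs_straight_eq) auto
  obtain s' where s': "loop_inv s'" "\<not> reg s' x < reg s N"
    "runs B (While ?test (c ;; ?incr)) ?s0
      ((reg s N - reg ?s0 x) * (T + 4 + bcost ?test + 1) + bcost ?test + 1) s'"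
  proof (rule runs_While[where B = B and s = ?s0 and I = loop_inv and P = "\<lambda>s'. reg s' x < reg s N"
        and rank = "\<lambda>s'. reg s N - reg s' x" and T = "T + 4" and b = ?test and c = "c ;; ?incr"])
    show "bounded_state B ?s0" by (rule runs_bounded[OF enter bounded])
    show "loop_inv ?s0" using init indep B by (simp add: loop_inv_def)
    fix r assume r: "bounded_state B r" "loop_inv r"
      and "same_except (written_regs (c ;; ?incr)) (written_arrs (c ;; ?incr)) ?s0 r"
    then have frame: "same_except (insert x (written_regs c)) (written_arrs c) s r"
      by (auto simp: same_except_def)
    have rN: "reg r N = reg s N" using same_except_reg[OF frame] N by simp
    show "tests B ?test r (reg r x < reg s N)" using r(1) by (simp add: tests_def flip: rN)
    assume less: "reg r x < reg s N"
    then obtain r1 where r1: "runs B c r T r1" "I (Suc (reg r x)) r1"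
      using step[OF _ refl r(1) frame] r(2) by (auto simp: loop_inv_def)
    have r1x: "reg r1 x = reg r x" "reg r1 N = reg s N" using runs_reg[OF r1(1)] x N rN by simp_all
    have fits: "Suc (reg r x) < B"
      using less rN bounded_reg[OF r(1), of N] by linarith
    then have "runs B ?incr r1 4 (set_reg x (Suc (reg r x)) r1)"
      using B r1x by (intro runs_straight_eq) auto
    then have "runs B (c ;; ?incr) r (T + 4) (set_reg x (Suc (reg r x)) r1)"
      by (rule runs_Seq[OF r1(1)])
    moreover have "loop_inv (set_reg x (Suc (reg r x)) r1)"
      using less r1(2) indep fits by (simp add: loop_inv_def)
    ultimately show
      "\<exists>r'. runs B (c ;; ?incr) r (T + 4) r' \<and> loop_inv r' \<and>
        reg s N - reg r' x < reg s N - reg r x"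
      using less by (intro exI conjI) auto
  qed
  have "reg s' x = reg s N" using s'(1,2) by (simp add: loop_inv_def)
  then have "I (reg s N) s'" using s'(1) by (simp add: loop_inv_def)
  moreover have "runs B (For x N c) s (reg s N * (T + 8) + 6) s'"
    unfolding For_def using runs_Seq[OF enter s'(3)] by (rule runs_mono) simp
  ultimately show thesis using that by blast
qed

lemma runs_For_straight:
  assumes "bounded_state B s" "1 < B" "x \<notin> written_regs c" "N \<notin> written_regs c" "N \<noteq> x"
    and indep: "\<And>i j s'. j < B \<Longrightarrow> I i s' \<Longrightarrow> I i (set_reg x j s')" and "I 0 s"
    and "straight_cost c \<le> T"
    and step: "\<And>i s'. i < reg s N \<Longrightarrow> reg s' x = i \<Longrightarrow> bounded_state B s'
        \<Longrightarrow> same_except (insert x (written_regs c)) (written_arrs c) s s' \<Longrightarrow> I i s'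
        \<Longrightarrow> wp B c s' (I (Suc i))"
  obtains s' where "runs B (For x N c) s (reg s N * (T + 8) + 6) s'" "I (reg s N) s'"
  using assms(1-5) indep assms(7)
proof (rule runs_For[where T = T])
  show "\<exists>s''. runs B c s' T s'' \<and> I (Suc i) s''"
    if "i < reg s N" "reg s' x = i" "bounded_state B s'"
      "same_except (insert x (written_regs c)) (written_arrs c) s s'" "I i s'" for i s'
    using step[OF that] by (rule runs_straight[OF assms(8)]) blast
qed (use that in auto)

section \<open>The reconfiguration program\<close>

text \<open>Registers 0 to 3 and arrays 0 to 3 are those of \<open>input_state\<close> and \<open>outputs\<close>; array 1 is
  overwritten with the current configuration. Entries of \<open>mate_arr\<close> are shifted by one, \<open>0\<close> meaning
  unmatched.\<close>

abbreviation (input) n_reg :: nat where "n_reg \<equiv> 0"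
abbreviation (input) m_reg :: nat where "m_reg \<equiv> 1"
abbreviation (input) moves_reg :: nat where "moves_reg \<equiv> 3"
abbreviation (input) u_reg :: nat where "u_reg \<equiv> 4"
abbreviation (input) v_reg :: nat where "v_reg \<equiv> 5"
abbreviation (input) head_reg :: nat where "head_reg \<equiv> 6"
abbreviation (input) tail_reg :: nat where "tail_reg \<equiv> 7"
abbreviation (input) root_reg :: nat where "root_reg \<equiv> 8"
abbreviation (input) cand_reg :: nat where "cand_reg \<equiv> 9"
abbreviation (input) found_reg :: nat where "found_reg \<equiv> 10"
abbreviation (input) token_reg :: nat where "token_reg \<equiv> 11"
abbreviation (input) cur_reg :: nat where "cur_reg \<equiv> 12"
abbreviation (input) next_reg :: nat where "next_reg \<equiv> 13"
abbreviation (input) free_reg :: nat where "free_reg \<equiv> 14"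
abbreviation (input) idx_reg :: nat where "idx_reg \<equiv> 15"

abbreviation (input) inc_arr :: nat where "inc_arr \<equiv> 0"
abbreviation (input) config_arr :: nat where "config_arr \<equiv> 1"
abbreviation (input) target_arr :: nat where "target_arr \<equiv> 2"
abbreviation (input) out_arr :: nat where "out_arr \<equiv> 3"
abbreviation (input) adj_arr :: nat where "adj_arr \<equiv> 4"
abbreviation (input) mate_arr :: nat where "mate_arr \<equiv> 5"
abbreviation (input) level_arr :: nat where "level_arr \<equiv> 6"
abbreviation (input) queue_arr :: nat where "queue_arr \<equiv> 7"

definition is_source :: "nat \<Rightarrow> bexp" where
  "is_source y = Less (Arr target_arr (Reg y)) (Arr config_arr (Reg y))"

definition is_target :: "nat \<Rightarrow> bexp" where
  "is_target y = Less (Arr config_arr (Reg y)) (Arr target_arr (Reg y))"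

definition is_unmatched :: "nat \<Rightarrow> bexp" where
  "is_unmatched y = Equal (Arr mate_arr (Reg y)) (Const 0)"

definition is_adjacent :: "nat \<Rightarrow> nat \<Rightarrow> bexp" where
  "is_adjacent x y = Equal (Arr adj_arr (Add (Mul (Reg x) (Reg n_reg)) (Reg y))) (Const 1)"

definition is_alternating :: bexp where
  "is_alternating = Neg (Conj
     (Neg (Conj (is_source u_reg) (Conj (is_target v_reg) (is_adjacent u_reg v_reg))))
     (Neg (Conj (Equal (Arr config_arr (Reg u_reg)) (Const 0))
                (Equal (Arr mate_arr (Reg u_reg)) (Add (Reg v_reg) (Const 1))))))"

definition is_reached :: "nat \<Rightarrow> bexp" where
  "is_reached y = Less (Const 0) (Arr level_arr (Reg y))"

definition precedes :: "nat \<Rightarrow> nat \<Rightarrow> bexp" where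
  "precedes y x = Equal (Add (Arr level_arr (Reg y)) (Const 1)) (Arr level_arr (Reg x))"

definition is_source_pred :: bexp where
  "is_source_pred =
     Conj (is_source cand_reg) (Conj (is_adjacent cand_reg cur_reg) (precedes cand_reg cur_reg))"

definition is_walk_succ :: bexp where
  "is_walk_succ = Conj (is_adjacent cur_reg cand_reg) (precedes cand_reg cur_reg)"

definition is_free_target :: bexp where
  "is_free_target = Conj (is_target cand_reg) (is_unmatched cand_reg)"

definition Find :: "bexp \<Rightarrow> com" where
  "Find b = Assign found_reg (Reg n_reg) ;;
     For cand_reg n_reg (Cond b (Assign found_reg (Reg cand_reg)) Skip)"

definition Visit :: "bexp \<Rightarrow> com" where
  "Visit b = Cond (Conj b (Equal (Arr level_arr (Reg v_reg)) (Const 0)))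
     (Store level_arr (Reg v_reg) (Add (Arr level_arr (Reg u_reg)) (Const 1)) ;;
      Store queue_arr (Reg tail_reg) (Reg v_reg) ;;
      Assign tail_reg (Add (Reg tail_reg) (Const 1)))
     Skip"

definition Scan :: "bexp \<Rightarrow> com" where
  "Scan b = Cond (Less (Reg head_reg) (Reg tail_reg))
     (Assign u_reg (Arr queue_arr (Reg head_reg)) ;; For v_reg n_reg (Visit b))
     Skip"

definition Init_Bfs :: com where
  "Init_Bfs = For v_reg n_reg (Store level_arr (Reg v_reg) (Const 0)) ;;
     Store level_arr (Reg root_reg) (Const 1) ;;
     Store queue_arr (Const 0) (Reg root_reg) ;;
     Assign tail_reg (Const 1)"

definition Bfs :: "bexp \<Rightarrow> com" where
  "Bfs b = Init_Bfs ;; For head_reg n_reg (Scan b)"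

definition Mark_Adjacent :: com where
  "Mark_Adjacent =
     Cond (Conj (Equal (Arr inc_arr (Add (Mul (Reg idx_reg) (Reg n_reg)) (Reg u_reg))) (Const 1))
                (Equal (Arr inc_arr (Add (Mul (Reg idx_reg) (Reg n_reg)) (Reg v_reg))) (Const 1)))
       (Store adj_arr (Add (Mul (Reg u_reg) (Reg n_reg)) (Reg v_reg)) (Const 1))
       Skip"

definition Mark_Edge :: com where
  "Mark_Edge = For u_reg n_reg (For v_reg n_reg Mark_Adjacent)"

definition Adjacency :: com where
  "Adjacency = For idx_reg m_reg Mark_Edge"

definition Write_Config :: com where
  "Write_Config = For idx_reg n_reg
     (Store out_arr (Add (Mul (Reg moves_reg) (Reg n_reg)) (Reg idx_reg))
         (Arr config_arr (Reg idx_reg)))"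

definition Emit :: com where
  "Emit = Assign moves_reg (Add (Reg moves_reg) (Const 1)) ;; Write_Config"

definition Rematch :: com where
  "Rematch =
     Cond (is_unmatched found_reg)
       (Assign next_reg (Reg n_reg))
       (Assign next_reg (Sub (Arr mate_arr (Reg found_reg)) (Const 1)) ;;
        Store mate_arr (Reg next_reg) (Const 0)) ;;
     Store mate_arr (Reg found_reg) (Add (Reg cur_reg) (Const 1)) ;;
     Store mate_arr (Reg cur_reg) (Add (Reg found_reg) (Const 1)) ;;
     Assign cur_reg (Reg next_reg)"

definition Augment_Step :: com where
  "Augment_Step = Find is_source_pred ;; Rematch"

definition Augment :: com where
  "Augment = Assign cur_reg (Reg found_reg) ;; While (Less (Reg cur_reg) (Reg n_reg)) Augment_Step"

definition Release :: com where
  "Release = For idx_reg n_reg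
     (Cond (Conj (is_reached idx_reg) (Neg (Equal (Reg idx_reg) (Reg token_reg))))
       (Store config_arr (Reg idx_reg) (Sub (Const 1) (Arr config_arr (Reg idx_reg))) ;;
        Store mate_arr (Reg idx_reg) (Const 0))
       Skip)"

definition Place :: com where
  "Place = Store config_arr (Reg free_reg) (Const 0) ;;
     Store config_arr (Reg cur_reg) (Const 1) ;;
     Assign free_reg (Reg cur_reg)"

definition Step :: com where
  "Step = Assign cur_reg (Reg found_reg) ;;
     Cond (Equal (Arr config_arr (Reg cur_reg)) (Const 0)) (Place ;; Emit) Skip"

definition Walk_Step :: com where
  "Walk_Step = Find is_walk_succ ;; Step"

definition Walk :: com where
  "Walk = (Assign cur_reg (Reg token_reg) ;; Assign free_reg (Reg token_reg)) ;;
     While (Less (Const 1) (Arr level_arr (Reg cur_reg))) Walk_Step"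

definition Deliver :: com where
  "Deliver = Find is_free_target ;;
     Assign root_reg (Reg found_reg) ;;
     Bfs (is_adjacent u_reg v_reg) ;;
     Walk"

definition Redirect :: com where
  "Redirect = Release ;; Emit ;; Deliver"

definition Match_Token :: com where
  "Match_Token = Assign root_reg (Reg token_reg) ;;
     Bfs is_alternating ;;
     Find (Conj is_free_target (is_reached cand_reg)) ;;
     Cond (Less (Reg found_reg) (Reg n_reg)) Augment Redirect"

definition Match_If_Unmatched :: com where
  "Match_If_Unmatched = Cond (Conj (is_source token_reg) (is_unmatched token_reg)) Match_Token Skip"

definition Match_Tokens :: com where
  "Match_Tokens = For token_reg n_reg Match_If_Unmatched"

definition Finish :: com where
  "Finish = For idx_reg n_reg
    (Store config_arr (Reg idx_reg) (Arr target_arr (Reg idx_reg))) ;; Emit"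

definition Prepare :: com where
  "Prepare = Adjacency ;; Write_Config"

definition Reconfigure :: com where
  "Reconfigure = Prepare ;; Cond (Less (Const 1) (Reg n_reg)) (Match_Tokens ;; Finish) Skip"

lemma bcost_tests [simp]:
  "bcost (is_source y) = 5" "bcost (is_target y) = 5" "bcost (is_unmatched y) = 4"
  "bcost (is_adjacent x y) = 8" "bcost is_alternating = 35" "bcost (is_reached y) = 4"
  "bcost (precedes y x) = 7" "bcost is_source_pred = 22" "bcost is_walk_succ = 16"
  "bcost is_free_target = 10"
  by (simp_all add: is_source_def is_target_def is_unmatched_def is_adjacent_def
    is_alternating_def is_reached_def precedes_def is_source_pred_def is_walk_succ_def
    is_free_target_def)

lemma written_regs_programs [simp]:
  "written_regs (Find b) = {cand_reg, found_reg}"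
  "written_regs (Visit b) = {tail_reg}"
  "written_regs (Scan b) = {u_reg, v_reg, tail_reg}"
  "written_regs Init_Bfs = {v_reg, tail_reg}"
  "written_regs (Bfs b) = {u_reg, v_reg, head_reg, tail_reg}"
  "written_regs Mark_Adjacent = {}"
  "written_regs Mark_Edge = {u_reg, v_reg}"
  "written_regs Adjacency = {u_reg, v_reg, idx_reg}"
  "written_regs Write_Config = {idx_reg}"
  "written_regs Emit = {moves_reg, idx_reg}"
  "written_regs Rematch = {cur_reg, next_reg}"
  "written_regs Augment_Step = {cand_reg, found_reg, cur_reg, next_reg}"
  "written_regs Augment = {cand_reg, found_reg, cur_reg, next_reg}"
  "written_regs Release = {idx_reg}"
  "written_regs Place = {free_reg}"
  "written_regs Step = {moves_reg, cur_reg, free_reg, idx_reg}"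
  "written_regs Walk_Step = {moves_reg, cand_reg, found_reg, cur_reg, free_reg, idx_reg}"
  "written_regs Walk = {moves_reg, cand_reg, found_reg, cur_reg, free_reg, idx_reg}"
  "written_regs Match_If_Unmatched = {moves_reg, u_reg, v_reg, head_reg, tail_reg, root_reg,
     cand_reg, found_reg, cur_reg, next_reg, free_reg, idx_reg}"
  by (auto simp: Find_def Visit_def Scan_def Init_Bfs_def Bfs_def Mark_Adjacent_def Mark_Edge_def
    Adjacency_def Write_Config_def Emit_def Rematch_def Augment_Step_def Augment_def Release_def
    Place_def Step_def Walk_Step_def Walk_def Deliver_def Redirect_def Match_Token_def
    Match_If_Unmatched_def)

lemma written_arrs_programs [simp]:
  "written_arrs (Find b) = {}"
  "written_arrs (Visit b) = {level_arr, queue_arr}"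
  "written_arrs (Scan b) = {level_arr, queue_arr}"
  "written_arrs Init_Bfs = {level_arr, queue_arr}"
  "written_arrs (Bfs b) = {level_arr, queue_arr}"
  "written_arrs Mark_Adjacent = {adj_arr}"
  "written_arrs Mark_Edge = {adj_arr}"
  "written_arrs Adjacency = {adj_arr}"
  "written_arrs Write_Config = {out_arr}"
  "written_arrs Emit = {out_arr}"
  "written_arrs Rematch = {mate_arr}"
  "written_arrs Augment_Step = {mate_arr}"
  "written_arrs Augment = {mate_arr}"
  "written_arrs Release = {config_arr, mate_arr}"
  "written_arrs Place = {config_arr}"
  "written_arrs Step = {config_arr, out_arr}"
  "written_arrs Walk_Step = {config_arr, out_arr}"
  "written_arrs Walk = {config_arr, out_arr}"
  "written_arrs Match_If_Unmatched = {config_arr, out_arr, mate_arr, level_arr, queue_arr}"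
  by (auto simp: Find_def Visit_def Scan_def Init_Bfs_def Bfs_def Mark_Adjacent_def Mark_Edge_def
    Adjacency_def Write_Config_def Emit_def Rematch_def Augment_Step_def Augment_def Release_def
    Place_def Step_def Walk_Step_def Walk_def Deliver_def Redirect_def Match_Token_def
    Match_If_Unmatched_def)

section \<open>Search procedures\<close>

lemma runs_Find:
  assumes bounded: "bounded_state B s" and n: "reg s n_reg = n" and B: "1 < B"
    and b: "\<And>s' y. y < n \<Longrightarrow> reg s' cand_reg = y \<Longrightarrow> bounded_state B s'
        \<Longrightarrow> same_except {cand_reg, found_reg} {} s s' \<Longrightarrow> tests B b s' (P y)"
  obtains s' where "runs B (Find b) s (n * (bcost b + 11) + 8) s'"
    "reg s' found_reg < n \<longleftrightarrow> (\<exists>y<n. P y)" "reg s' found_reg < n \<longrightarrow> P (reg s' found_reg)"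
proof -
  let ?body = "Cond b (Assign found_reg (Reg cand_reg)) Skip"
  define I where "I i s' \<longleftrightarrow> (reg s' found_reg < n \<longleftrightarrow> (\<exists>y<i. P y)) \<and>
    (reg s' found_reg < n \<longrightarrow> P (reg s' found_reg))" for i and s' :: state
  let ?s1 = "set_reg found_reg n s"
  have assign: "runs B (Assign found_reg (Reg n_reg)) s 2 ?s1"
    using bounded n by (intro runs_straight_eq) auto
  have bounded1: "bounded_state B ?s1" by (rule runs_bounded[OF assign bounded])
  obtain s' where s': "runs B (For cand_reg n_reg ?body) ?s1 (n * (bcost b + 3 + 8) + 6) s'"
    "I n s'"
  proof (rule runs_For_straight[OF bounded1 B, of cand_reg ?body n_reg I "bcost b + 3"])
    fix i r assume r: "i < reg ?s1 n_reg" "reg r cand_reg = i" "bounded_state B r" "I i r"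
      and "same_except (insert cand_reg (written_regs ?body)) (written_arrs ?body) ?s1 r"
    then have "same_except {cand_reg, found_reg} {} s r" by (simp add: same_except_def)
    then have "tests B b r (P i)" using b[of i r] r n by simp
    then show "wp B ?body r (I (Suc i))"
      using r n by (auto simp: tests_def I_def less_Suc_eq)
  qed (use n in \<open>auto simp: I_def\<close>)
  have "runs B (Find b) s (n * (bcost b + 11) + 8) s'"
    unfolding Find_def using runs_Seq[OF assign s'(1)]
    by (rule runs_mono) (simp add: algebra_simps)
  then show thesis using that s'(2) by (simp add: I_def)
qed

context
  fixes B n a :: nat and b :: bexp and E :: "nat \<Rightarrow> nat \<Rightarrow> bool" and s0 :: state
  assumes n: "reg s0 n_reg = n" and B: "Suc n < B" and a: "reg s0 root_reg = a" "a < n"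
    and test: "\<And>s u v. u < n \<Longrightarrow> v < n \<Longrightarrow> reg s u_reg = u \<Longrightarrow> reg s v_reg = v \<Longrightarrow> bounded_state B s
        \<Longrightarrow> same_except {u_reg, v_reg, head_reg, tail_reg} {level_arr, queue_arr} s0 s
        \<Longrightarrow> tests B b s (E u v)"
begin

definition bfs_state :: "nat \<Rightarrow> nat \<Rightarrow> state \<Rightarrow> bool" where
  "bfs_state h v s \<longleftrightarrow>
     bfs_inv {..<n} E a h {..<v} (arr s level_arr) (arr s queue_arr) (reg s tail_reg)"

lemma wp_Visit:
  assumes s: "bounded_state B s"
      "same_except {u_reg, v_reg, head_reg, tail_reg} {level_arr, queue_arr} s0 s"
    and inv: "bfs_state h v s" and h: "h < reg s tail_reg" "reg s u_reg = arr s queue_arr h"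
    and v: "reg s v_reg = v" "v < n"
  shows "wp B (Visit b) s (\<lambda>s'. bfs_state h (Suc v) s' \<and> h < reg s' tail_reg \<and>
    reg s' u_reg = arr s' queue_arr h)"
proof -
  interpret bfs_inv "{..<n}" E a h "{..<v}" "arr s level_arr" "arr s queue_arr" "reg s tail_reg"
    using inv by (simp add: bfs_state_def)
  have u: "reg s u_reg < n" using queue_entry(1)[OF h(1)] h(2) by simp
  have tail: "reg s tail_reg \<le> n" using queue_length_le by simp
  have "arr s level_arr (reg s u_reg) \<le> n" using level_le u by simp
  then have fits: "Suc (arr s level_arr (reg s u_reg)) < B" "Suc (reg s tail_reg) < B"
    "1 < B" "v < B"
    using tail B u v(2) by auto
  have b: "tests B b s (E (reg s u_reg) v)" using test u v s by blast
  show ?thesis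
  proof (cases "E (reg s u_reg) v \<and> arr s level_arr v = 0")
    case True
    then show ?thesis
      using visit[of v] b fits s(1) h v
      by (simp add: Visit_def tests_def bfs_state_def lessThan_Suc)
  next
    case False
    then show ?thesis
      using skip[of v] b fits s(1) h v
      by (auto simp: Visit_def tests_def bfs_state_def lessThan_Suc)
  qed
qed

lemma runs_For_Visit:
  assumes s: "bounded_state B s"
      "same_except {u_reg, v_reg, head_reg, tail_reg} {level_arr, queue_arr} s0 s"
    and inv: "bfs_state h 0 s" and h: "h < reg s tail_reg" "reg s u_reg = arr s queue_arr h"
  obtains s' where "runs B (For v_reg n_reg (Visit b)) s (n * (bcost b + 27) + 6) s'"
    "bfs_state h n s'"
proof -
  have sn: "reg s n_reg = n" using same_except_reg[OF s(2)] n by simp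
  define I where "I v r \<longleftrightarrow> bfs_state h v r \<and> h < reg r tail_reg \<and>
    reg r u_reg = arr r queue_arr h" for v r
  obtain s' where s': "runs B (For v_reg n_reg (Visit b)) s (n * (bcost b + 19 + 8) + 6) s'"
    "I n s'"
  proof (rule runs_For_straight[OF s(1), of v_reg "Visit b" n_reg I "bcost b + 19"])
    show "I 0 s" using inv h by (simp add: I_def)
    show "straight_cost (Visit b) \<le> bcost b + 19" by (simp add: Visit_def)
    fix v r assume r: "v < reg s n_reg" "reg r v_reg = v" "bounded_state B r" "I v r"
      and "same_except (insert v_reg (written_regs (Visit b))) (written_arrs (Visit b)) s r"
    then have "same_except {u_reg, v_reg, head_reg, tail_reg} {level_arr, queue_arr} s0 r"
      using s(2) by (simp add: same_except_def)
    then show "wp B (Visit b) r (I (Suc v))"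
      unfolding I_def using wp_Visit[OF r(3)] r sn by (simp add: I_def)
  qed (use B sn in \<open>auto simp: I_def bfs_state_def\<close>)
  then show thesis using that by (simp add: I_def add.commute)
qed

lemma runs_Scan:
  assumes s: "bounded_state B s"
      "same_except {u_reg, v_reg, head_reg, tail_reg} {level_arr, queue_arr} s0 s"
    and inv: "bfs_state h 0 s" and h: "reg s head_reg = h"
  obtains s' where "runs B (Scan b) s (n * (bcost b + 27) + 13) s'" "bfs_state (Suc h) 0 s'"
proof -
  have cond: "tests B (Less (Reg head_reg) (Reg tail_reg)) s (h < reg s tail_reg)"
    using s(1) h by (auto simp: tests_def)
  show thesis
  proof (cases "h < reg s tail_reg")
    case True
    let ?s1 = "set_reg u_reg (arr s queue_arr h) s"
    have assign: "runs B (Assign u_reg (Arr queue_arr (Reg head_reg))) s 3 ?s1"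
      using s(1) h by (intro runs_straight_eq) auto
    have "same_except {u_reg, v_reg, head_reg, tail_reg} {level_arr, queue_arr} s0 ?s1"
      using s(2) by (simp add: same_except_def)
    then obtain s' where s': "runs B (For v_reg n_reg (Visit b)) ?s1 (n * (bcost b + 27) + 6) s'"
      "bfs_state h n s'"
      using runs_For_Visit[OF runs_bounded[OF assign s(1)]] inv True
      by (auto simp: bfs_state_def)
    have nonempty: "tests B (Less (Reg head_reg) (Reg tail_reg)) s True" using cond True by simp
    have "runs B (Scan b) s (n * (bcost b + 27) + 13) s'"
      unfolding Scan_def using runs_Cond_True[OF nonempty runs_Seq[OF assign s'(1)]]
      by (rule runs_mono) simp
    moreover have "bfs_state (Suc h) 0 s'"
      using s'(2) bfs_inv.advance[of "{..<n}" E a h "{..<n}"] by (simp add: bfs_state_def)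
    ultimately show thesis by (rule that)
  next
    case False
    then have empty: "tests B (Less (Reg head_reg) (Reg tail_reg)) s False" using cond by simp
    have "runs B (Scan b) s (n * (bcost b + 27) + 13) s"
      unfolding Scan_def using runs_Cond_False[OF empty runs_Skip] by (rule runs_mono) simp
    moreover have "bfs_state (Suc h) 0 s"
      using inv False bfs_inv.advance by (fastforce simp: bfs_state_def)
    ultimately show thesis by (rule that)
  qed
qed

lemma runs_Init_Bfs:
  assumes bounded: "bounded_state B s0"
  obtains s where "runs B Init_Bfs s0 (12 * n + 14) s" "bfs_state 0 0 s"
proof -
  let ?clear = "Store level_arr (Reg v_reg) (Const 0)"
  have word: "1 < B" "0 < B" using B by auto
  obtain s1 where s1: "runs B (For v_reg n_reg ?clear) s0 (n * (4 + 8) + 6) s1"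
    "\<forall>v<n. arr s1 level_arr v = 0"
  proof (rule runs_For_straight[OF bounded word(1), of v_reg ?clear n_reg
        "\<lambda>i s. \<forall>v<i. arr s level_arr v = 0" 4])
  qed (use word n in \<open>auto simp: less_Suc_eq\<close>)
  let ?s2 = "set_reg tail_reg 1 (set_arr queue_arr 0 a (set_arr level_arr a 1 s1))"
  have "reg s1 root_reg = a" using runs_reg[OF s1(1), of root_reg] a by simp
  then have "runs B (Store level_arr (Reg root_reg) (Const 1) ;;
      Store queue_arr (Const 0) (Reg root_reg) ;; Assign tail_reg (Const 1)) s1 8 ?s2"
    using runs_bounded[OF s1(1) bounded] B a(2) by (intro runs_straight_eq) auto
  from runs_Seq[OF s1(1) this] have "runs B Init_Bfs s0 (12 * n + 14) ?s2"
    unfolding Init_Bfs_def by (rule runs_mono) simp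
  moreover have "bfs_inv {..<n} E a 0 {} (arr ?s2 level_arr) (arr ?s2 queue_arr) 1"
    by (rule bfs_inv_init) (use s1(2) a(2) in auto)
  then have "bfs_state 0 0 ?s2" by (simp add: bfs_state_def)
  ultimately show thesis by (rule that)
qed

lemma runs_Bfs:
  assumes bounded: "bounded_state B s0"
  obtains s where "runs B (Bfs b) s0 (n * n * (bcost b + 80)) s"
    "bfs_levels {..<n} E a (arr s level_arr)"
proof -
  obtain s1 where s1: "runs B Init_Bfs s0 (12 * n + 14) s1" "bfs_state 0 0 s1"
    using runs_Init_Bfs[OF bounded] .
  note frame1 = runs_same_except[OF s1(1)]
  obtain s where s: "runs B (For head_reg n_reg (Scan b)) s1
      (n * (n * (bcost b + 27) + 13 + 8) + 6) s" "bfs_state n 0 s"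
  proof (rule runs_For[OF runs_bounded[OF s1(1) bounded], of head_reg "Scan b" n_reg
        "\<lambda>h. bfs_state h 0" "n * (bcost b + 27) + 13"])
    show "bfs_state 0 0 s1" by (rule s1(2))
    fix h r assume r: "reg r head_reg = h" "bounded_state B r" "bfs_state h 0 r"
      and "same_except (insert head_reg (written_regs (Scan b))) (written_arrs (Scan b)) s1 r"
    then have "same_except {u_reg, v_reg, head_reg, tail_reg} {level_arr, queue_arr} s0 r"
      using frame1 by (simp add: same_except_def)
    then show "\<exists>r'. runs B (Scan b) r (n * (bcost b + 27) + 13) r' \<and> bfs_state (Suc h) 0 r'"
      using runs_Scan[OF r(2) _ r(3,1)] by blast
  qed (use B same_except_reg[OF frame1, of n_reg] n in \<open>auto simp: bfs_state_def\<close>)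
  have "n \<le> n * n" "1 \<le> n * n" using a(2) by auto
  then have "33 * n + 20 \<le> 53 * (n * n)" by linarith
  then have "runs B (Bfs b) s0 (n * n * (bcost b + 80)) s"
    unfolding Bfs_def using runs_Seq[OF s1(1) s(1)]
    by (elim runs_mono) (simp add: algebra_simps)
  moreover have "bfs_levels {..<n} E a (arr s level_arr)"
    using s(2) bfs_inv.queue_length_le bfs_inv.levels by (fastforce simp: bfs_state_def)
  ultimately show thesis by (rule that)
qed

end

section \<open>Correctness of the program\<close>

lemma row_major_eq_iff:
  assumes "v < n" "v' < (n :: nat)"
  shows "u * n + v = u' * n + v' \<longleftrightarrow> u = u' \<and> v = v'"
proof
  assume eq: "u * n + v = u' * n + v'"
  have "u = (u * n + v) div n" using assms(1) by simp
  also have "\<dots> = u'" unfolding eq using assms(2) by simp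
  finally show "u = u' \<and> v = v'" using eq by simp
qed simp

lemma outputs_snoc:
  assumes old: "outputs xs Ds s" and "reg s' moves_reg = length Ds"
    and row: "\<And>j. j < length xs \<Longrightarrow>
        arr s' out_arr (length Ds * length xs + j) = of_bool (xs ! j \<in> D)"
    and kept: "\<And>p. p < length Ds * length xs \<Longrightarrow> arr s' out_arr p = arr s out_arr p"
  shows "outputs xs (Ds @ [D]) s'"
  unfolding outputs_def
proof (intro conjI allI impI)
  fix i j assume i: "i < length (Ds @ [D])" and j: "j < length xs"
  show "arr s' out_arr (i * length xs + j) = of_bool (xs ! j \<in> (Ds @ [D]) ! i)"
  proof (cases "i < length Ds")
    case True
    then have "Suc i * length xs \<le> length Ds * length xs" by (intro mult_right_mono) auto
    then have "i * length xs + j < length Ds * length xs" using j by simp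
    then show ?thesis using kept old True j by (simp add: outputs_def nth_append)
  qed (use i row[OF j] in \<open>simp add: nth_append less_Suc_eq\<close>)
qed (use assms(2) in simp)

definition mate_of :: "state \<Rightarrow> nat \<rightharpoonup> nat" where
  "mate_of s v = (case arr s mate_arr v of 0 \<Rightarrow> None | Suc u \<Rightarrow> Some u)"

lemma mate_of_set_reg [simp]: "mate_of (set_reg x v s) = mate_of s"
  by (simp add: mate_of_def fun_eq_iff)

lemma mate_of_cong: "arr s' mate_arr = arr s mate_arr \<Longrightarrow> mate_of s' = mate_of s"
  by (simp add: mate_of_def fun_eq_iff)

locale ram_instance = finite_hypergraph "{..<n}" "set es"
  for n :: nat and es :: "nat set list" +
  fixes S0 T :: "nat set" and k d B :: nat
  assumes S0: "vertex_cover {..<n} (set es) S0" "card S0 = k"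
    and T: "vertex_cover {..<n} (set es) T" "card T = k"
    and diam: "hdiam {..<n} (set es) \<le> enat d"
    and word: "(n + length es + 2) ^ 3 \<le> B"
begin

abbreviation cover :: "nat set \<Rightarrow> bool" where
  "cover \<equiv> vertex_cover {..<n} (set es)"

lemma n_pos: "0 < n"
  using hypergraph by (auto simp: hypergraph_def)

lemma n_le_square: "n \<le> n * n" "1 \<le> n * n"
  using n_pos by auto

lemma iterations_le:
  assumes "r \<le> n"
  shows "r * (b + c * n) + e \<le> (b + c + e) * (n * n)"
proof -
  have "r * (b + c * n) \<le> n * (b + c * n)" using assms by (rule mult_right_mono) simp
  also have "\<dots> = b * n + c * (n * n)" by (simp add: algebra_simps)
  also have "\<dots> + e * 1 \<le> b * (n * n) + c * (n * n) + e * (n * n)"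
    using n_le_square by (intro add_mono mult_left_mono) auto
  finally show ?thesis by (simp add: algebra_simps)
qed

lemma fits_cube:
  assumes "x < (n + 2) ^ 3"
  shows "x < B"
proof -
  have "(n + 2) ^ 3 \<le> (n + length es + 2) ^ 3" by (intro power_mono) auto
  then show ?thesis using assms word by linarith
qed

lemma fits_linear:
  assumes "x \<le> n + 2"
  shows "x < B"
proof (rule fits_cube)
  have "(n + 2) ^ 1 < (n + 2) ^ 3" by (rule power_strict_increasing) auto
  then show "x < (n + 2) ^ 3" using assms by simp
qed

lemma fits_const [simp]: "0 < B" "Suc 0 < B" "1 < B" "2 < B"
  by (rule fits_linear, simp)+

lemma fits_index:
  assumes "u < n + length es" "v < n"
  shows "u * n + v < B" "u * n < B"
proof -
  have "Suc u * n \<le> (n + length es) * n" using assms by (intro mult_right_mono) auto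
  also have "\<dots> < (n + length es + 2) ^ 2"
    unfolding power2_eq_square by (intro mult_strict_mono) auto
  also have "\<dots> \<le> (n + length es + 2) ^ 3" by (rule power_increasing) auto
  finally show "u * n + v < B" "u * n < B" using assms word by auto
qed

lemma fits_row:
  assumes "r < (n + 2) ^ 2" "v < n"
  shows "r * n + v < B" "r * n < B"
proof -
  have "Suc r * n \<le> (n + 2) ^ 2 * (n + 2)" using assms by (intro mult_mono) auto
  also have "\<dots> = (n + 2) ^ 3" by (simp add: power3_eq_cube power2_eq_square)
  finally show "r * n + v < B" "r * n < B" using assms(2) by (auto intro!: fits_cube)
qed

subsection \<open>The adjacency matrix\<close>

definition reads_incidence :: "state \<Rightarrow> bool" where
  "reads_incidence s \<longleftrightarrow> reg s n_reg = n \<and> reg s m_reg = length es \<and>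
     (\<forall>e<length es. \<forall>u<n. arr s inc_arr (e * n + u) = of_bool (u \<in> es ! e))"

definition marks :: "(nat \<times> nat \<times> nat) set \<Rightarrow> state \<Rightarrow> bool" where
  "marks D s \<longleftrightarrow> (\<forall>u<n. \<forall>v<n. arr s adj_arr (u * n + v) =
     of_bool (\<exists>e. (e, u, v) \<in> D \<and> u \<in> es ! e \<and> v \<in> es ! e))"

lemma reads_incidence_frame:
  assumes "reads_incidence s" "same_except R A s s'" "n_reg \<notin> R" "m_reg \<notin> R" "inc_arr \<notin> A"
  shows "reads_incidence s'"
  using assms by (simp add: reads_incidence_def same_except_def)

lemma marks_set_reg [simp]: "marks D (set_reg x v s) \<longleftrightarrow> marks D s"
  by (simp add: marks_def)

lemma wp_Mark_Adjacent:
  assumes s: "bounded_state B s" "reads_incidence s" and marks: "marks D s"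
    and e: "reg s idx_reg = e" "e < length es" and u: "reg s u_reg = u" "u < n"
    and v: "reg s v_reg = v" "v < n"
  shows "wp B Mark_Adjacent s (marks (insert (e, u, v) D))"
proof -
  have n: "reg s n_reg = n"
    and inc: "\<And>w. w < n \<Longrightarrow> arr s inc_arr (e * n + w) = of_bool (w \<in> es ! e)"
    using s(2) e(2) by (auto simp: reads_incidence_def)
  have fits: "e < B" "u < B" "v < B" "n < B"
    using bounded_reg[OF s(1)] e(1) fits_linear u(2) v(2) by auto
  have index: "e * n + u < B" "e * n + v < B" "e * n < B" "u * n + v < B" "u * n < B"
    using fits_index e(2) u(2) v(2) by auto
  have "marks (insert (e, u, v) D) (set_arr adj_arr (u * n + v) 1 s)" if "u \<in> es ! e" "v \<in> es ! e"
    using marks that row_major_eq_iff[OF _ v(2)] unfolding marks_def by auto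
  moreover have "marks (insert (e, u, v) D) s" if "\<not> (u \<in> es ! e \<and> v \<in> es ! e)"
    using marks that unfolding marks_def by auto
  ultimately show ?thesis
    using n inc[OF u(2)] inc[OF v(2)] e u v fits index by (auto simp: Mark_Adjacent_def)
qed

lemma runs_For_Mark_Adjacent:
  assumes s: "bounded_state B s" "reads_incidence s" and marks: "marks D s"
    and e: "reg s idx_reg = e" "e < length es" and u: "reg s u_reg = u" "u < n"
  obtains s' where "runs B (For v_reg n_reg Mark_Adjacent) s (n * 33 + 6) s'"
    "marks (D \<union> {e} \<times> {u} \<times> {..<n}) s'"
proof -
  have n: "reg s n_reg = n" using s(2) by (simp add: reads_incidence_def)
  show thesis
  proof (rule runs_For_straight[OF s(1), of v_reg Mark_Adjacent n_reg
        "\<lambda>v. marks (D \<union> {e} \<times> {u} \<times> {..<v})" 25])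
    fix v r assume r: "v < reg s n_reg" "reg r v_reg = v" "bounded_state B r"
        "marks (D \<union> {e} \<times> {u} \<times> {..<v}) r"
      and frame: "same_except (insert v_reg (written_regs Mark_Adjacent))
          (written_arrs Mark_Adjacent) s r"
    have "wp B Mark_Adjacent r (marks (insert (e, u, v) (D \<union> {e} \<times> {u} \<times> {..<v})))"
      using r n e u frame
      by (intro wp_Mark_Adjacent reads_incidence_frame[OF s(2) frame]) (auto simp: same_except_def)
    also have "insert (e, u, v) (D \<union> {e} \<times> {u} \<times> {..<v}) = D \<union> {e} \<times> {u} \<times> {..<Suc v}"
      by (auto simp: less_Suc_eq)
    finally show "wp B Mark_Adjacent r (marks (D \<union> {e} \<times> {u} \<times> {..<Suc v}))" .
  qed (use marks that n in \<open>auto simp: Mark_Adjacent_def\<close>)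
qed

lemma runs_Mark_Edge:
  assumes s: "bounded_state B s" "reads_incidence s" and marks: "marks D s"
    and e: "reg s idx_reg = e" "e < length es"
  obtains s' where "runs B Mark_Edge s (n * (n * 33 + 14) + 6) s'"
    "marks (D \<union> {e} \<times> {..<n} \<times> {..<n}) s'"
proof -
  let ?row = "For v_reg n_reg Mark_Adjacent"
  have n: "reg s n_reg = n" using s(2) by (simp add: reads_incidence_def)
  show thesis
  proof (rule runs_For[OF s(1), of u_reg ?row n_reg
        "\<lambda>u. marks (D \<union> {e} \<times> {..<u} \<times> {..<n})" "n * 33 + 6"])
    fix s' assume "runs B (For u_reg n_reg ?row) s (reg s n_reg * (n * 33 + 6 + 8) + 6) s'"
      and "marks (D \<union> {e} \<times> {..<reg s n_reg} \<times> {..<n}) s'"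
    then show thesis using that[of s'] n by (simp add: Mark_Edge_def add.commute)
  next
    fix u r assume r: "u < reg s n_reg" "reg r u_reg = u" "bounded_state B r"
        "marks (D \<union> {e} \<times> {..<u} \<times> {..<n}) r"
      and frame: "same_except (insert u_reg (written_regs ?row)) (written_arrs ?row) s r"
    have "reads_incidence r" by (rule reads_incidence_frame[OF s(2) frame]) auto
    moreover have "reg r idx_reg = e" using same_except_reg[OF frame, of idx_reg] e(1) by simp
    ultimately obtain r' where "runs B ?row r (n * 33 + 6) r'"
      "marks (D \<union> {e} \<times> {..<u} \<times> {..<n} \<union> {e} \<times> {u} \<times> {..<n}) r'"
      using runs_For_Mark_Adjacent[OF r(3) _ r(4)] e(2) r(1,2) n by metis
    moreover have "D \<union> {e} \<times> {..<u} \<times> {..<n} \<union> {e} \<times> {u} \<times> {..<n} = D \<union> {e} \<times> {..<Suc u} \<times> {..<n}"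
      by (auto simp: less_Suc_eq)
    ultimately show "\<exists>r'. runs B ?row r (n * 33 + 6) r' \<and> marks (D \<union> {e} \<times> {..<Suc u} \<times> {..<n}) r'"
      by auto
  qed (use marks in auto)
qed

lemma runs_Adjacency:
  assumes s: "bounded_state B s" "reads_incidence s" and zero: "arr s adj_arr = (\<lambda>_. 0)"
  obtains s' where "runs B Adjacency s (length es * (n * (n * 33 + 14) + 14) + 6) s'"
    "\<forall>u<n. \<forall>v<n. arr s' adj_arr (u * n + v) = of_bool (adj u v)"
proof -
  have m: "reg s m_reg = length es" using s(2) by (simp add: reads_incidence_def)
  obtain s' where s': "runs B Adjacency s (length es * (n * (n * 33 + 14) + 6 + 8) + 6) s'"
    "marks ({..<length es} \<times> {..<n} \<times> {..<n}) s'"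
    unfolding Adjacency_def
  proof (rule runs_For[OF s(1), of idx_reg Mark_Edge m_reg
        "\<lambda>e. marks ({..<e} \<times> {..<n} \<times> {..<n})" "n * (n * 33 + 14) + 6"])
    show "marks ({..<0} \<times> {..<n} \<times> {..<n}) s" using zero by (simp add: marks_def)
    fix e r assume r: "e < reg s m_reg" "reg r idx_reg = e" "bounded_state B r"
        "marks ({..<e} \<times> {..<n} \<times> {..<n}) r"
      and frame: "same_except (insert idx_reg (written_regs Mark_Edge))
          (written_arrs Mark_Edge) s r"
    have "reads_incidence r" by (rule reads_incidence_frame[OF s(2) frame]) auto
    then obtain r' where "runs B Mark_Edge r (n * (n * 33 + 14) + 6) r'"
      "marks ({..<e} \<times> {..<n} \<times> {..<n} \<union> {e} \<times> {..<n} \<times> {..<n}) r'"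
      using runs_Mark_Edge[OF r(3) _ r(4,2)] r(1) m by metis
    moreover have "{..<e} \<times> {..<n} \<times> {..<n} \<union> {e} \<times> {..<n} \<times> {..<n} = {..<Suc e} \<times> {..<n} \<times> {..<n}"
      by (auto simp: less_Suc_eq)
    ultimately show "\<exists>r'. runs B Mark_Edge r (n * (n * 33 + 14) + 6) r' \<and>
        marks ({..<Suc e} \<times> {..<n} \<times> {..<n}) r'"
      by auto
  qed (use m in auto)
  have "arr s' adj_arr (u * n + v) = of_bool (adj u v)" if "u < n" "v < n" for u v
  proof -
    have iff: "adj u v \<longleftrightarrow>
        (\<exists>e. (e, u, v) \<in> {..<length es} \<times> {..<n} \<times> {..<n} \<and> u \<in> es ! e \<and> v \<in> es ! e)"
      unfolding adj_def using that by (auto simp: set_conv_nth)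
    show ?thesis
      unfolding iff using s'(2) that unfolding marks_def by blast
  qed
  moreover have "runs B Adjacency s (length es * (n * (n * 33 + 14) + 14) + 6) s'"
    using s'(1) by (rule runs_mono) simp
  ultimately show thesis using that by blast
qed

subsection \<open>Configurations\<close>

definition encodes :: "state \<Rightarrow> nat set \<Rightarrow> bool" where
  "encodes s S \<longleftrightarrow> reg s n_reg = n \<and>
     (\<forall>v<n. arr s config_arr v = of_bool (v \<in> S)) \<and>
     (\<forall>v<n. arr s target_arr v = of_bool (v \<in> T)) \<and>
     (\<forall>u<n. \<forall>v<n. arr s adj_arr (u * n + v) = of_bool (adj u v))"

lemma encodesD:
  assumes "encodes s S"
  shows "reg s n_reg = n" "v < n \<Longrightarrow> arr s config_arr v = of_bool (v \<in> S)"
    "v < n \<Longrightarrow> arr s target_arr v = of_bool (v \<in> T)"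
    "u < n \<Longrightarrow> v < n \<Longrightarrow> arr s adj_arr (u * n + v) = of_bool (adj u v)"
  using assms by (simp_all add: encodes_def)

lemma encodes_frame:
  assumes "encodes s S" "same_except R A s s'"
    "n_reg \<notin> R" "{config_arr, target_arr, adj_arr} \<inter> A = {}"
  shows "encodes s' S"
  using assms by (simp add: encodes_def same_except_def)

lemma encodes_update:
  assumes "encodes s S" "same_except R A s s'" "n_reg \<notin> R" "{target_arr, adj_arr} \<inter> A = {}"
    and "\<And>v. v < n \<Longrightarrow> arr s' config_arr v = of_bool (v \<in> S')"
  shows "encodes s' S'"
  using assms by (simp add: encodes_def same_except_def)

definition tracks :: "state \<Rightarrow> nat set list \<Rightarrow> nat set \<Rightarrow> bool" where
  "tracks s Ds S \<longleftrightarrow> bounded_state B s \<and> encodes s S \<and> outputs [0..<n] Ds s \<and>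
     reconfigures {..<n} (set es) k S0 Ds S"

lemma tracksD:
  assumes "tracks s Ds S"
  shows "bounded_state B s" "encodes s S" "outputs [0..<n] Ds s"
    "reconfigures {..<n} (set es) k S0 Ds S" "cover S" "card S = k" "S \<subseteq> {..<n}"
  using assms reconfiguresD[of "{..<n}" "set es" k S0 Ds S]
    vertex_cover_subset[of "{..<n}" "set es" S]
  by (simp_all add: tracks_def)

lemma tracks_frame:
  assumes "tracks s Ds S" "runs B c s t s'" "{n_reg, moves_reg} \<inter> written_regs c = {}"
    "{config_arr, target_arr, out_arr, adj_arr} \<inter> written_arrs c = {}"
  shows "tracks s' Ds S"
  using assms encodes_frame[OF _ runs_same_except[OF assms(2)]] runs_bounded[OF assms(2)]
    runs_reg[OF assms(2), of moves_reg] runs_arr[OF assms(2), of out_arr]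
  by (simp add: tracks_def outputs_def)

lemma tracks_set_reg:
  assumes "tracks s Ds S" "x \<noteq> n_reg" "x \<noteq> moves_reg" "v < B"
  shows "tracks (set_reg x v s) Ds S"
  using assms by (simp add: tracks_def encodes_def outputs_def bounded_set_reg)

lemma runs_Write_Config:
  assumes s: "bounded_state B s" "encodes s S" and r: "reg s moves_reg = r" "r < (n + 2) ^ 2"
  obtains s' where "runs B Write_Config s (16 * n + 6) s'"
    "\<And>v. v < n \<Longrightarrow> arr s' out_arr (r * n + v) = of_bool (v \<in> S)"
    "\<And>p. p < r * n \<Longrightarrow> arr s' out_arr p = arr s out_arr p"
proof -
  let ?store = "Store out_arr (Add (Mul (Reg moves_reg) (Reg n_reg)) (Reg idx_reg))
    (Arr config_arr (Reg idx_reg))"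
  define I where "I i s' \<longleftrightarrow> (\<forall>v<i. arr s' out_arr (r * n + v) = of_bool (v \<in> S)) \<and>
     (\<forall>p<r * n. arr s' out_arr p = arr s out_arr p)" for i and s' :: state
  note n = encodesD(1)[OF s(2)]
  obtain s' where s': "runs B Write_Config s (n * (8 + 8) + 6) s'" "I n s'"
    unfolding Write_Config_def
  proof (rule runs_For_straight[OF s(1), of idx_reg ?store n_reg I 8])
    fix i q assume q: "i < reg s n_reg" "reg q idx_reg = i" "bounded_state B q" "I i q"
      and frame: "same_except (insert idx_reg (written_regs ?store)) (written_arrs ?store) s q"
    have eq: "reg q moves_reg = r" "reg q n_reg = n" "arr q config_arr i = of_bool (i \<in> S)"
      using frame r(1) n encodesD(2)[OF s(2)] q(1) by (auto simp: same_except_def)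
    have "i < n" using q(1) n by simp
    then show "wp B ?store q (I (Suc i))"
      using q(2-4) eq fits_row[OF r(2)] bounded_reg[OF q(3), of moves_reg]
        fits_linear[of n] fits_linear[of i]
      by (auto simp: I_def less_Suc_eq)
  qed (use n in \<open>auto simp: I_def\<close>)
  then show thesis using that[of s'] by (auto simp: I_def algebra_simps)
qed

lemma runs_Emit:
  assumes s: "bounded_state B s" "encodes s S'" and out: "outputs [0..<n] Ds s"
    and Ds: "reconfigures {..<n} (set es) k S0 Ds S"
    and step: "tj_move {..<n} (set es) S S'" "cover S'"
    and len: "length Ds < (n + 2) ^ 2"
  obtains s' where "runs B Emit s (26 * n) s'" "tracks s' (Ds @ [S']) S'"
proof -
  let ?s1 = "set_reg moves_reg (length Ds) s"
  have moves: "Suc (reg s moves_reg) = length Ds"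
    using out reconfiguresD(1)[OF Ds] by (simp add: outputs_def)
  have "length Ds * 1 \<le> length Ds * n" using n_pos by (intro mult_left_mono) auto
  then have "length Ds < B" using fits_row(2)[OF len n_pos] by linarith
  then have incr: "runs B (Assign moves_reg (Add (Reg moves_reg) (Const 1))) s 4 ?s1"
    using s(1) moves by (intro runs_straight_eq) auto
  have s1: "bounded_state B ?s1" "encodes ?s1 S'"
    using runs_bounded[OF incr s(1)] s(2) by (auto simp: encodes_def)
  obtain s' where s': "runs B Write_Config ?s1 (16 * n + 6) s'"
    "\<And>v. v < n \<Longrightarrow> arr s' out_arr (length Ds * n + v) = of_bool (v \<in> S')"
    "\<And>p. p < length Ds * n \<Longrightarrow> arr s' out_arr p = arr s out_arr p"
    using runs_Write_Config[OF s1 _ len] by (metis arr_set_reg reg_set_reg)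
  have "outputs [0..<n] (Ds @ [S']) s'"
    by (rule outputs_snoc[OF out]) (use s'(2,3) runs_reg[OF s'(1), of moves_reg] in auto)
  moreover have "bounded_state B s'" "encodes s' S'"
    using runs_bounded[OF s'(1) s1(1)] encodes_frame[OF s1(2) runs_same_except[OF s'(1)]] by auto
  ultimately have "tracks s' (Ds @ [S']) S'"
    using reconfigures_snoc[OF Ds step] by (simp add: tracks_def)
  moreover have "runs B Emit s (26 * n) s'"
    unfolding Emit_def using runs_Seq[OF incr s'(1)] by (rule runs_mono) (use n_pos in simp)
  ultimately show thesis using that by blast
qed

lemma tests_is_source:
  assumes "bounded_state B s" "encodes s S" "reg s y = v" "v < n"
  shows "tests B (is_source y) s (v \<in> S - T)"
  using assms encodesD(2,3)[OF assms(2,4)] by (auto simp: tests_def is_source_def)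

lemma tests_is_target:
  assumes "bounded_state B s" "encodes s S" "reg s y = v" "v < n"
  shows "tests B (is_target y) s (v \<in> T - S)"
  using assms encodesD(2,3)[OF assms(2,4)] by (auto simp: tests_def is_target_def)

lemma tests_is_unmatched:
  assumes "bounded_state B s" "reg s y = v"
  shows "tests B (is_unmatched y) s (mate_of s v = None)"
  using assms by (auto simp: tests_def is_unmatched_def mate_of_def split: nat.split)

lemma tests_is_reached:
  assumes "bounded_state B s" "reg s y = v"
  shows "tests B (is_reached y) s (arr s level_arr v \<noteq> 0)"
  using assms by (auto simp: tests_def is_reached_def)

lemma tests_is_adjacent:
  assumes "bounded_state B s" "encodes s S" "reg s x = u" "u < n" "reg s y = v" "v < n"
  shows "tests B (is_adjacent x y) s (adj u v)"
  using assms encodesD(1,4)[OF assms(2)] fits_index[of u v] fits_linear[of n] fits_linear[of u]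
    fits_linear[of v] by (auto simp: tests_def is_adjacent_def)

lemma tests_precedes:
  assumes "bounded_state B s" "reg s x = u" "reg s y = v" "arr s level_arr v \<le> n"
  shows "tests B (precedes y x) s (Suc (arr s level_arr v) = arr s level_arr u)"
  using assms fits_linear[of "Suc (arr s level_arr v)"] by (auto simp: tests_def precedes_def)

lemma tests_is_alternating:
  assumes s: "bounded_state B s" "encodes s S" and u: "reg s u_reg = u" "u < n"
    and v: "reg s v_reg = v" "v < n"
  shows "tests B is_alternating s (alternating (mate_of s) S T u v)"
proof -
  have "tests B (Equal (Arr config_arr (Reg u_reg)) (Const 0)) s (u \<notin> S)"
    using s encodesD(2)[OF s(2) u(2)] u by (auto simp: tests_def)
  moreover have "tests B (Equal (Arr mate_arr (Reg u_reg)) (Add (Reg v_reg) (Const 1))) s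
      (mate_of s u = Some v)"
    using s(1) u v fits_linear[of "Suc v"] by (auto simp: tests_def mate_of_def split: nat.split)
  ultimately show ?thesis
    using tests_is_source[OF s u] tests_is_target[OF s v] tests_is_adjacent[OF s u v]
    by (auto simp: is_alternating_def alternating_def tests_def)
qed

lemma tests_is_source_pred:
  assumes "bounded_state B s" "encodes s S" "reg s cand_reg = y" "y < n" "reg s cur_reg = x" "x < n"
    and "arr s level_arr y \<le> n"
  shows "tests B is_source_pred s
    (y \<in> S - T \<and> adj y x \<and> Suc (arr s level_arr y) = arr s level_arr x)"
  unfolding is_source_pred_def using assms
  by (intro tests_Conj tests_is_source tests_is_adjacent tests_precedes)

lemma tests_is_walk_succ:
  assumes "bounded_state B s" "encodes s S" "reg s cand_reg = y" "y < n" "reg s cur_reg = x" "x < n"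
    and "arr s level_arr y \<le> n"
  shows "tests B is_walk_succ s (adj x y \<and> Suc (arr s level_arr y) = arr s level_arr x)"
  unfolding is_walk_succ_def using assms by (intro tests_Conj tests_is_adjacent tests_precedes)

lemma tests_is_free_target:
  assumes "bounded_state B s" "encodes s S" "reg s cand_reg = b" "b < n"
  shows "tests B is_free_target s (b \<in> unmatched (mate_of s) T S)"
  unfolding is_free_target_def unmatched_mem using assms
  by (intro tests_Conj tests_is_target tests_is_unmatched)

subsection \<open>Augmenting the matching\<close>

lemma runs_Rematch:
  assumes s: "bounded_state B s" "reg s n_reg = n" and x: "reg s cur_reg = x" "x < n"
    and y: "reg s found_reg = y" "y < n"
  obtains s' where "runs B Rematch s 25 s'" "mate_of s' = rematch x y (mate_of s)"
    "reg s' cur_reg = (case mate_of s y of None \<Rightarrow> n | Some z \<Rightarrow> z)"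
proof -
  define post where "post s' \<longleftrightarrow> mate_of s' = rematch x y (mate_of s) \<and>
    reg s' cur_reg = (case mate_of s y of None \<Rightarrow> n | Some z \<Rightarrow> z)" for s'
  have fits: "Suc x < B" "Suc y < B" "x < B" "y < B" "n < B" using x(2) y(2) fits_linear by auto
  have "wp B Rematch s post"
  proof (cases "arr s mate_arr y")
    case 0
    then show ?thesis
      using s x y fits
      by (auto simp: Rematch_def is_unmatched_def post_def rematch_def mate_of_def fun_eq_iff)
  next
    case (Suc z)
    then have "Suc z < B" using bounded_arr[OF s(1), of mate_arr y] by simp
    then show ?thesis
      using s x y fits Suc
      by (auto simp: Rematch_def is_unmatched_def post_def rematch_def mate_of_def fun_eq_iff)
  qed
  then obtain s' where "runs B Rematch s 25 s'" "post s'"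
    by (rule runs_straight[rotated]) (auto simp: Rematch_def)
  then show thesis using that by (simp add: post_def)
qed

definition augment_inv :: "nat set \<Rightarrow> (nat \<Rightarrow> nat) \<Rightarrow> (nat \<rightharpoonup> nat) \<Rightarrow> nat \<Rightarrow> state \<Rightarrow> bool" where
  "augment_inv S f M a s \<longleftrightarrow>
     (if reg s cur_reg < n then augmenting S T f M (mate_of s) (reg s cur_reg)
      else matching (mate_of s) S T \<and> unmatched (mate_of s) S T \<subseteq> unmatched M S T - {a})"

lemma runs_Find_source_pred:
  assumes s: "bounded_state B s" "encodes s S" and M: "matching M S T" "a \<in> unmatched M S T"
    and f: "bfs_levels {..<n} (alternating M S T) a (arr s level_arr)"
    and aug: "augmenting S T (arr s level_arr) M (mate_of s) x" and x: "reg s cur_reg = x" "x < n"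
  obtains s' y where "runs B (Find is_source_pred) s (33 * n + 8) s'" "reg s' found_reg = y"
    "y < n" "y \<in> S - T" "adj y x" "Suc (arr s level_arr y) = arr s level_arr x"
proof -
  let ?f = "arr s level_arr"
  define P where "P y \<longleftrightarrow> y \<in> S - T \<and> adj y x \<and> Suc (?f y) = ?f x" for y
  obtain s' where s': "runs B (Find is_source_pred) s (n * (bcost is_source_pred + 11) + 8) s'"
    "reg s' found_reg < n \<longleftrightarrow> (\<exists>y<n. P y)" "reg s' found_reg < n \<longrightarrow> P (reg s' found_reg)"
  proof (rule runs_Find[OF s(1) encodesD(1)[OF s(2)], of is_source_pred P])
    fix r y assume y: "y < n" "reg r cand_reg = y" "bounded_state B r"
      and frame: "same_except {cand_reg, found_reg} {} s r"
    have "encodes r S" "reg r cur_reg = x" "arr r level_arr = ?f"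
      using encodes_frame[OF s(2) frame] frame x(1) by (auto simp: same_except_def)
    then show "tests B is_source_pred r (P y)"
      using tests_is_source_pred[of r S y x] y x(2) bfs_levels_le_card[OF f, of y]
      by (simp add: P_def)
  qed auto
  obtain w where "P w"
    using augmenting_pred[OF M f aug vertex_cover_subset[OF T(1)]] by (auto simp: P_def)
  moreover from this have "w < n" using adjD(1)[of w x] by (simp add: P_def)
  ultimately have "reg s' found_reg < n" "P (reg s' found_reg)" using s'(2,3) by auto
  then show thesis using that[OF _ refl] s'(1) by (simp add: P_def mult.commute)
qed

lemma runs_Augment_Step:
  assumes s: "bounded_state B s" "encodes s S" and M: "matching M S T" "a \<in> unmatched M S T"
    and f: "bfs_levels {..<n} (alternating M S T) a (arr s level_arr)"
    and inv: "augment_inv S (arr s level_arr) M a s" and x: "reg s cur_reg = x" "x < n"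
  obtains s' where "runs B Augment_Step s (33 * n + 33) s'" "augment_inv S (arr s level_arr) M a s'"
    "reg s' cur_reg < n \<Longrightarrow> arr s level_arr (reg s' cur_reg) < arr s level_arr x"
proof -
  let ?f = "arr s level_arr"
  have aug: "augmenting S T ?f M (mate_of s) x" using inv x by (simp add: augment_inv_def)
  obtain s1 y where s1: "runs B (Find is_source_pred) s (33 * n + 8) s1" "reg s1 found_reg = y"
    and y: "y < n" "y \<in> S - T" "adj y x" "Suc (?f y) = ?f x"
    using runs_Find_source_pred[OF s M f aug x] .
  have kept: "mate_of s1 = mate_of s" "reg s1 cur_reg = x" "reg s1 n_reg = n"
    using mate_of_cong[OF runs_arr[OF s1(1)]] runs_reg[OF s1(1)] x(1) encodesD(1)[OF s(2)]
    by simp_all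
  obtain s2 where s2: "runs B Rematch s1 25 s2" "mate_of s2 = rematch x y (mate_of s)"
    "reg s2 cur_reg = (case mate_of s y of None \<Rightarrow> n | Some z \<Rightarrow> z)"
    using runs_Rematch[OF runs_bounded[OF s1(1) s(1)] kept(3,2) x(2) s1(2) y(1)]
    unfolding kept(1) .
  have "runs B Augment_Step s (33 * n + 33) s2"
    unfolding Augment_Step_def using runs_Seq[OF s1(1) s2(1)] by (rule runs_mono) simp
  moreover have "augment_inv S ?f M a s2 \<and> (reg s2 cur_reg < n \<longrightarrow> ?f (reg s2 cur_reg) < ?f x)"
  proof (cases "mate_of s y")
    case None
    then show ?thesis
      using augmenting_step[OF M f aug y(2-4)] s2(2,3) by (simp add: augment_inv_def)
  next
    case (Some z)
    then have "augmenting S T ?f M (rematch x y (mate_of s)) z \<and> ?f z < ?f x"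
      using augmenting_step[OF M f aug y(2-4)] by simp
    moreover from this have "z < n"
      using vertex_cover_subset[OF T(1)] by (auto simp: augmenting_def unmatched_mem)
    ultimately show ?thesis using s2(2,3) Some by (simp add: augment_inv_def)
  qed
  ultimately show thesis using that by blast
qed

lemma runs_Augment:
  assumes s: "bounded_state B s" "encodes s S"
    and M: "matching (mate_of s) S T" "a \<in> unmatched (mate_of s) S T"
    and f: "bfs_levels {..<n} (alternating (mate_of s) S T) a (arr s level_arr)"
    and x: "reg s found_reg < n" "reg s found_reg \<in> unmatched (mate_of s) T S"
      "arr s level_arr (reg s found_reg) \<noteq> 0"
  obtains s' where "runs B Augment s (80 * (n * n)) s'" "matching (mate_of s') S T"
    "unmatched (mate_of s') S T \<subseteq> unmatched (mate_of s) S T - {a}"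
proof -
  let ?M = "mate_of s" and ?f = "arr s level_arr" and ?s1 = "set_reg cur_reg (reg s found_reg) s"
  let ?test = "Less (Reg cur_reg) (Reg n_reg)"
  define rank where "rank r = (if reg r cur_reg < n then ?f (reg r cur_reg) else 0)" for r :: state
  have assign: "runs B (Assign cur_reg (Reg found_reg)) s 2 ?s1"
    using s(1) by (intro runs_straight_eq) auto
  have "augment_inv S ?f ?M a ?s1"
    using M x by (auto simp: augment_inv_def augmenting_def)
  then obtain s' where s': "augment_inv S ?f ?M a s'" "\<not> reg s' cur_reg < n"
    "runs B (While ?test Augment_Step) ?s1
      (rank ?s1 * (33 * n + 33 + bcost ?test + 1) + bcost ?test + 1) s'"
  proof (rule runs_While[OF runs_bounded[OF assign s(1)], of "augment_inv S ?f ?M a"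
        Augment_Step ?test "\<lambda>r. reg r cur_reg < n" "33 * n + 33" rank])
    fix r assume r: "bounded_state B r" "augment_inv S ?f ?M a r"
      and frame1: "same_except (written_regs Augment_Step) (written_arrs Augment_Step) ?s1 r"
    have frame: "same_except {cand_reg, found_reg, cur_reg, next_reg} {mate_arr} s r"
      using frame1 by (simp add: same_except_def)
    have encoded: "encodes r S" by (rule encodes_frame[OF s(2) frame]) auto
    show "tests B ?test r (reg r cur_reg < n)"
      using r(1) encodesD(1)[OF encoded] by (auto simp: tests_def)
    assume less: "reg r cur_reg < n"
    have level: "arr r level_arr = ?f" using same_except_arr[OF frame, of level_arr] by simp
    obtain r' where "runs B Augment_Step r (33 * n + 33) r'" "augment_inv S ?f ?M a r'"
      "reg r' cur_reg < n \<Longrightarrow> ?f (reg r' cur_reg) < ?f (reg r cur_reg)"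
      using runs_Augment_Step[OF r(1) encoded M _ _ refl less] f r(2) unfolding level by blast
    moreover have "?f (reg r cur_reg) \<noteq> 0"
      using r(2) less by (simp add: augment_inv_def augmenting_def)
    ultimately show "\<exists>r'. runs B Augment_Step r (33 * n + 33) r' \<and> augment_inv S ?f ?M a r' \<and>
        rank r' < rank r"
      using less by (intro exI[of _ r']) (auto simp: rank_def)
  qed
  have "rank ?s1 \<le> n"
    using bfs_levels_le_card[OF f, of "reg s found_reg"] x(1) by (simp add: rank_def)
  then have "runs B Augment s (80 * (n * n)) s'"
    unfolding Augment_def using runs_Seq[OF assign s'(3)] iterations_le[of "rank ?s1" 37 33 6]
    by (elim runs_mono) simp
  then show thesis using that s'(1,2) by (simp add: augment_inv_def)
qed

subsection \<open>Redirecting a token\<close>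

lemma runs_Release:
  assumes s: "bounded_state B s" "encodes s S" and a: "reg s token_reg = a"
  defines "X \<equiv> reached (arr s level_arr) a"
  obtains s' where "runs B Release s (33 * n) s'" "encodes s' (sym_diff S X)"
    "mate_of s' = mate_of s |` (- X)"
proof -
  let ?body = "Cond (Conj (is_reached idx_reg) (Neg (Equal (Reg idx_reg) (Reg token_reg))))
     (Store config_arr (Reg idx_reg) (Sub (Const 1) (Arr config_arr (Reg idx_reg))) ;;
      Store mate_arr (Reg idx_reg) (Const 0)) Skip"
  define I where "I i r \<longleftrightarrow>
     (\<forall>v<n. arr r config_arr v = of_bool (v \<in> sym_diff S (X \<inter> {..<i}))) \<and>
     mate_of r = mate_of s |` (- (X \<inter> {..<i}))" for i r
  note n = encodesD(1)[OF s(2)]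
  have X: "X \<subseteq> {..<n}" by (auto simp: X_def reached_def)
  obtain s' where s': "runs B Release s (n * (19 + 8) + 6) s'" "I n s'"
    unfolding Release_def
  proof (rule runs_For_straight[OF s(1), of idx_reg ?body n_reg I 19])
    show "I 0 s" using encodesD(2)[OF s(2)] by (auto simp: I_def restrict_map_def)
    fix i r assume r: "i < reg s n_reg" "reg r idx_reg = i" "bounded_state B r" "I i r"
      and frame: "same_except (insert idx_reg (written_regs ?body)) (written_arrs ?body) s r"
    have i: "i < n" "i < B" using r(1) n fits_linear[of i] by auto
    have "tests B (is_reached idx_reg) r (arr s level_arr i \<noteq> 0)"
      using tests_is_reached[OF r(3,2)] same_except_arr[OF frame, of level_arr] by simp
    moreover have "tests B (Equal (Reg idx_reg) (Reg token_reg)) r (i = a)"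
      using r(2,3) same_except_reg[OF frame, of token_reg] a i(2) by (auto simp: tests_def)
    ultimately have test: "tests B (Conj (is_reached idx_reg)
        (Neg (Equal (Reg idx_reg) (Reg token_reg)))) r (i \<in> X)"
      using tests_Conj[OF _ tests_Neg] i(1) by (simp add: X_def reached_def)
    have config: "arr r config_arr i = of_bool (i \<in> S)" using r(4) i(1) by (auto simp: I_def)
    have "I (Suc i) (set_arr mate_arr i 0 (set_arr config_arr i (1 - of_bool (i \<in> S)) r))"
      if "i \<in> X"
      using r(4) that unfolding I_def lessThan_Suc
      by (auto simp: mate_of_def fun_eq_iff restrict_map_def)
    moreover have "I (Suc i) r" if "i \<notin> X"
      using r(4) that unfolding I_def lessThan_Suc by simp
    ultimately show "wp B ?body r (I (Suc i))"
      using test r(2) i(2) config by (auto simp: tests_def)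
  qed (use n in \<open>auto simp: I_def mate_of_def is_reached_def\<close>)
  have "runs B Release s (33 * n) s'" using s'(1) by (rule runs_mono) (use n_pos in simp)
  moreover have "X \<inter> {..<n} = X" using X by blast
  then have "encodes s' (sym_diff S X)" "mate_of s' = mate_of s |` (- X)"
    using s'(2) encodes_update[OF s(2) runs_same_except[OF s'(1)]] by (auto simp: I_def)
  ultimately show thesis by (rule that)
qed

lemma runs_Place_Emit:
  assumes tracks: "tracks s Ds S" and y: "reg s cur_reg = y" "y < n" "y \<notin> S"
    and free: "reg s free_reg = fr" "fr \<in> S"
    and move: "tj_move {..<n} (set es) S (insert y (S - {fr}))" and covers: "cover (S - {fr})"
    and len: "length Ds < (n + 2) ^ 2"
  obtains s' where "runs B (Place ;; Emit) s (26 * n + 8) s'"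
    "tracks s' (Ds @ [insert y (S - {fr})]) (insert y (S - {fr}))"
    "reg s' cur_reg = y" "reg s' free_reg = y"
proof -
  let ?s1 = "set_reg free_reg y (set_arr config_arr y 1 (set_arr config_arr fr 0 s))"
  let ?S' = "insert y (S - {fr})"
  have fits: "y < B" "fr < B" using y(2) free(2) tracksD(7)[OF tracks] fits_linear by auto
  have place: "runs B Place s 8 ?s1"
    using tracksD(1)[OF tracks] y(1) free(1) fits by (intro runs_straight_eq) (auto simp: Place_def)
  have encoded: "encodes ?s1 ?S'" and out: "outputs [0..<n] Ds ?s1"
    using tracksD(2,3)[OF tracks] y(3) free(2) by (auto simp: encodes_def outputs_def)
  have "cover ?S'"
    using covers tracksD(7)[OF tracks] y(2) by (auto intro: vertex_cover_mono)
  then obtain s' where s': "runs B Emit ?s1 (26 * n) s'" "tracks s' (Ds @ [?S']) ?S'"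
    using runs_Emit[OF runs_bounded[OF place tracksD(1)[OF tracks]]
      encoded out tracksD(4)[OF tracks] move _ len]
    by blast
  have "runs B (Place ;; Emit) s (26 * n + 8) s'"
    using runs_Seq[OF place s'(1)] by (rule runs_mono) simp
  moreover have "reg s' cur_reg = y" "reg s' free_reg = y"
    using runs_reg[OF s'(1)] y(1) by simp_all
  ultimately show thesis using that s'(2) by blast
qed

lemma runs_Step:
  assumes tracks: "tracks s Ds S" and y: "reg s found_reg = y" "y < n" "adj x y" "f y < f x"
    and free: "reg s free_reg = fr" and push: "pushable S f fr x" and covers: "cover (S - {fr})"
    and len: "length Ds < (n + 2) ^ 2"
  obtains s' S' Ds' where "runs B Step s (26 * n + 15) s'" "reg s' cur_reg = y"
    "S' - {reg s' free_reg} = S - {fr}" "tracks s' Ds' S'" "length Ds' \<le> Suc (length Ds)"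
    "pushable S' f (reg s' free_reg) y"
proof -
  let ?s1 = "set_reg cur_reg y s" and ?test = "Equal (Arr config_arr (Reg cur_reg)) (Const 0)"
  have assign: "runs B (Assign cur_reg (Reg found_reg)) s 2 ?s1"
    using tracksD(1)[OF tracks] y(1) by (intro runs_straight_eq) auto
  have tracks1: "tracks ?s1 Ds S" using tracks y(2) fits_linear by (simp add: tracks_set_reg)
  have test: "tests B ?test ?s1 (y \<notin> S)"
    using tracksD(1)[OF tracks1] encodesD(2)[OF tracksD(2)[OF tracks] y(2)] y(2) fits_linear[of y]
    by (auto simp: tests_def)
  show thesis
  proof (cases "y \<in> S")
    case True
    have "runs B (Cond ?test (Place ;; Emit) Skip) ?s1 (1 + bcost ?test + 1) ?s1"
      using test True by (intro runs_Cond_False runs_Skip) simp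
    from runs_Seq[OF assign this] have "runs B Step s (26 * n + 15) ?s1"
      unfolding Step_def by (rule runs_mono) simp
    moreover have "pushable S f fr y" using pushable_step[OF push y(3) True y(4)] .
    ultimately show thesis using that[of ?s1 S Ds] tracks1 free by simp
  next
    case False
    let ?S' = "insert y (S - {fr})"
    have "fr \<in> S" using push by (simp add: pushable_def)
    then obtain s' where s': "runs B (Place ;; Emit) ?s1 (26 * n + 8) s'"
      "tracks s' (Ds @ [?S']) ?S'"
      "reg s' cur_reg = y" "reg s' free_reg = y"
      using runs_Place_Emit[OF tracks1 _ y(2) False _ _
        tj_move_pushable[OF push y(3) False] covers len] free
      by auto
    have "runs B (Cond ?test (Place ;; Emit) Skip) ?s1 (1 + bcost ?test + (26 * n + 8)) s'"
      using test False by (intro runs_Cond_True s'(1)) simp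
    from runs_Seq[OF assign this] have "runs B Step s (26 * n + 15) s'"
      unfolding Step_def by (rule runs_mono) simp
    moreover have "pushable ?S' f y y" using tracksD(7)[OF s'(2)] by (intro pushable_refl) auto
    ultimately show thesis using that[of s' ?S' "Ds @ [?S']"] s' False by auto
  qed
qed

definition walk_inv :: "nat set \<Rightarrow> nat \<Rightarrow> (nat \<Rightarrow> nat) \<Rightarrow> state \<Rightarrow> bool" where
  "walk_inv R l f s \<longleftrightarrow> reg s cur_reg < n \<and> f (reg s cur_reg) \<noteq> 0 \<and>
     (\<exists>S Ds. S - {reg s free_reg} = R \<and> tracks s Ds S \<and> length Ds + f (reg s cur_reg) \<le> l \<and>
       pushable S f (reg s free_reg) (reg s cur_reg))"

lemma runs_Walk_Step:
  assumes s: "bounded_state B s" and inv: "walk_inv R l (arr s level_arr) s"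
    and f: "bfs_levels {..<n} adj b (arr s level_arr)" and b: "b < n"
    and far: "1 < arr s level_arr (reg s cur_reg)" and covers: "cover R" and l: "l \<le> (n + 2) ^ 2"
  obtains s' where "runs B Walk_Step s (53 * n + 23) s'" "walk_inv R l (arr s level_arr) s'"
    "arr s level_arr (reg s' cur_reg) < arr s level_arr (reg s cur_reg)"
proof -
  let ?f = "arr s level_arr"
  define x where "x = reg s cur_reg"
  define P where "P y \<longleftrightarrow> adj x y \<and> Suc (?f y) = ?f x" for y
  obtain S Ds where inv': "S - {reg s free_reg} = R" "tracks s Ds S" "length Ds + ?f x \<le> l"
    "pushable S ?f (reg s free_reg) x" and x: "x < n" "?f x \<noteq> 0"
    using inv by (auto simp: walk_inv_def x_def)
  note encoded = tracksD(2)[OF inv'(2)]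
  obtain s1 where s1: "runs B (Find is_walk_succ) s (n * (bcost is_walk_succ + 11) + 8) s1"
    "reg s1 found_reg < n \<longleftrightarrow> (\<exists>y<n. P y)" "reg s1 found_reg < n \<longrightarrow> P (reg s1 found_reg)"
  proof (rule runs_Find[OF s encodesD(1)[OF encoded], of is_walk_succ P])
    fix r y assume y: "y < n" "reg r cand_reg = y" "bounded_state B r"
      and frame: "same_except {cand_reg, found_reg} {} s r"
    have "encodes r S" "reg r cur_reg = x" "arr r level_arr = ?f"
      using encodes_frame[OF encoded frame] frame by (auto simp: same_except_def x_def)
    then show "tests B is_walk_succ r (P y)"
      using tests_is_walk_succ[of r S y x] y x(1) bfs_levels_le_card[OF f, of y]
      by (simp add: P_def)
  qed auto
  have "x \<noteq> b" using far bfs_levels_root[OF f, of x] x(1) by (auto simp: x_def)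
  then obtain w where "w < n" "adj w x" "Suc (?f w) = ?f x"
    using bfs_levels_pred[OF f, of x] x by auto
  then have y: "reg s1 found_reg < n" "P (reg s1 found_reg)"
    using s1(2,3) adj_sym by (auto simp: P_def)
  have "tracks s1 Ds S" by (rule tracks_frame[OF inv'(2) s1(1)]) auto
  moreover have "reg s1 free_reg = reg s free_reg" using runs_reg[OF s1(1), of free_reg] by simp
  ultimately obtain s2 S' Ds' where s2: "runs B Step s1 (26 * n + 15) s2"
    "reg s2 cur_reg = reg s1 found_reg" "S' - {reg s2 free_reg} = R" "tracks s2 Ds' S'"
    "length Ds' \<le> Suc (length Ds)" "pushable S' ?f (reg s2 free_reg) (reg s1 found_reg)"
    using runs_Step[of s1 Ds S "reg s1 found_reg" x ?f "reg s free_reg"] y inv' covers l far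
    by (auto simp: P_def x_def)
  have "runs B Walk_Step s (53 * n + 23) s2"
    unfolding Walk_Step_def using runs_Seq[OF s1(1) s2(1)] by (rule runs_mono) simp
  moreover have "walk_inv R l ?f s2"
    unfolding walk_inv_def using s2(2-6) y far inv'(3) by (force simp: P_def x_def)
  ultimately show thesis using that s2(2) y(2) by (simp add: P_def x_def)
qed

lemma runs_Walk:
  assumes tracks: "tracks s Ds S" and a: "reg s token_reg = a" "a \<in> S"
    and f: "bfs_levels {..<n} adj b (arr s level_arr)" and b: "b < n" "b \<notin> S"
    and covers: "cover (S - {a})" and level: "arr s level_arr a \<noteq> 0"
    and len: "length Ds + arr s level_arr a \<le> (n + 2) ^ 2"
  obtains s' Ds' where "runs B Walk s (100 * (n * n)) s'" "tracks s' Ds' (insert b (S - {a}))"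
    "length Ds' < length Ds + arr s level_arr a"
proof -
  let ?f = "arr s level_arr" and ?test = "Less (Const 1) (Arr level_arr (Reg cur_reg))"
  let ?s1 = "set_reg free_reg a (set_reg cur_reg a s)"
  let ?inv = "walk_inv (S - {a}) (length Ds + ?f a) ?f"
  define rank where "rank r = ?f (reg r cur_reg)" for r :: state
  have a_less: "a < n" using a(2) tracksD(7)[OF tracks] by auto
  have assign: "runs B (Assign cur_reg (Reg token_reg) ;; Assign free_reg (Reg token_reg)) s 4 ?s1"
    using tracksD(1)[OF tracks] a(1) by (intro runs_straight_eq) auto
  have "tracks ?s1 Ds S" using tracks a_less fits_linear by (simp add: tracks_set_reg)
  moreover have "pushable S ?f a a" using tracksD(7)[OF tracks] a(2) by (rule pushable_refl)
  ultimately have "?inv ?s1" using a_less level by (auto simp: walk_inv_def)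
  then obtain s' where s': "?inv s'" "\<not> 1 < ?f (reg s' cur_reg)"
    "runs B (While ?test Walk_Step) ?s1
      (rank ?s1 * (53 * n + 23 + bcost ?test + 1) + bcost ?test + 1) s'"
  proof (rule runs_While[OF runs_bounded[OF assign tracksD(1)[OF tracks]], of ?inv Walk_Step ?test
        "\<lambda>r. 1 < ?f (reg r cur_reg)" "53 * n + 23" rank])
    fix r assume r: "bounded_state B r" "?inv r"
      and frame: "same_except (written_regs Walk_Step) (written_arrs Walk_Step) ?s1 r"
    have lv: "arr r level_arr = ?f" using same_except_arr[OF frame, of level_arr] by simp
    show "tests B ?test r (1 < ?f (reg r cur_reg))" 
      using r(1) bounded_arr[OF r(1), of level_arr] lv by (simp add: tests_def)
    assume "1 < ?f (reg r cur_reg)"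
    then show "\<exists>r'. runs B Walk_Step r (53 * n + 23) r' \<and> ?inv r' \<and> rank r' < rank r"
      using runs_Walk_Step[OF r(1) _ _ b(1) _ covers len] r(2) f unfolding lv rank_def by blast
  qed
  obtain S' Ds' where inv: "S' - {reg s' free_reg} = S - {a}" "tracks s' Ds' S'"
    "length Ds' + ?f (reg s' cur_reg) \<le> length Ds + ?f a"
    "pushable S' ?f (reg s' free_reg) (reg s' cur_reg)"
    and cur: "reg s' cur_reg < n" "?f (reg s' cur_reg) = 1"
    using s'(1,2) unfolding walk_inv_def by (metis One_nat_def less_one linorder_neqE_nat)
  then have "reg s' cur_reg = b" using bfs_levels_root[OF f] by auto
  then have "b \<in> S'" "reg s' free_reg \<in> S'" using inv(4) by (auto simp: pushable_def)
  then have "reg s' free_reg = b" "S' = insert b (S - {a})" using inv(1) b(2) by blast+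
  have "rank ?s1 \<le> n" using bfs_levels_le_card[OF f, of a] a_less by (simp add: rank_def)
  then have "runs B Walk s (100 * (n * n)) s'"
    unfolding Walk_def using runs_Seq[OF assign s'(3)] iterations_le[of "rank ?s1" 28 53 9]
    by (elim runs_mono) simp
  then show thesis
    using that inv(2,3) cur(2) \<open>S' = insert b (S - {a})\<close> by simp
qed

definition progress :: "nat set \<Rightarrow> nat \<Rightarrow> state \<Rightarrow> bool" where
  "progress U l s \<longleftrightarrow> (\<exists>S Ds. tracks s Ds S \<and> matching (mate_of s) S T \<and>
     unmatched (mate_of s) S T \<subseteq> U \<and> length Ds \<le> l)"

lemma progressI:
  "tracks s Ds S \<Longrightarrow> matching (mate_of s) S T \<Longrightarrow> unmatched (mate_of s) S T \<subseteq> U \<Longrightarrow>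
    length Ds \<le> l \<Longrightarrow> progress U l s"
  unfolding progress_def by blast

lemma progress_mono: "progress U l s \<Longrightarrow> U \<subseteq> U' \<Longrightarrow> l \<le> l' \<Longrightarrow> progress U' l' s"
  unfolding progress_def by (meson order_trans)

lemma runs_Find_free_target:
  assumes tracks: "tracks s Ds S" and M: "matching (mate_of s) S T" "a \<in> unmatched (mate_of s) S T"
  obtains s' b where "runs B (Find is_free_target) s (21 * n + 8) s'" "reg s' found_reg = b"
    "b < n" "b \<in> unmatched (mate_of s) T S"
proof -
  let ?P = "\<lambda>b. b \<in> unmatched (mate_of s) T S"
  note s = tracksD(1,2)[OF tracks]
  obtain s' where s': "runs B (Find is_free_target) s (n * (bcost is_free_target + 11) + 8) s'"
    "reg s' found_reg < n \<longleftrightarrow> (\<exists>b<n. ?P b)" "reg s' found_reg < n \<longrightarrow> ?P (reg s' found_reg)"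
  proof (rule runs_Find[OF s(1) encodesD(1)[OF s(2)], of is_free_target ?P])
    fix r b assume b: "b < n" "reg r cand_reg = b" "bounded_state B r"
      and frame: "same_except {cand_reg, found_reg} {} s r"
    have "encodes r S" "mate_of r = mate_of s"
      using encodes_frame[OF s(2) frame] mate_of_cong[OF same_except_arr[OF frame]] by auto
    then show "tests B is_free_target r (?P b)" using tests_is_free_target[of r S b] b by simp
  qed auto
  obtain b where "?P b"
    using exists_unmatched[OF M(1) _ _ _ M(2)] finite_vertex_cover tracksD(5,6)[OF tracks] T
    by metis
  moreover from this have "b < n" using vertex_cover_subset[OF T(1)] by (auto simp: unmatched_mem)
  ultimately have "reg s' found_reg < n" "?P (reg s' found_reg)" using s'(2,3) by auto
  then show thesis using that[OF _ refl] s'(1) by (simp add: mult.commute)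
qed

lemma runs_Bfs_adjacent:
  assumes tracks: "tracks s Ds S" and b: "reg s root_reg = b" "b < n"
  obtains s' where "runs B (Bfs (is_adjacent u_reg v_reg)) s (88 * (n * n)) s'"
    "bfs_levels {..<n} adj b (arr s' level_arr)"
proof -
  obtain s' where s': "runs B (Bfs (is_adjacent u_reg v_reg)) s
      (n * n * (bcost (is_adjacent u_reg v_reg) + 80)) s'"
    "bfs_levels {..<n} adj b (arr s' level_arr)"
  proof (rule runs_Bfs[of s n B b "is_adjacent u_reg v_reg" adj])
    fix r u v assume r: "u < n" "v < n" "reg r u_reg = u" "reg r v_reg = v" "bounded_state B r"
      and frame: "same_except {u_reg, v_reg, head_reg, tail_reg} {level_arr, queue_arr} s r"
    have "encodes r S" by (rule encodes_frame[OF tracksD(2)[OF tracks] frame]) auto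
    then show "tests B (is_adjacent u_reg v_reg) r (adj u v)" using tests_is_adjacent r by metis
  qed (use tracksD(1)[OF tracks] encodesD(1)[OF tracksD(2)[OF tracks]] b fits_linear in auto)
  then show thesis using that by (simp add: mult.commute)
qed

lemma runs_Deliver:
  assumes tracks: "tracks s Ds S" and M: "matching (mate_of s) S T"
    and a: "reg s token_reg = a" "a \<in> unmatched (mate_of s) S T"
    and covers: "cover (S - {a})" and len: "length Ds + n \<le> (n + 2) ^ 2"
  obtains s' where "runs B Deliver s (220 * (n * n)) s'"
    "progress (unmatched (mate_of s) S T - {a}) (length Ds + min d n) s'"
proof -
  let ?M = "mate_of s"
  have a_mem: "a \<in> S" "a < n" using a(2) tracksD(7)[OF tracks] by (auto simp: unmatched_mem)
  obtain s1 b where s1: "runs B (Find is_free_target) s (21 * n + 8) s1" "reg s1 found_reg = b"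
    and b: "b < n" "b \<in> unmatched ?M T S"
    using runs_Find_free_target[OF tracks M a(2)] .
  let ?s2 = "set_reg root_reg b s1"
  have assign: "runs B (Assign root_reg (Reg found_reg)) s1 2 ?s2"
    using runs_bounded[OF s1(1) tracksD(1)[OF tracks]] s1(2) by (intro runs_straight_eq) auto
  have tracks2: "tracks ?s2 Ds S"
    using tracks_frame[OF tracks s1(1)] b(1) fits_linear by (simp add: tracks_set_reg)
  obtain s3 where s3: "runs B (Bfs (is_adjacent u_reg v_reg)) ?s2 (88 * (n * n)) s3"
    "bfs_levels {..<n} adj b (arr s3 level_arr)"
    by (rule runs_Bfs_adjacent[OF tracks2 _ b(1)]) auto
  have tracks3: "tracks s3 Ds S" by (rule tracks_frame[OF tracks2 s3(1)]) auto
  have "hdist {..<n} (set es) b a \<le> enat d"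
    using hdist_le_hdiam[of b "{..<n}" a] b(1) a_mem(2) diam order_trans by fastforce
  then have level: "arr s3 level_arr a \<noteq> 0" "arr s3 level_arr a \<le> Suc d" "arr s3 level_arr a \<le> n"
    using bfs_levels_hdist[OF s3(2)] bfs_levels_le_card[OF s3(2)] b(1) a_mem(2) by auto
  have "reg s3 token_reg = a" using runs_reg[OF s3(1)] runs_reg[OF s1(1)] a(1) by simp
  then obtain s4 Ds' where s4: "runs B Walk s3 (100 * (n * n)) s4"
    "tracks s4 Ds' (insert b (S - {a}))" "length Ds' < length Ds + arr s3 level_arr a"
    using runs_Walk[OF tracks3 _ a_mem(1) s3(2) b(1) _ covers level(1)] level(3) len b(2)
    by (auto simp: unmatched_mem)
  have mate: "mate_of s4 = ?M"
    using runs_arr[OF s4(1)] runs_arr[OF s3(1)] runs_arr[OF s1(1)] by (intro mate_of_cong) simp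
  have "matching ?M (insert b (S - {a})) T"
    using a(2) b(2) by (intro matching_cong[OF M]) (auto simp: unmatched_mem)
  moreover have "unmatched ?M (insert b (S - {a})) T \<subseteq> unmatched ?M S T - {a}"
    using b(2) by (auto simp: unmatched_mem)
  moreover have "length Ds' \<le> length Ds + min d n" using s4(3) level by simp
  ultimately have "progress (unmatched ?M S T - {a}) (length Ds + min d n) s4"
    using progressI[OF s4(2)] unfolding mate by blast
  moreover have "runs B Deliver s (220 * (n * n)) s4"
    unfolding Deliver_def using runs_Seq[OF s1(1) runs_Seq[OF assign runs_Seq[OF s3(1) s4(1)]]]
    by (rule runs_mono) (use n_le_square in linarith)
  ultimately show thesis using that by blast
qed

lemma runs_Redirect:
  assumes tracks: "tracks s Ds S" and M: "matching (mate_of s) S T"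
    and a: "reg s token_reg = a" "a \<in> unmatched (mate_of s) S T"
    and f: "bfs_levels {..<n} (alternating (mate_of s) S T) a (arr s level_arr)"
    and stuck: "\<And>b. b \<in> unmatched (mate_of s) T S \<Longrightarrow> arr s level_arr b = 0"
    and len: "length Ds \<le> n * n + 1"
  obtains s' where "runs B Redirect s (280 * (n * n)) s'"
    "progress (unmatched (mate_of s) S T - {a}) (length Ds + min d n + 1) s'"
proof -
  let ?X = "reached (arr s level_arr) a"
  let ?S1 = "sym_diff S ?X" and ?M1 = "mate_of s |` (- ?X)"
  note release = tj_move_release[OF M a(2) f stuck tracksD(7)[OF tracks]]
    matching_release[OF M a(2) f stuck] unmatched_release[OF M a(2) f stuck]
    vertex_cover_release[OF M a(2) f stuck tracksD(5)[OF tracks] T(1)]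
  have X: "?X \<subseteq> {..<n}" "a \<notin> ?X" by (auto simp: reached_def)
  have len_snoc: "length Ds < (n + 2) ^ 2" "length (Ds @ [?S1]) + n \<le> (n + 2) ^ 2"
    using len by (auto simp: power2_eq_square algebra_simps)
  obtain s1 where s1: "runs B Release s (33 * n) s1" "encodes s1 ?S1" "mate_of s1 = ?M1"
    using runs_Release[OF tracksD(1,2)[OF tracks] a(1)] by blast
  have out: "outputs [0..<n] Ds s1"
    using tracksD(3)[OF tracks] runs_reg[OF s1(1)] runs_arr[OF s1(1)] by (simp add: outputs_def)
  have "cover ?S1" using X(1) tracksD(7)[OF tracks] by (intro vertex_cover_mono[OF release(4)]) auto
  then obtain s2 where s2: "runs B Emit s1 (26 * n) s2" "tracks s2 (Ds @ [?S1]) ?S1"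
    using runs_Emit[OF runs_bounded[OF s1(1) tracksD(1)[OF tracks]]
      s1(2) out tracksD(4)[OF tracks] release(1) _ len_snoc(1)]
    by blast
  have kept: "mate_of s2 = ?M1" "reg s2 token_reg = a"
    using s1(3) mate_of_cong[OF runs_arr[OF s2(1)]] runs_reg[OF s2(1)] runs_reg[OF s1(1)] a(1)
    by simp_all
  have "matching (mate_of s2) ?S1 T" "a \<in> unmatched (mate_of s2) ?S1 T"
    unfolding kept(1) using release(2) a(2) X(2) by (auto simp: unmatched_mem restrict_map_def)
  from runs_Deliver[OF s2(2) this(1) kept(2) this(2) release(4) len_snoc(2)]
  obtain s3 where s3: "runs B Deliver s2 (220 * (n * n)) s3"
    "progress (unmatched (mate_of s2) ?S1 T - {a}) (length (Ds @ [?S1]) + min d n) s3" .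
  have "runs B Redirect s (280 * (n * n)) s3"
    unfolding Redirect_def using runs_Seq[OF s1(1) runs_Seq[OF s2(1) s3(1)]]
    by (rule runs_mono) (use n_le_square in linarith)
  moreover have "progress (unmatched (mate_of s) S T - {a}) (length Ds + min d n + 1) s3"
    using s3(2) by (rule progress_mono) (use release(3) kept(1) in auto)
  ultimately show thesis by (rule that)
qed

subsection \<open>Matching all tokens\<close>

lemma runs_Bfs_alternating:
  assumes tracks: "tracks s Ds S" and a: "reg s root_reg = a" "a < n"
  obtains s' where "runs B (Bfs is_alternating) s (115 * (n * n)) s'"
    "bfs_levels {..<n} (alternating (mate_of s) S T) a (arr s' level_arr)"
proof -
  let ?E = "alternating (mate_of s) S T"
  obtain s' where s': "runs B (Bfs is_alternating) s (n * n * (bcost is_alternating + 80)) s'"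
    "bfs_levels {..<n} ?E a (arr s' level_arr)"
  proof (rule runs_Bfs[of s n B a is_alternating ?E])
    fix r u v assume r: "u < n" "v < n" "reg r u_reg = u" "reg r v_reg = v" "bounded_state B r"
      and frame: "same_except {u_reg, v_reg, head_reg, tail_reg} {level_arr, queue_arr} s r"
    have "encodes r S" "mate_of r = mate_of s"
      using encodes_frame[OF tracksD(2)[OF tracks] frame] mate_of_cong[OF same_except_arr[OF frame]]
      by auto
    then show "tests B is_alternating r (?E u v)" using tests_is_alternating r by metis
  qed (use tracksD(1)[OF tracks] encodesD(1)[OF tracksD(2)[OF tracks]] a fits_linear in auto)
  then show thesis using that by (simp add: mult.commute)
qed

lemma runs_Find_reached_target:
  assumes s: "bounded_state B s" "encodes s S"
  defines "P \<equiv> \<lambda>b. b \<in> unmatched (mate_of s) T S \<and> arr s level_arr b \<noteq> 0"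
  obtains s' where "runs B (Find (Conj is_free_target (is_reached cand_reg))) s (26 * n + 8) s'"
    "reg s' found_reg < n \<longrightarrow> P (reg s' found_reg)"
    "\<not> reg s' found_reg < n \<longrightarrow> (\<forall>b\<in>unmatched (mate_of s) T S. arr s level_arr b = 0)"
proof -
  let ?test = "Conj is_free_target (is_reached cand_reg)"
  obtain s' where s': "runs B (Find ?test) s (n * (bcost ?test + 11) + 8) s'"
    "reg s' found_reg < n \<longleftrightarrow> (\<exists>b<n. P b)" "reg s' found_reg < n \<longrightarrow> P (reg s' found_reg)"
  proof (rule runs_Find[OF s(1) encodesD(1)[OF s(2)], of ?test P])
    fix r b assume b: "b < n" "reg r cand_reg = b" "bounded_state B r"
      and frame: "same_except {cand_reg, found_reg} {} s r"
    have "encodes r S" "mate_of r = mate_of s" "arr r level_arr = arr s level_arr"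
      using encodes_frame[OF s(2) frame] mate_of_cong[OF same_except_arr[OF frame]]
        same_except_arr[OF frame] by auto
    then show "tests B ?test r (P b)"
      using tests_Conj[OF tests_is_free_target[of r S b] tests_is_reached[of r cand_reg b]] b
      by (simp add: P_def)
  qed auto
  have "b < n" if "b \<in> unmatched (mate_of s) T S" for b
    using that vertex_cover_subset[OF T(1)] by (auto simp: unmatched_mem)
  then have "\<not> reg s' found_reg < n \<longrightarrow> (\<forall>b\<in>unmatched (mate_of s) T S. arr s level_arr b = 0)"
    using s'(2) by (auto simp: P_def)
  then show thesis using that[OF _ s'(3)] s'(1) by (simp add: mult.commute)
qed

lemma runs_Augment_or_Redirect:
  assumes tracks: "tracks s Ds S" and M: "matching (mate_of s) S T"
    and a: "reg s token_reg = a" "a \<in> unmatched (mate_of s) S T" and len: "length Ds \<le> n * n + 1"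
    and f: "bfs_levels {..<n} (alternating (mate_of s) S T) a (arr s level_arr)"
    and found: "reg s found_reg < n \<longrightarrow>
      reg s found_reg \<in> unmatched (mate_of s) T S \<and> arr s level_arr (reg s found_reg) \<noteq> 0"
    and stuck: "\<not> reg s found_reg < n \<longrightarrow> (\<forall>b\<in>unmatched (mate_of s) T S. arr s level_arr b = 0)"
  obtains s' where
    "runs B (Cond (Less (Reg found_reg) (Reg n_reg)) Augment Redirect) s (280 * (n * n) + 4) s'"
    "progress (unmatched (mate_of s) S T - {a}) (length Ds + min d n + 1) s'"
proof -
  let ?test = "Less (Reg found_reg) (Reg n_reg)"
  have test: "tests B ?test s (reg s found_reg < n)"
    using tracksD(1)[OF tracks] encodesD(1)[OF tracksD(2)[OF tracks]] by (auto simp: tests_def)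
  show thesis
  proof (cases "reg s found_reg < n")
    case True
    then obtain s' where s': "runs B Augment s (80 * (n * n)) s'" "matching (mate_of s') S T"
      "unmatched (mate_of s') S T \<subseteq> unmatched (mate_of s) S T - {a}"
      using runs_Augment[OF tracksD(1,2)[OF tracks] M a(2) f] found by blast
    have "tests B ?test s True" using test True by simp
    from runs_Cond_True[OF this s'(1)]
    have "runs B (Cond ?test Augment Redirect) s (280 * (n * n) + 4) s'" by (rule runs_mono) simp
    moreover have "tracks s' Ds S" by (rule tracks_frame[OF tracks s'(1)]) auto
    then have "progress (unmatched (mate_of s) S T - {a}) (length Ds + min d n + 1) s'"
      by (rule progressI[OF _ s'(2,3)]) simp
    ultimately show thesis by (rule that)
  next
    case False
    then have no_end: "arr s level_arr b = 0" if "b \<in> unmatched (mate_of s) T S" for b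
      using stuck that by blast
    obtain s' where s': "runs B Redirect s (280 * (n * n)) s'"
      "progress (unmatched (mate_of s) S T - {a}) (length Ds + min d n + 1) s'"
      by (rule runs_Redirect[OF tracks M a f no_end len])
    have "tests B ?test s False" using test False by simp
    from runs_Cond_False[OF this s'(1)]
    have "runs B (Cond ?test Augment Redirect) s (280 * (n * n) + 4) s'" by (rule runs_mono) simp
    then show thesis using s'(2) by (rule that)
  qed
qed

lemma runs_Match_Token:
  assumes tracks: "tracks s Ds S" and M: "matching (mate_of s) S T"
    and a: "reg s token_reg = a" "a \<in> unmatched (mate_of s) S T" and len: "length Ds \<le> n * n + 1"
  obtains s' where "runs B Match_Token s (440 * (n * n)) s'"
    "progress (unmatched (mate_of s) S T - {a}) (length Ds + min d n + 1) s'"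
proof -
  let ?s1 = "set_reg root_reg a s"
  have a_less: "a < n" using a(2) tracksD(7)[OF tracks] by (auto simp: unmatched_mem)
  have assign: "runs B (Assign root_reg (Reg token_reg)) s 2 ?s1"
    using tracksD(1)[OF tracks] a(1) by (intro runs_straight_eq) auto
  have tracks1: "tracks ?s1 Ds S" using tracks a_less fits_linear by (simp add: tracks_set_reg)
  obtain s2 where s2: "runs B (Bfs is_alternating) ?s1 (115 * (n * n)) s2"
    "bfs_levels {..<n} (alternating (mate_of s) S T) a (arr s2 level_arr)"
    using runs_Bfs_alternating[OF tracks1 _ a_less] by auto
  have tracks2: "tracks s2 Ds S" by (rule tracks_frame[OF tracks1 s2(1)]) auto
  have mate2: "mate_of s2 = mate_of s" using mate_of_cong[OF runs_arr[OF s2(1)]] by simp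
  obtain s3 where s3: "runs B (Find (Conj is_free_target (is_reached cand_reg))) s2 (26 * n + 8) s3"
    "reg s3 found_reg < n \<longrightarrow>
      reg s3 found_reg \<in> unmatched (mate_of s2) T S \<and> arr s2 level_arr (reg s3 found_reg) \<noteq> 0"
    "\<not> reg s3 found_reg < n \<longrightarrow> (\<forall>b\<in>unmatched (mate_of s2) T S. arr s2 level_arr b = 0)"
    using runs_Find_reached_target[OF tracksD(1,2)[OF tracks2]] .
  have tracks3: "tracks s3 Ds S" by (rule tracks_frame[OF tracks2 s3(1)]) auto
  have mate3: "mate_of s3 = mate_of s" and level3: "arr s3 level_arr = arr s2 level_arr"
    and token3: "reg s3 token_reg = a"
    using mate_of_cong[OF runs_arr[OF s3(1)]] mate2 runs_arr[OF s3(1)] runs_reg[OF s3(1)]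
      runs_reg[OF s2(1)] a(1) by simp_all
  obtain s4 where
    s4: "runs B (Cond (Less (Reg found_reg) (Reg n_reg)) Augment Redirect)
      s3 (280 * (n * n) + 4) s4"
    "progress (unmatched (mate_of s3) S T - {a}) (length Ds + min d n + 1) s4"
    by (rule runs_Augment_or_Redirect[OF tracks3 _ token3 _ len])
      (use M a(2) s2(2) s3(2,3) mate2 mate3 level3 in simp_all)
  have "runs B Match_Token s (440 * (n * n)) s4"
    unfolding Match_Token_def using runs_Seq[OF assign runs_Seq[OF s2(1) runs_Seq[OF s3(1) s4(1)]]]
    by (rule runs_mono) (use n_le_square in linarith)
  then show thesis using s4(2) unfolding mate3 by (rule that)
qed

abbreviation match_inv :: "nat \<Rightarrow> state \<Rightarrow> bool" where
  "match_inv i \<equiv> progress {i..} (1 + i * (min d n + 1))"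

lemma runs_Match_If_Unmatched:
  assumes inv: "match_inv a s" and a: "reg s token_reg = a" "a < n"
  obtains s' where "runs B Match_If_Unmatched s (440 * (n * n) + 11) s'" "match_inv (Suc a) s'"
proof -
  let ?test = "Conj (is_source token_reg) (is_unmatched token_reg)"
  obtain S Ds where tracks: "tracks s Ds S" and M: "matching (mate_of s) S T"
    and matched: "unmatched (mate_of s) S T \<subseteq> {a..}" and len: "length Ds \<le> 1 + a * (min d n + 1)"
    using inv by (auto simp: progress_def)
  have test: "tests B ?test s (a \<in> unmatched (mate_of s) S T)"
    unfolding unmatched_mem using tracksD(1,2)[OF tracks] a
    by (intro tests_Conj tests_is_source tests_is_unmatched) auto
  have after: "unmatched (mate_of s) S T - {a} \<subseteq> {Suc a..}" using matched by force
  show thesis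
  proof (cases "a \<in> unmatched (mate_of s) S T")
    case True
    have "a * (min d n + 1) \<le> a * (n + 1)" by (intro mult_left_mono) auto
    also have "\<dots> \<le> Suc a * n" using a(2) by simp
    also have "\<dots> \<le> n * n" using a(2) by (intro mult_right_mono) auto
    finally have "length Ds \<le> n * n + 1" using len by simp
    from runs_Match_Token[OF tracks M a(1) True this]
    obtain s' where s': "runs B Match_Token s (440 * (n * n)) s'"
      "progress (unmatched (mate_of s) S T - {a}) (length Ds + min d n + 1) s'" .
    have "tests B ?test s True" using test True by simp
    from runs_Cond_True[OF this s'(1)] have "runs B Match_If_Unmatched s (440 * (n * n) + 11) s'"
      unfolding Match_If_Unmatched_def by (rule runs_mono) simp
    moreover have "match_inv (Suc a) s'"
      using s'(2) after by (rule progress_mono) (use len in simp)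
    ultimately show thesis by (rule that)
  next
    case False
    then have "tests B ?test s False" using test by simp
    from runs_Cond_False[OF this runs_Skip]
      have "runs B Match_If_Unmatched s (440 * (n * n) + 11) s"
      unfolding Match_If_Unmatched_def by (rule runs_mono) (use n_pos in simp)
    moreover have "match_inv (Suc a) s"
      by (rule progressI[OF tracks M]) (use False after len in auto)
    ultimately show thesis by (rule that)
  qed
qed

lemma runs_Match_Tokens:
  assumes tracks: "tracks s [S0] S0" and mate: "mate_of s = Map.empty"
  obtains s' S Ds where "runs B Match_Tokens s (n * (440 * (n * n) + 19) + 6) s'" "tracks s' Ds S"
    "tj_move {..<n} (set es) S T" "length Ds \<le> 1 + n * (min d n + 1)"
proof -
  note n = encodesD(1)[OF tracksD(2)[OF tracks]]
  obtain s' where s': "runs B Match_Tokens s (n * (440 * (n * n) + 11 + 8) + 6) s'" "match_inv n s'"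
    unfolding Match_Tokens_def
  proof (rule runs_For[OF tracksD(1)[OF tracks], of token_reg Match_If_Unmatched n_reg match_inv])
    show "match_inv 0 s" using matching_empty by (intro progressI[OF tracks]) (simp_all add: mate)
    show "match_inv i (set_reg token_reg j r)" if "j < B" "match_inv i r" for i j r
      using that tracks_set_reg[of r _ _ token_reg j] unfolding progress_def by fastforce
    show "\<exists>r'. runs B Match_If_Unmatched r (440 * (n * n) + 11) r' \<and> match_inv (Suc a) r'"
      if "a < reg s n_reg" "reg r token_reg = a" "match_inv a r" for a r
      by (rule runs_Match_If_Unmatched[OF that(3,2)]) (use that(1) n in auto)
  qed (use n in auto)
  obtain S Ds where tracks': "tracks s' Ds S" and M: "matching (mate_of s') S T"
    and matched: "unmatched (mate_of s') S T \<subseteq> {n..}" and len: "length Ds \<le> 1 + n * (min d n + 1)"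
    using s'(2) by (auto simp: progress_def)
  have "unmatched (mate_of s') S T = {}"
    using matched tracksD(7)[OF tracks'] by (fastforce simp: unmatched_mem)
  then have "tj_move {..<n} (set es) S T"
    using tj_move_complete_matching[OF M tracksD(7)[OF tracks']] finite_vertex_cover
      tracksD(5,6)[OF tracks'] T by simp
  then show thesis using that s'(1) tracks' len by (simp add: add.assoc)
qed

lemma runs_Finish:
  assumes tracks: "tracks s Ds S" and move: "tj_move {..<n} (set es) S T"
    and len: "length Ds < (n + 2) ^ 2"
  obtains s' where "runs B Finish s (44 * n) s'" "tracks s' (Ds @ [T]) T"
proof -
  let ?copy = "Store config_arr (Reg idx_reg) (Arr target_arr (Reg idx_reg))"
  note s = tracksD(1,2)[OF tracks] and n = encodesD(1)[OF tracksD(2)[OF tracks]]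
  obtain s1 where s1: "runs B (For idx_reg n_reg ?copy) s (n * (4 + 8) + 6) s1"
    "\<forall>v<n. arr s1 config_arr v = of_bool (v \<in> T)"
  proof (rule runs_For_straight[OF s(1), of idx_reg ?copy n_reg
        "\<lambda>i r. \<forall>v<i. arr r config_arr v = of_bool (v \<in> T)" 4])
    fix i r assume r: "i < reg s n_reg" "reg r idx_reg = i" "bounded_state B r"
        "\<forall>v<i. arr r config_arr v = of_bool (v \<in> T)"
      and frame: "same_except (insert idx_reg (written_regs ?copy)) (written_arrs ?copy) s r"
    have "arr r target_arr i = of_bool (i \<in> T)"
      using same_except_arr[OF frame] encodesD(3)[OF s(2)] r(1) n by simp
    then show "wp B ?copy r (\<lambda>r'. \<forall>v<Suc i. arr r' config_arr v = of_bool (v \<in> T))"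
      using r(2-4) bounded_reg[OF r(3), of idx_reg] by (auto simp: less_Suc_eq)
  qed (use n in auto)
  have encoded: "encodes s1 T"
    by (rule encodes_update[OF s(2) runs_same_except[OF s1(1)]]) (use s1(2) in auto)
  have out: "outputs [0..<n] Ds s1"
    using tracksD(3)[OF tracks] runs_reg[OF s1(1)] runs_arr[OF s1(1)] by (simp add: outputs_def)
  obtain s2 where s2: "runs B Emit s1 (26 * n) s2" "tracks s2 (Ds @ [T]) T"
    using runs_Emit[OF runs_bounded[OF s1(1) s(1)]
      encoded out tracksD(4)[OF tracks] move T(1) len] .
  have "runs B Finish s (44 * n) s2"
    unfolding Finish_def using runs_Seq[OF s1(1) s2(1)] by (rule runs_mono) (use n_pos in simp)
  then show thesis using that s2(2) by blast
qed

subsection \<open>The complete program\<close>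

lemma bounded_input_state: "bounded_state B (input_state [0..<n] es k S0 T)"
proof -
  have "k \<le> n" using card_mono[of "{..<n}" S0] S0 vertex_cover_subset by fastforce
  moreover have "length es * 1 \<le> length es * n" using n_pos by (intro mult_left_mono) auto
  then have "length es < B" using fits_index(2)[of "length es" 0] n_pos by linarith
  ultimately show ?thesis
    using fits_linear by (simp add: bounded_state_def input_state_def)
qed

lemma runs_Prepare:
  fixes s defines "s \<equiv> input_state [0..<n] es k S0 T"
  obtains s' where "runs B Prepare s (length es * (n * (n * 33 + 14) + 14) + 16 * n + 12) s'"
    "tracks s' [S0] S0" "mate_of s' = Map.empty"
proof -
  have bounded: "bounded_state B s" unfolding s_def by (rule bounded_input_state)
  have "reads_incidence s"
    unfolding reads_incidence_def
  proof (intro conjI allI impI)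
    fix e u assume eu: "e < length es" "u < n"
    have "Suc e * n \<le> length es * n" using eu by (intro mult_right_mono) auto
    then show "arr s inc_arr (e * n + u) = of_bool (u \<in> es ! e)"
      using eu by (simp add: s_def input_state_def)
  qed (simp_all add: s_def input_state_def)
  then obtain s1 where s1: "runs B Adjacency s (length es * (n * (n * 33 + 14) + 14) + 6) s1"
    "\<forall>u<n. \<forall>v<n. arr s1 adj_arr (u * n + v) = of_bool (adj u v)"
    using runs_Adjacency[OF bounded] by (auto simp: s_def input_state_def)
  have encoded1: "encodes s1 S0"
    using s1(2) runs_reg[OF s1(1)] runs_arr[OF s1(1)]
    by (simp add: encodes_def s_def input_state_def)
  have "reg s1 moves_reg = 0" using runs_reg[OF s1(1)] by (simp add: s_def input_state_def)
  then obtain s2 where s2: "runs B Write_Config s1 (16 * n + 6) s2"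
    "\<And>v. v < n \<Longrightarrow> arr s2 out_arr (0 * n + v) = of_bool (v \<in> S0)"
    using runs_Write_Config[OF runs_bounded[OF s1(1) bounded] encoded1, of 0] by auto
  have "outputs [0..<n] [S0] s2"
    using s2(2) \<open>reg s1 moves_reg = 0\<close> runs_reg[OF s2(1)] by (simp add: outputs_def)
  moreover have "encodes s2 S0" by (rule encodes_frame[OF encoded1 runs_same_except[OF s2(1)]]) auto
  ultimately have "tracks s2 [S0] S0"
    using runs_bounded[OF s2(1) runs_bounded[OF s1(1) bounded]] reconfigures_refl[OF S0]
    by (simp add: tracks_def)
  moreover have "mate_of s2 = Map.empty"
    using runs_arr[OF s2(1)] runs_arr[OF s1(1)]
    by (simp add: mate_of_def fun_eq_iff s_def input_state_def)
  moreover have "runs B Prepare s (length es * (n * (n * 33 + 14) + 14) + 16 * n + 12) s2"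
    unfolding Prepare_def using runs_Seq[OF s1(1) s2(1)] by (rule runs_mono) simp
  ultimately show thesis using that by blast
qed

lemma runs_Match_Finish:
  assumes tracks: "tracks s [S0] S0" and mate: "mate_of s = Map.empty" and n: "1 < n"
  obtains s' Ds where "runs B (Match_Tokens ;; Finish) s (510 * (n * n * n)) s'" "tracks s' Ds T"
    "length Ds - 1 \<le> 3 * (n * d)"
proof -
  obtain s1 S Ds where s1: "runs B Match_Tokens s (n * (440 * (n * n) + 19) + 6) s1"
    "tracks s1 Ds S"
    "tj_move {..<n} (set es) S T" "length Ds \<le> 1 + n * (min d n + 1)"
    using runs_Match_Tokens[OF tracks mate] by blast
  have "n * (min d n + 1) \<le> n * (n + 1)" by (intro mult_left_mono) auto
  moreover have "(n + 2) ^ 2 = n * (n + 1) + 3 * n + 4"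
    by (simp add: power2_eq_square algebra_simps)
  ultimately have "length Ds < (n + 2) ^ 2" using s1(4) by linarith
  then obtain s2 where s2: "runs B Finish s1 (44 * n) s2" "tracks s2 (Ds @ [T]) T"
    using runs_Finish[OF s1(2,3)] by blast
  have "d \<noteq> 0"
  proof
    assume "d = 0"
    then have "hdist {..<n} (set es) 0 1 \<le> 0"
      using hdist_le_hdiam[of 0 "{..<n}" 1 "set es"] diam n
      by (auto simp: zero_enat_def elim: order_trans)
    then show False using hdist_le_0_imp_eq by fastforce
  qed
  then have "n \<le> n * d" by simp
  moreover have "n * (min d n + 1) \<le> n * (d + 1)" by (intro mult_left_mono) auto
  moreover have "n * (d + 1) = n * d + n" by simp
  ultimately have moves: "length (Ds @ [T]) - 1 \<le> 3 * (n * d)" using s1(4) n by (simp, linarith)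
  have "n \<le> n * n * n" "1 \<le> n * n * n" using n by auto
  moreover have "n * (440 * (n * n) + 19) = 440 * (n * n * n) + 19 * n"
    by (simp add: algebra_simps)
  ultimately have "(n * (440 * (n * n) + 19) + 6) + 44 * n \<le> 510 * (n * n * n)" by linarith
  then have "runs B (Match_Tokens ;; Finish) s (510 * (n * n * n)) s2"
    by (rule runs_mono[OF runs_Seq[OF s1(1) s2(1)]])
  then show thesis using that s2(2) moves by blast
qed

lemma runs_Cond_Match_Finish:
  assumes tracks: "tracks s [S0] S0" and mate: "mate_of s = Map.empty"
  obtains s' Ds where
    "runs B (Cond (Less (Const 1) (Reg n_reg)) (Match_Tokens ;; Finish) Skip) s
      (4 + 510 * (n * n * n)) s'" "tracks s' Ds T" "length Ds - 1 \<le> 3 * (n * d)"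
proof -
  have test: "tests B (Less (Const 1) (Reg n_reg)) s (1 < n)"
    using tracksD(1)[OF tracks] encodesD(1)[OF tracksD(2)[OF tracks]] by (auto simp: tests_def)
  show thesis
  proof (cases "1 < n")
    case True
    then obtain s' Ds where s': "runs B (Match_Tokens ;; Finish) s (510 * (n * n * n)) s'"
      "tracks s' Ds T" "length Ds - 1 \<le> 3 * (n * d)"
      using runs_Match_Finish[OF tracks mate] by blast
    have "tests B (Less (Const 1) (Reg n_reg)) s True" using test True by simp
    from runs_Cond_True[OF this s'(1)]
    have "runs B (Cond (Less (Const 1) (Reg n_reg)) (Match_Tokens ;; Finish) Skip) s
        (4 + 510 * (n * n * n)) s'"
      by (rule runs_mono) simp
    then show thesis using s'(2,3) by (rule that)
  next
    case False
    then have "n = 1" using n_pos by simp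
    then have "S0 \<subseteq> {0}" "T \<subseteq> {0}" using S0(1) T(1) vertex_cover_subset by fastforce+
    then have "S0 = T" using S0(2) T(2) by (auto simp: subset_singleton_iff)
    moreover have "tests B (Less (Const 1) (Reg n_reg)) s False" using test False by simp
    from runs_Cond_False[OF this runs_Skip]
    have "runs B (Cond (Less (Const 1) (Reg n_reg)) (Match_Tokens ;; Finish) Skip) s
        (4 + 510 * (n * n * n)) s"
      by (rule runs_mono) (use n_pos in simp)
    ultimately show thesis using that[of s "[S0]"] tracks by simp
  qed
qed

lemma runs_Reconfigure:
  obtains s Ds where
    "runs B Reconfigure (input_state [0..<n] es k S0 T) (600 * (n * n * n + n * n * length es)) s"
    "outputs [0..<n] Ds s" "reconfigures {..<n} (set es) k S0 Ds T" "length Ds - 1 \<le> 3 * (n * d)"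
proof -
  let ?s = "input_state [0..<n] es k S0 T"
  obtain s1 where s1: "runs B Prepare ?s (length es * (n * (n * 33 + 14) + 14) + 16 * n + 12) s1"
    "tracks s1 [S0] S0" "mate_of s1 = Map.empty"
    using runs_Prepare by blast
  obtain s2 Ds where s2: "tracks s2 Ds T" "length Ds - 1 \<le> 3 * (n * d)"
    "runs B (Cond (Less (Const 1) (Reg n_reg)) (Match_Tokens ;; Finish) Skip) s1
      (4 + 510 * (n * n * n)) s2"
    using runs_Cond_Match_Finish[OF s1(2,3)] by blast
  have "n * (n * 33 + 14) = 33 * (n * n) + 14 * n" by (simp add: algebra_simps)
  then have "n * (n * 33 + 14) + 14 \<le> 61 * (n * n)" using n_le_square by linarith
  then have "length es * (n * (n * 33 + 14) + 14) \<le> length es * (61 * (n * n))"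
    by (rule mult_left_mono) simp
  also have "\<dots> = 61 * (n * n * length es)" by simp
  finally have adjacency: "length es * (n * (n * 33 + 14) + 14) \<le> 61 * (n * n * length es)" .
  have "n \<le> n * n * n" "1 \<le> n * n * n" using n_pos by auto
  then have "(length es * (n * (n * 33 + 14) + 14) + 16 * n + 12) +
      (4 + 510 * (n * n * n)) \<le> 600 * (n * n * n + n * n * length es)"
    using adjacency unfolding distrib_left by linarith
  then have "runs B Reconfigure ?s (600 * (n * n * n + n * n * length es)) s2"
    unfolding Reconfigure_def by (rule runs_mono[OF runs_Seq[OF s1(1) s2(3)]])
  then show thesis using that tracksD(3,4)[OF s2(1)] s2(2) by blast
qed

end

section \<open>Renaming the vertices\<close>

lemma nth_map_mem_image_iff:
  assumes "inj_on g (set xs)" "i < length xs" "C \<subseteq> set xs"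
  shows "map g xs ! i \<in> g ` C \<longleftrightarrow> xs ! i \<in> C"
  using inj_on_image_mem_iff[OF assms(1) nth_mem[OF assms(2)] assms(3)] assms(2) by simp

lemma input_state_map:
  assumes inj: "inj_on g (set xs)" and sub: "S \<subseteq> set xs" "T \<subseteq> set xs" "\<And>e. e \<in> set es \<Longrightarrow> e \<subseteq> set xs"
  shows "input_state (map g xs) (map ((`) g) es) k (g ` S) (g ` T) = input_state xs es k S T"
proof -
  have "map g xs ! (a mod length xs) \<in> map ((`) g) es ! (a div length xs) \<longleftrightarrow>
      xs ! (a mod length xs) \<in> es ! (a div length xs)" if a: "a < length es * length xs" for a
  proof -
    have "a div length xs < length es" using a by (rule less_mult_imp_div_less)
    moreover have "a mod length xs < length xs" using a by (cases "xs = []") auto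
    ultimately show ?thesis using nth_map_mem_image_iff[OF inj] sub(3) nth_mem by simp
  qed
  then show ?thesis
    using nth_map_mem_image_iff[OF inj _ sub(1)] nth_map_mem_image_iff[OF inj _ sub(2)]
    by (simp add: input_state_def cong: if_cong)
qed

lemma outputs_map:
  assumes "outputs xs Ds s" "inj_on g (set xs)" "\<And>D. D \<in> set Ds \<Longrightarrow> D \<subseteq> set xs"
  shows "outputs (map g xs) (map ((`) g) Ds) s"
  using assms(1) nth_map_mem_image_iff[OF assms(2)] assms(3) by (simp add: outputs_def)

lemma index_of_distinct:
  assumes "distinct xs"
  obtains idx where "inj_on idx (set xs)" "map idx xs = [0..<length xs]"
    "\<And>v. v \<in> set xs \<Longrightarrow> xs ! idx v = v"
proof -
  define idx where "idx = inv_into {..<length xs} ((!) xs)"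
  have nth: "bij_betw ((!) xs) {..<length xs} (set xs)"
    using assms by (intro bij_betw_nth) auto
  show thesis
  proof
    show "inj_on idx (set xs)"
      using bij_betw_inv_into[OF nth] by (simp add: idx_def bij_betw_def)
    show "map idx xs = [0..<length xs]"
      using bij_betw_inv_into_left[OF nth] by (intro nth_equalityI) (simp_all add: idx_def)
    show "xs ! idx v = v" if "v \<in> set xs" for v
      using bij_betw_inv_into_right[OF nth that] by (simp add: idx_def)
  qed
qed

lemma ram_instance_image:
  assumes hyper: "hypergraph V (set es)" and diam: "hdiam V (set es) \<le> enat d"
    and S: "vertex_cover V (set es) S" "card S = k" and T: "vertex_cover V (set es) T" "card T = k"
    and g: "inj_on g V" "g ` V = {..<n}"
  shows "ram_instance n (map ((`) g) es) (g ` S) (g ` T) k d ((n + length es + 2) ^ 3)"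
proof
  have F: "set (map ((`) g) es) = (`) g ` set es" by simp
  show "hypergraph {..<n} (set (map ((`) g) es))"
    using hyper unfolding F g(2)[symmetric] hypergraph_def by blast
  show "vertex_cover {..<n} (set (map ((`) g) es)) (g ` S)"
    "vertex_cover {..<n} (set (map ((`) g) es)) (g ` T)"
    unfolding F g(2)[symmetric] by (intro vertex_cover_image S(1) T(1))+
  show "card (g ` S) = k" "card (g ` T) = k"
    using card_image[OF inj_on_subset[OF g(1)]] vertex_cover_subset S T by metis+
  show "hdiam {..<n} (set (map ((`) g) es)) \<le> enat d"
    unfolding F g(2)[symmetric] using hdiam_image_le diam by (rule order_trans)
qed simp

lemma Reconfigure_correct:
  fixes V :: "'a set"
  assumes hyper: "hypergraph V F" and diam: "hdiam V F \<le> enat d"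
    and S: "vertex_cover V F S" "card S = k" and T: "vertex_cover V F T" "card T = k"
    and xs: "distinct xs" "set xs = V" and es: "set es = F"
  defines "n \<equiv> length xs" and "m \<equiv> length es"
  obtains t s Ds where "exec ((n + m + 2) ^ 3) Reconfigure (input_state xs es k S T) t s"
    "t \<le> 600 * (n * n * n + n * n * m)" "outputs xs Ds s" "reconfigures V F k S Ds T"
    "length Ds - 1 \<le> 3 * (n * d)"
proof -
  obtain idx where idx: "inj_on idx V" "map idx xs = [0..<n]" "\<And>v. v \<in> V \<Longrightarrow> xs ! idx v = v"
    using index_of_distinct[OF xs(1)] unfolding xs(2) n_def by blast
  have idx_V: "idx ` V = {..<n}"
    using arg_cong[OF idx(2), of set] xs(2) by (simp add: atLeast0LessThan)
  have sub: "S \<subseteq> V" "T \<subseteq> V" "\<And>e. e \<in> F \<Longrightarrow> e \<subseteq> V"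
    using vertex_cover_subset[OF S(1)] vertex_cover_subset[OF T(1)] hyper
    by (auto simp: hypergraph_def)
  have nth_idx: "(!) xs ` idx ` C = C" if "C \<subseteq> V" for C
    using that idx(3) unfolding image_image by (auto simp: subset_iff image_iff)
  let ?es = "map ((`) idx) es"
  have es_idx: "set ?es = (`) idx ` F" using es by simp
  interpret ram_instance n ?es "idx ` S" "idx ` T" k d "(n + m + 2) ^ 3"
    unfolding m_def by (rule ram_instance_image[OF _ _ _ _ _ _ idx(1) idx_V])
      (use hyper diam S T es in auto)
  obtain s Ds where s: "outputs [0..<n] Ds s"
      "runs ((n + m + 2) ^ 3) Reconfigure (input_state [0..<n] ?es k (idx ` S) (idx ` T))
        (600 * (n * n * n + n * n * length ?es)) s"
    and Ds: "reconfigures {..<n} (set ?es) k (idx ` S) Ds (idx ` T)" "length Ds - 1 \<le> 3 * (n * d)"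
    by (rule runs_Reconfigure)
  have "input_state [0..<n] ?es k (idx ` S) (idx ` T) = input_state xs es k S T"
    using input_state_map[of idx xs S T es k] idx(1,2) sub xs(2) es by simp
  then obtain t where t: "exec ((n + m + 2) ^ 3) Reconfigure (input_state xs es k S T) t s"
    "t \<le> 600 * (n * n * n + n * n * m)"
    using s(2) by (auto simp: runs_def m_def)
  have inj: "inj_on ((!) xs) {..<n}" using xs(1) by (simp add: n_def inj_on_nth)
  have "D \<subseteq> {..<n}" if "D \<in> set Ds" for D
    using Ds(1) that by (auto simp: reconfigures_def reconf_seq_def vertex_cover_def)
  then have "outputs (map ((!) xs) [0..<n]) (map ((`) ((!) xs)) Ds) s"
    using inj by (intro outputs_map s(1)) (simp_all add: atLeast0LessThan)
  then have "outputs xs (map ((`) ((!) xs)) Ds) s" by (simp add: n_def map_nth)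
  moreover have "(`) ((!) xs) ` set ?es = F"
    unfolding es_idx image_image[of "(`) ((!) xs)"] using nth_idx sub(3) by simp
  then have "reconfigures V F k S (map ((`) ((!) xs)) Ds) T"
    using reconfigures_image[OF Ds(1) inj] nth_idx sub(1,2) by (simp flip: idx_V)
  ultimately show thesis using that[OF t] Ds(2) by simp
qed

lemma cube_le_powr: "real n ^ 3 \<le> real n powr (7 / 2)"
proof (cases "n = 0")
  case False
  then have "real n powr 3 \<le> real n powr (7 / 2)" by (intro powr_mono) auto
  then show ?thesis using False by simp
qed simp

theorem theorem2:
  "\<exists>(prog :: com) (w :: nat) (C1 :: real) (C2 :: real).
     \<forall>(V :: 'a set) (F :: 'a set set) (n :: nat) (m :: nat) (d :: nat) (k :: nat)
        (Vs :: 'a set) (Vt :: 'a set) (xs :: 'a list) (es :: 'a set list).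
       hypergraph V F \<longrightarrow> hconnected V F \<longrightarrow>
       card V = n \<longrightarrow> card F = m \<longrightarrow> hdiam V F = enat d \<longrightarrow>
       vertex_cover V F Vs \<longrightarrow> card Vs = k \<longrightarrow>
       vertex_cover V F Vt \<longrightarrow> card Vt = k \<longrightarrow>
       distinct xs \<longrightarrow> set xs = V \<longrightarrow> distinct es \<longrightarrow> set es = F \<longrightarrow>
       (\<exists>t s Ds.
          exec ((n + m + 2) ^ w) prog (input_state xs es k Vs Vt) t s \<and>
          real t \<le> C1 * (real n powr (7 / 2) + real n ^ 2 * real m) \<and>
          outputs xs Ds s \<and>
          reconf_seq V F k Ds \<and> hd Ds = Vs \<and> last Ds = Vt \<and>
          real (length Ds - 1) \<le> C2 * (real n * real d))"
proof (rule exI[of _ Reconfigure], rule exI[of _ 3], rule exI[of _ 600], rule exI[of _ 3],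
    intro allI impI)
  fix V :: "'a set" and F :: "'a set set" and n m d k :: nat and Vs Vt :: "'a set"
    and xs :: "'a list" and es :: "'a set list"
  assume hyper: "hypergraph V F" and n: "card V = n" and m: "card F = m"
    and diam: "hdiam V F = enat d"
    and Vs: "vertex_cover V F Vs" "card Vs = k" and Vt: "vertex_cover V F Vt" "card Vt = k"
    and xs: "distinct xs" "set xs = V" and es: "distinct es" "set es = F"
  have len: "length xs = n" "length es = m" using n m xs es distinct_card by fastforce+
  obtain t s Ds where run: "exec ((n + m + 2) ^ 3) Reconfigure (input_state xs es k Vs Vt) t s"
    and time: "t \<le> 600 * (n * n * n + n * n * m)" and out: "outputs xs Ds s"
    and Ds: "reconfigures V F k Vs Ds Vt" and moves: "length Ds - 1 \<le> 3 * (n * d)"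
    by (rule Reconfigure_correct[OF hyper eq_refl[OF diam] Vs Vt xs es(2), unfolded len])
  have "real t \<le> real (600 * (n * n * n + n * n * m))" using time by (rule of_nat_mono)
  also have "\<dots> \<le> 600 * (real n powr (7 / 2) + real n ^ 2 * real m)"
    using cube_le_powr[of n] by (simp add: power2_eq_square power3_eq_cube)
  finally have time: "real t \<le> 600 * (real n powr (7 / 2) + real n ^ 2 * real m)" .
  have "real (length Ds - 1) \<le> 3 * (real n * real d)"
    using moves of_nat_mono[OF moves, where 'a = real] by simp
  then show "\<exists>t s Ds. exec ((n + m + 2) ^ 3) Reconfigure (input_state xs es k Vs Vt) t s \<and>
      real t \<le> 600 * (real n powr (7 / 2) + real n ^ 2 * real m) \<and> outputs xs Ds s \<and>
      reconf_seq V F k Ds \<and> hd Ds = Vs \<and> last Ds = Vt \<and>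
      real (length Ds - 1) \<le> 3 * (real n * real d)"
    using run time out Ds by (auto simp: reconfigures_def)
qed

end
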